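(* Consider the LDA model described in the context, with a fixed number $D$ of documents, document lengths $N_{1\cdot\cdot},\dots,N_{D\cdot\cdot}$ i.i.d. from a common distribution such that, for some $\iota>0$ and some scaling function $b\in RV_{1/\iota}$, $t\,\mathbb{P}(N_{1\cdot\cdot}>b(t)x)\to x^{-\iota}=\nu_\iota((x,\infty))$ as $t\to\infty$ for every $x>0$, and $\theta_1,\dots,\theta_D$ i.i.d. $\text{Dirichlet}(\alpha_1,\dots,\alpha_K)$. (a) For each $d$, $(N_{d\cdot 1},\dots,N_{d\cdot W})\in \text{MRV}(\iota,b(t),\mu,\mathbb{R}_+^W\setminus\{0\})$, where $\mu\in\mathbb{M}(\mathbb{R}_+^W\setminus\{0\})$ satisfies, for any $f\in\mathcal{C}(\mathbb{R}_+^W\setminus\{0\})$, $$\mu(f)=\int_0^\infty \mathbb{E}[f(y\Phi\theta_d)]\,\nu_\iota(dy).$$ Hence, in $\mathbb{M}(\Delta^{W-1}\times(\mathbb{R}_+\setminus\{0\}))$, as $t\to\infty$, $$t\,\mathbb{P}\left[\left(\left(\frac{N_{d\cdot1}}{N_{d\cdot\cdot}},\dots,\frac{N_{d\cdot W}}{N_{d\cdot\cdot}}\right),\frac{N_{d\cdot\cdot}}{b(t)}\right)\in\cdot\right]\to \mathbb{P}(\Phi\theta_d\in\cdot)\times\nu_\iota(\cdot).$$ (b) For each $d$, $(N_{d1\cdot},\dots,N_{dK\cdot})\in\text{MRV}(\iota,b(t),\eta,\mathbb{R}_+^K\setminus\{0\})$, where $\eta\in\mathbb{M}(\mathbb{R}_+^K\setminus\{0\})$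 satisfies, for any $f\in\mathcal{C}(\mathbb{R}_+^K\setminus\{0\})$, $$\eta(f)=\int_0^\infty\mathbb{E}[f(y\theta_d)]\,\nu_\iota(dy).$$ Hence, in $\mathbb{M}(\Delta^{K-1}\times(\mathbb{R}_+\setminus\{0\}))$, as $t\to\infty$, $$t\,\mathbb{P}\left[\left(\left(\frac{N_{d1\cdot}}{N_{d\cdot\cdot}},\dots,\frac{N_{dK\cdot}}{N_{d\cdot\cdot}}\right),\frac{N_{d\cdot\cdot}}{b(t)}\right)\in\cdot\right]\to\mathbb{P}(\theta_d\in\cdot)\times\nu_\iota(\cdot).$$ (c) For each topic $k$, $(N_{\cdot k1},\dots,N_{\cdot kW})\in\text{MRV}(\iota,\tilde b_k(t),\upsilon,\mathbb{R}_+^W\setminus\{0\})$, where $\upsilon\in\mathbb{M}(\mathbb{R}_+^W\setminus\{0\})$ satisfies, for any $f\in\mathcal{C}(\mathbb{R}_+^W\setminus\{0\})$, $$\upsilon(f)=\int_0^\infty f(y\phi_k)\,\nu_\iota(dy),\qquad \tilde b_k(t)=\left(D\,\frac{B(\alpha_k+\iota,\alpha_0-\alpha_k)}{B(\alpha_k,\alpha_0-\alpha_k)}\right)^{1/\iota}b(t).$$ Hence, in $\mathbb{M}(\Delta^{W-1}\times(\mathbb{R}_+\setminus\{0\}))$, as $t\to\infty$, $$t\,\mathbb{P}\left[\left(\left(\frac{N_{\cdot k1}}{N_{\cdot k\cdot}},\dots,\frac{N_{\cdot kW}}{N_{\cdot k\cdot}}\right),\frac{N_{\cdot k\cdot}}{\tilde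 b_k(t)}\right)\in\cdot\right]\to\epsilon_{\phi_k}(\cdot)\times\nu_\iota(\cdot),$$ where $\epsilon_{\phi_k}$ is the Dirac measure at $\phi_k$.
   Context: LDA model. Fix integers $W\ge1$ (vocabulary size), $K\ge2$ (number of topics) and $D\ge 1$ (number of documents). $\Delta^{p-1}$ is the set of probability vectors in $\mathbb{R}^p$. The topics $\phi_1,\dots,\phi_K\in\Delta^{W-1}$ are fixed, $\phi_k=(\phi_{k1},\dots,\phi_{kW})$, $\Phi=[\phi_1\cdots\phi_K]$ is the $W\times K$ matrix with these columns, and each word $w$ has $\phi_{kw}>0$ for at least one $k$. Let $\alpha_1,\dots,\alpha_K>0$ and $\alpha_0=\sum_k\alpha_k$. Document $d$ has topic proportions $\theta_d=(\theta_{d1},\dots,\theta_{dK})$ and a positive-integer-valued length $N_{d\cdot\cdot}$; the lengths are independent of $(\theta_d)_d$. Given all lengths and topic proportions, the pairs $(X_{di},Z_{di})$, $1\le i\le N_{d\cdot\cdot}$, (word, topic) are independent over $i$ and $d$ with $\mathbb{P}(X_{di}=w,Z_{di}=k\mid\cdot)=\theta_{dk}\phi_{kw}$. Counts: $N_{dkw}=\sum_{i=1}^{N_{d\cdot\cdot}}1_{\{X_{di}=w,Z_{di}=k\}}$; a dot denotes summation over that index, e.g. $N_{d\cdot w}=\sum_kN_{dkw}$, $N_{dk\cdot}=\sum_wN_{dkw}$, $N_{\cdot kw}=\sum_dN_{dkw}$, $N_{\cdot k\cdot}=\sum_{d,w}N_{dkw}$. (Ratios with zero denominator may be assigned any fixed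 value in the simplex.) Regular variation. For $c>0$, $RV_c$ is the class of $U:\mathbb{R}_+\to\mathbb{R}_+$ with $\lim_{t\to\infty}U(tx)/U(t)=x^c$ for all $x>0$. $\nu_c$ is the measure on $(0,\infty)$ with $\nu_c((x,\infty))=x^{-c}$. For closed cones $\mathbb{C}_0\subset\mathbb{C}$, $\mathbb{M}(\mathbb{C}\setminus\mathbb{C}_0)$ is the set of Borel measures on $\mathbb{C}\setminus\mathbb{C}_0$ finite on sets bounded away from $\mathbb{C}_0$; $\mathcal{C}(\mathbb{C}\setminus\mathbb{C}_0)$ is the set of continuous, bounded, nonnegative functions on $\mathbb{C}\setminus\mathbb{C}_0$ with support bounded away from $\mathbb{C}_0$; $\mu_n\to\mu$ in $\mathbb{M}(\mathbb{C}\setminus\mathbb{C}_0)$ means $\int f\,d\mu_n\to\int f\,d\mu$ for all $f\in\mathcal{C}(\mathbb{C}\setminus\mathbb{C}_0)$. The same definitions are used for $\Delta^{p-1}\times(\mathbb{R}_+\setminus\{0\})$, with "bounded away from $\Delta^{p-1}\times\{0\}$". Write $\mu(f)=\int f\,d\mu$. A random vector $Z\in\mathbb{R}_+^p$ is in $\text{MRV}(c,b(t),\nu,\mathbb{R}_+^p\setminus\{0\})$, $c>0$, if $b\in RV_{1/c}$, $\nu\in\mathbb{M}(\mathbb{R}_+^p\setminus\{0\})$, $\nu\not\equiv0$, and $t\,\mathbb{P}(Z/b(t)\in\cdot)\to\nu(\cdot)$ in $\mathbb{M}(\mathbb{R}_+^p\setminus\{0\})$ as $t\to\infty$. $B(\cdot,\cdot)$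 is the Beta function. *)

theory Defs
  imports "HOL-Probability.Probability"
begin

section \<open>Regular variation\<close>

definition RV :: "real \<Rightarrow> (real \<Rightarrow> real) set" where
  "RV c = {U. (\<forall>t\<ge>0. 0 \<le> U t) \<and>
              (\<forall>x>0. ((\<lambda>t. U (t * x) / U t) \<longlongrightarrow> x powr c) at_top)}"

text \<open>
  The measure on \<open>{0<..}\<close> whose tail function is \<open>x powr - c\<close>. For \<open>c > 0\<close> the description
  is proper, see \<open>nu_eq_density\<close> and \<open>nu_tail\<close> below.
\<close>

definition nu :: "real \<Rightarrow> real measure" where
  "nu c = (THE m. sets m = sets (restrict_space borel {0<..}) \<and>
                  (\<forall>x>0. emeasure m {x<..} = ennreal (x powr - c)))"

lemma power_tail_density:
  fixes c x :: real
  assumes c: "c > 0" and x: "x > 0"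
  shows "emeasure (density (restrict_space lborel {0<..}) (\<lambda>y. ennreal (c * y powr (- c - 1)))) {x<..}
         = ennreal (x powr - c)"
proof -
  have meas: "(\<lambda>y::real. ennreal (c * y powr (- c - 1))) \<in> borel_measurable (restrict_space lborel {0<..})"
    by (rule measurable_restrict_space1) simp
  have xs: "{x<..} \<in> sets (restrict_space lborel {0<..})"
    using x by (auto simp: sets_restrict_space intro!: image_eqI[of _ _ "{x<..}"])
  have "emeasure (density (restrict_space lborel {0<..}) (\<lambda>y. ennreal (c * y powr (- c - 1)))) {x<..}
      = (\<integral>\<^sup>+y. ennreal (c * y powr (- c - 1)) * indicator {x<..} y \<partial>restrict_space lborel {0<..})"
    by (rule emeasure_density[OF meas xs])
  also have "\<dots> = (\<integral>\<^sup>+y. ennreal (c * y powr (- c - 1)) * indicator {x<..} y * indicator {0<..} y \<partial>lborel)"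
    by (rule nn_integral_restrict_space) simp
  also have "\<dots> = (\<integral>\<^sup>+y. ennreal (c * y powr (- c - 1)) * indicator {x..} y \<partial>lborel)"
  proof (rule nn_integral_cong_AE)
    have "AE y in lborel. y \<noteq> x"
      by (rule AE_lborel_singleton)
    then show "AE y in lborel. ennreal (c * y powr (- c - 1)) * indicator {x<..} y * indicator {0<..} y
                 = ennreal (c * y powr (- c - 1)) * indicator {x..} y"
      by eventually_elim (use x in \<open>auto simp: indicator_def\<close>)
  qed
  also have "\<dots> = ennreal (0 - (- (x powr - c)))"
  proof (rule nn_integral_FTC_atLeast)
    show "(\<lambda>y. c * y powr (- c - 1)) \<in> borel_measurable borel" by simp
    show "((\<lambda>y. - (y powr - c)) has_real_derivative c * y powr (- c - 1)) (at y)" if "x \<le> y" for y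
      using that x by (auto intro!: derivative_eq_intros simp: powr_diff field_simps)
    show "0 \<le> c * y powr (- c - 1)" if "x \<le> y" for y
      using c by simp
    have "((\<lambda>y. y powr - c) \<longlongrightarrow> 0) at_top"
      using c by (intro tendsto_neg_powr filterlim_ident) auto
    then show "((\<lambda>y. - (y powr - c)) \<longlongrightarrow> 0) at_top"
      using tendsto_minus by fastforce
  qed
  finally show ?thesis by simp
qed

lemma tail_measure_unique:
  fixes m m' :: "real measure"
  assumes s: "sets m = sets (restrict_space borel {0<..})"
    and s': "sets m' = sets (restrict_space borel {0<..})"
    and t: "\<And>x. x > 0 \<Longrightarrow> emeasure m {x<..} = ennreal (x powr - c)"
    and t': "\<And>x. x > 0 \<Longrightarrow> emeasure m' {x<..} = ennreal (x powr - c)"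
  shows "m = m'"
proof -
  let ?E = "{{x<..} | x::real. x > 0}"
  have gen: "sets (restrict_space borel {0<..}) = sigma_sets {0<..} ?E"
  proof -
    let ?S = "{0::real<..}" and ?G = "range (greaterThan :: real \<Rightarrow> real set)"
    have b: "sets (borel :: real measure) = sigma_sets UNIV ?G"
      by (subst borel_Ioi) simp
    have S: "?S \<in> sigma_sets UNIV ?G"
      by (rule sigma_sets.Basic) simp
    have "sets (restrict_space borel ?S) = sigma_sets ?S ((\<inter>) ?S ` ?G)"
      unfolding sets_restrict_space b by (rule sigma_sets_Int[OF S]) simp
    also have "\<dots> = sigma_sets ?S ?E"
    proof (rule sigma_sets_eqI)
      fix A assume "A \<in> (\<inter>) ?S ` ?G"
      then obtain x where A: "A = ?S \<inter> {x<..}" by auto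
      show "A \<in> sigma_sets ?S ?E"
      proof (cases "x > 0")
        case True
        then have "A = {x<..}" using A by auto
        then show ?thesis using True by (intro sigma_sets.Basic) auto
      next
        case False
        then have "A = ?S" using A by auto
        then show ?thesis by (simp add: sigma_sets_top)
      qed
    next
      fix B assume "B \<in> ?E"
      then obtain x :: real where "B = {x<..}" "x > 0" by auto
      then have "B = ?S \<inter> {x<..}" by auto
      then show "B \<in> sigma_sets ?S ((\<inter>) ?S ` ?G)" by (intro sigma_sets.Basic) auto
    qed
    finally show ?thesis .
  qed
  show ?thesis
  proof (rule measure_eqI_generator_eq[where E = ?E and \<Omega> = "{0<..}" and A = "\<lambda>n. {1 / real (Suc n)<..}"])
    show "Int_stable ?E"
    proof (rule Int_stableI)
      fix a b assume "a \<in> ?E" "b \<in> ?E"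
      then obtain x y where "a = {x<..}" "b = {y<..}" "x > 0" "y > 0" by auto
      then have "a \<inter> b = {max x y<..}" "max x y > 0" by auto
      then show "a \<inter> b \<in> ?E" by blast
    qed
    show "?E \<subseteq> Pow {0<..}" by auto
    show "emeasure m X = emeasure m' X" if "X \<in> ?E" for X
      using that t t' by auto
    show "sets m = sigma_sets {0<..} ?E" "sets m' = sigma_sets {0<..} ?E"
      using s s' gen by simp_all
    show "range (\<lambda>n. {1 / real (Suc n)<..}) \<subseteq> ?E" by force
    show "(\<Union>n. {1 / real (Suc n)<..}) = {0<..}"
    proof (intro equalityI subsetI)
      fix y :: real assume "y \<in> {0<..}"
      then obtain n where "1 / real (Suc n) < y"
        using nat_approx_posE[of y] by auto
      then show "y \<in> (\<Union>n. {1 / real (Suc n)<..})" by auto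
    next
      fix y :: real assume "y \<in> (\<Union>n. {1 / real (Suc n)<..})"
      then obtain n where "1 / real (Suc n) < y" by auto
      moreover have "0 < 1 / real (Suc n)" by simp
      ultimately have "0 < y" by (rule less_trans[rotated])
      then show "y \<in> {0<..}" by simp
    qed
    show "emeasure m {1 / real (Suc i)<..} \<noteq> \<infinity>" for i
      using t[of "1 / real (Suc i)"] by (simp del: of_nat_Suc)
  qed
qed

lemma nu_eq_density:
  assumes "c > 0"
  shows "nu c = density (restrict_space lborel {0<..}) (\<lambda>y. ennreal (c * y powr (- c - 1)))"
  unfolding nu_def
proof (rule the_equality)
  show "sets (density (restrict_space lborel {0<..}) (\<lambda>y. ennreal (c * y powr (- c - 1))))
          = sets (restrict_space borel {0<..}) \<and>
        (\<forall>x>0. emeasure (density (restrict_space lborel {0<..}) (\<lambda>y. ennreal (c * y powr (- c - 1)))) {x<..}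
          = ennreal (x powr - c))"
    using power_tail_density[OF assms] by (simp add: sets_restrict_space)
  then show "m = density (restrict_space lborel {0<..}) (\<lambda>y. ennreal (c * y powr (- c - 1)))"
    if "sets m = sets (restrict_space borel {0<..}) \<and> (\<forall>x>0. emeasure m {x<..} = ennreal (x powr - c))"
    for m
    using that by (intro tail_measure_unique[where c = c]) auto
qed

lemma nu_tail:
  assumes "c > 0" "x > 0"
  shows "emeasure (nu c) {x<..} = ennreal (x powr - c)"
  using assms by (simp add: nu_eq_density power_tail_density)

lemma sets_nu:
  assumes "c > 0"
  shows "sets (nu c) = sets (restrict_space borel {0<..})"
  using assms by (simp add: nu_eq_density sets_restrict_space)


section \<open>Convergence of measures on a cone with a sub-cone removed\<close>

definition bounded_away :: "'a::metric_space set \<Rightarrow> 'a set \<Rightarrow> bool" where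
  "bounded_away A C0 \<longleftrightarrow> (\<exists>r>0. \<forall>x\<in>A. \<forall>y\<in>C0. r \<le> dist x y)"

definition cone_measures :: "'a::metric_space set \<Rightarrow> 'a set \<Rightarrow> 'a measure set" where
  "cone_measures C C0 =
     {\<mu>. sets \<mu> = sets (restrict_space borel (C - C0)) \<and>
         (\<forall>A\<in>sets \<mu>. bounded_away A C0 \<longrightarrow> emeasure \<mu> A < \<infinity>)}"

definition cone_test_functions :: "'a::metric_space set \<Rightarrow> 'a set \<Rightarrow> ('a \<Rightarrow> real) set" where
  "cone_test_functions C C0 =
     {f. continuous_on (C - C0) f \<and> bounded (f ` (C - C0)) \<and> (\<forall>x\<in>C - C0. 0 \<le> f x) \<and>
         bounded_away ((C - C0) \<inter> closure {x \<in> C - C0. f x \<noteq> 0}) C0}"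

definition cone_convergence ::
    "'a::metric_space set \<Rightarrow> 'a set \<Rightarrow> ('b \<Rightarrow> 'a measure) \<Rightarrow> 'a measure \<Rightarrow> 'b filter \<Rightarrow> bool" where
  "cone_convergence C C0 m \<mu> F \<longleftrightarrow>
     (\<forall>\<^sub>F t in F. m t \<in> cone_measures C C0) \<and> \<mu> \<in> cone_measures C C0 \<and>
     (\<forall>f\<in>cone_test_functions C C0. ((\<lambda>t. integral\<^sup>L (m t) f) \<longlongrightarrow> integral\<^sup>L \<mu> f) F)"

definition scaled_law :: "'a measure \<Rightarrow> 'b::topological_space set \<Rightarrow> real \<Rightarrow> ('a \<Rightarrow> 'b) \<Rightarrow> 'b measure" where
  "scaled_law M S t Y = scale_measure (ennreal t) (restrict_space (distr M borel Y) S)"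

definition nonneg_orthant :: "(real ^ 'p) set" where
  "nonneg_orthant = {x. \<forall>i. 0 \<le> x $ i}"

definition prob_simplex :: "(real ^ 'p) set" where
  "prob_simplex = {x. (\<forall>i. 0 \<le> x $ i) \<and> (\<Sum>i\<in>UNIV. x $ i) = 1}"

definition MRV ::
    "'a measure \<Rightarrow> ('a \<Rightarrow> real ^ 'p) \<Rightarrow> real \<Rightarrow> (real \<Rightarrow> real) \<Rightarrow> (real ^ 'p) measure \<Rightarrow> bool" where
  "MRV M Z c b \<nu> \<longleftrightarrow>
     Z \<in> borel_measurable M \<and> (\<forall>\<omega>\<in>space M. Z \<omega> \<in> nonneg_orthant) \<and>
     c > 0 \<and> b \<in> RV (1 / c) \<and>
     \<nu> \<in> cone_measures nonneg_orthant {0} \<and> emeasure \<nu> (space \<nu>) \<noteq> 0 \<and>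
     cone_convergence nonneg_orthant {0}
       (\<lambda>t. scaled_law M (nonneg_orthant - {0}) t (\<lambda>\<omega>. (1 / b t) *\<^sub>R Z \<omega>)) \<nu> at_top"

text \<open>Convergence on \<open>prob_simplex \<times> {0<..}\<close>, seen as \<open>prob_simplex \<times> {0..}\<close> with
  \<open>prob_simplex \<times> {0}\<close> removed.\<close>

definition polar_convergence ::
    "'a measure \<Rightarrow> (real \<Rightarrow> 'a \<Rightarrow> (real ^ 'p) \<times> real) \<Rightarrow> ((real ^ 'p) \<times> real) measure \<Rightarrow> bool" where
  "polar_convergence M Y \<mu> \<longleftrightarrow>
     cone_convergence (prob_simplex \<times> {0..}) (prob_simplex \<times> {0})
       (\<lambda>t. scaled_law M (prob_simplex \<times> {0<..}) t (Y t)) \<mu> at_top"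

definition simplex_law :: "'a measure \<Rightarrow> ('a \<Rightarrow> real ^ 'p) \<Rightarrow> (real ^ 'p) measure" where
  "simplex_law M Y = distr M (restrict_space borel prob_simplex) Y"


section \<open>The Dirichlet distribution\<close>

text \<open>
  The usual density with respect to Lebesgue measure on all coordinates but one, the remaining
  coordinate \<open>j\<close> being one minus the sum of the others. The result does not depend on \<open>j\<close>. The
  density is supported on the relative interior of the simplex, so no boundary values arise
  when some parameter is less than one.
\<close>

definition dirichlet :: "('k::finite \<Rightarrow> real) \<Rightarrow> (real ^ 'k) measure" where
  "dirichlet \<alpha> =
     (let j = (SOME j. True);
          I = UNIV - {j};
          point = (\<lambda>x. \<chi> k. if k = j then 1 - (\<Sum>i\<in>I. x i) else x k);
          dens = (\<lambda>p :: real ^ 'k. if \<forall>k. 0 < p $ k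
                    then Gamma (\<Sum>k\<in>UNIV. \<alpha> k) / (\<Prod>k\<in>UNIV. Gamma (\<alpha> k))
                           * (\<Prod>k\<in>UNIV. (p $ k) powr (\<alpha> k - 1))
                    else 0)
      in distr (density (PiM I (\<lambda>_. lborel)) (\<lambda>x. ennreal (dens (point x)))) borel point)"


section \<open>The LDA model\<close>

text \<open>The \<open>\<sigma>\<close>-algebra generated by all lengths and all topic proportions.\<close>

definition lda_conditioning ::
    "'a measure \<Rightarrow> ('d::finite \<Rightarrow> 'a \<Rightarrow> nat) \<Rightarrow> ('d \<Rightarrow> 'a \<Rightarrow> real ^ 'k) \<Rightarrow> 'a measure" where
  "lda_conditioning M N \<theta> =
     vimage_algebra (space M) (\<lambda>\<omega> d. (N d \<omega>, \<theta> d \<omega>))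
       (PiM UNIV (\<lambda>_. count_space UNIV \<Otimes>\<^sub>M borel))"

text \<open>
  Words, topics and documents are indexed by the finite types \<open>'w\<close>, \<open>'k\<close> and \<open>'d\<close>; \<open>\<phi> k\<close> is the
  \<open>k\<close>-th topic, and \<open>X d i\<close>, \<open>Z d i\<close> are the word and the topic at position \<open>i\<close> of document \<open>d\<close>.
  These are total in \<open>i\<close>, but nothing is assumed about, and nothing depends on, the positions
  outside \<open>{1..N d \<omega>}\<close>, measurability apart. Assumption \<open>tokens\<close> is the conditional independence
  of the pairs, with their conditional law, in terms of joint point probabilities: on the event
  that the lengths equal \<open>n\<close>, the conditional probability that the pairs take the values
  \<open>(x d i, z d i)\<close> is the product of the individual ones.
\<close>

locale lda = prob_space M
  for M :: "'a measure"
    and \<phi> :: "'k::finite \<Rightarrow> real ^ 'w::finite"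
    and N :: "'d::finite \<Rightarrow> 'a \<Rightarrow> nat"
    and \<theta> :: "'d \<Rightarrow> 'a \<Rightarrow> real ^ 'k"
    and X :: "'d \<Rightarrow> nat \<Rightarrow> 'a \<Rightarrow> 'w"
    and Z :: "'d \<Rightarrow> nat \<Rightarrow> 'a \<Rightarrow> 'k" +
  assumes two_topics: "CARD('k) \<ge> 2"
    and topics: "\<And>k. \<phi> k \<in> prob_simplex"
    and words: "\<And>w. \<exists>k. \<phi> k $ w > 0"
    and N_measurable: "\<And>d. N d \<in> M \<rightarrow>\<^sub>M count_space UNIV"
    and N_pos: "\<And>d \<omega>. \<omega> \<in> space M \<Longrightarrow> N d \<omega> \<ge> 1"
    and theta_measurable: "\<And>d. \<theta> d \<in> borel_measurable M"
    and theta_simplex: "\<And>d \<omega>. \<omega> \<in> space M \<Longrightarrow> \<theta> d \<omega> \<in> prob_simplex"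
    and X_measurable: "\<And>d i. X d i \<in> M \<rightarrow>\<^sub>M count_space UNIV"
    and Z_measurable: "\<And>d i. Z d i \<in> M \<rightarrow>\<^sub>M count_space UNIV"
    and lengths_indep_proportions:
      "indep_set
         (sets (vimage_algebra (space M) (\<lambda>\<omega> d. N d \<omega>) (PiM UNIV (\<lambda>_. count_space UNIV))))
         (sets (vimage_algebra (space M) (\<lambda>\<omega> d. \<theta> d \<omega>) (PiM UNIV (\<lambda>_. borel))))"
    and tokens: "\<And>n x z. AE \<omega> in M.
      real_cond_exp M (lda_conditioning M N \<theta>)
        (indicator {\<omega>\<in>space M. \<forall>d. N d \<omega> = n d \<and> (\<forall>i\<in>{1..n d}. X d i \<omega> = x d i \<and> Z d i \<omega> = z d i)}) \<omega>
      = indicator {\<omega>. \<forall>d. N d \<omega> = n d} \<omega>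
          * (\<Prod>d\<in>UNIV. \<Prod>i\<in>{1..n d}. \<theta> d \<omega> $ z d i * \<phi> (z d i) $ x d i)"

definition topic_matrix :: "('k \<Rightarrow> real ^ 'w) \<Rightarrow> real ^ 'k ^ 'w" where
  "topic_matrix \<phi> = (\<chi> w k. \<phi> k $ w)"

definition token_count ::
    "('d \<Rightarrow> 'a \<Rightarrow> nat) \<Rightarrow> ('d \<Rightarrow> nat \<Rightarrow> 'a \<Rightarrow> 'w) \<Rightarrow> ('d \<Rightarrow> nat \<Rightarrow> 'a \<Rightarrow> 'k)
      \<Rightarrow> 'd \<Rightarrow> 'k \<Rightarrow> 'w \<Rightarrow> 'a \<Rightarrow> nat" where
  "token_count N X Z d k w \<omega> = card {i\<in>{1..N d \<omega>}. X d i \<omega> = w \<and> Z d i \<omega> = k}"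

definition doc_word_counts ::
    "('d \<Rightarrow> 'a \<Rightarrow> nat) \<Rightarrow> ('d \<Rightarrow> nat \<Rightarrow> 'a \<Rightarrow> 'w) \<Rightarrow> ('d \<Rightarrow> nat \<Rightarrow> 'a \<Rightarrow> 'k::finite)
      \<Rightarrow> 'd \<Rightarrow> 'a \<Rightarrow> real ^ 'w" where
  "doc_word_counts N X Z d \<omega> = (\<chi> w. \<Sum>k\<in>UNIV. real (token_count N X Z d k w \<omega>))"

definition doc_topic_counts ::
    "('d \<Rightarrow> 'a \<Rightarrow> nat) \<Rightarrow> ('d \<Rightarrow> nat \<Rightarrow> 'a \<Rightarrow> 'w::finite) \<Rightarrow> ('d \<Rightarrow> nat \<Rightarrow> 'a \<Rightarrow> 'k)
      \<Rightarrow> 'd \<Rightarrow> 'a \<Rightarrow> real ^ 'k" where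
  "doc_topic_counts N X Z d \<omega> = (\<chi> k. \<Sum>w\<in>UNIV. real (token_count N X Z d k w \<omega>))"

definition topic_word_counts ::
    "('d::finite \<Rightarrow> 'a \<Rightarrow> nat) \<Rightarrow> ('d \<Rightarrow> nat \<Rightarrow> 'a \<Rightarrow> 'w) \<Rightarrow> ('d \<Rightarrow> nat \<Rightarrow> 'a \<Rightarrow> 'k)
      \<Rightarrow> 'k \<Rightarrow> 'a \<Rightarrow> real ^ 'w" where
  "topic_word_counts N X Z k \<omega> = (\<chi> w. \<Sum>d\<in>UNIV. real (token_count N X Z d k w \<omega>))"

definition topic_total ::
    "('d::finite \<Rightarrow> 'a \<Rightarrow> nat) \<Rightarrow> ('d \<Rightarrow> nat \<Rightarrow> 'a \<Rightarrow> 'w::finite) \<Rightarrow> ('d \<Rightarrow> nat \<Rightarrow> 'a \<Rightarrow> 'k)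
      \<Rightarrow> 'k \<Rightarrow> 'a \<Rightarrow> real" where
  "topic_total N X Z k \<omega> = (\<Sum>d\<in>UNIV. \<Sum>w\<in>UNIV. real (token_count N X Z d k w \<omega>))"

text \<open>Normalization of a vector by its total \<open>s\<close>, with a conventional value \<open>q\<close> if \<open>s = 0\<close>.\<close>

definition proportions :: "real ^ 'p \<Rightarrow> real \<Rightarrow> real ^ 'p \<Rightarrow> real ^ 'p" where
  "proportions q s v = (if s = 0 then q else (\<chi> i. v $ i / s))"

end

(*
  Conditionally on its length and topic proportions, the token counts of a document have variance at
  most the length. Since P(N > b(t) x) is of order 1/t and b(t) tends to infinity, Chebyshev's
  inequality shows that replacing a count by length times probability changes it by more than
  eps * b(t) only with probability o(1/t). So the counts may be replaced by N_d a_d with a_d a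
  function of theta_d, independent of N_d. For one document, vague convergence of the law of
  N_d / b(t) and independence give the limit. For a sum over documents, with probability 1 - o(1/t)
  at most one N_d / b(t) is not small, so the limits of the documents add up; in (c) the scaling
  property of nu turns the random factor theta_dk into its moment of order iota, a ratio of Beta
  values by the Dirichlet integral. The statements on proportions follow by applying the limit to
  functions of (x / |x|, |x|), where |x| is the sum of the entries.
*)

theory Submission
  imports Defs
begin


section \<open>Measurability and the measure \<open>nu\<close>\<close>

text \<open>The obstacle is that a length may have infinite mean (for \<iota> < 1 it does), so a
  deviation of order b(t) cannot be controlled through moments of the length. Chebyshev is therefore
  used relative to the length: given N, a count leaves its mean by more than \<epsilon> N with
  probability at most 1 / (\<epsilon>^2 N), which on N > m yields P(N > m) / (\<epsilon>^2 m), a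
  bound by the tail alone. As the deviation never exceeds N, only lengths above \<epsilon> b(t)
  matter, and those above a large multiple of b(t) are discarded at a small cost. That b tends to
  infinity comes from N \<ge> 1. The measures t P(N / b(t) \<in> .) have total mass t, so vague
  convergence is reduced to weak convergence of the laws conditioned on N / b(t) > s. Test functions
  are controlled off the origin only; each is extended by zero. The independent factor a is
  integrated out first, G(y) = E f(y a), which leaves a one-dimensional limit.\<close>

lemma borel_measurable_vecI:
  fixes f :: "'a \<Rightarrow> real ^ 'n"
  assumes "\<And>i. (\<lambda>x. f x $ i) \<in> borel_measurable M"
  shows "f \<in> borel_measurable M"
  unfolding borel_measurable_euclidean_space[of f M]
  using assms by (auto simp: Basis_vec_def inner_axis)

lemma borel_measurable_vec_nth:
  fixes f :: "'a \<Rightarrow> real ^ 'n"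
  assumes "f \<in> borel_measurable M"
  shows "(\<lambda>x. f x $ i) \<in> borel_measurable M"
  by (rule borel_measurable_continuous_on[OF _ assms]) (intro continuous_intros)

text \<open>Inclusions of sigma-algebras thus become measurability of the identity, which the rules
  for products, restrictions and generated sigma-algebras supply.\<close>

lemma sets_subset_if_ident_measurable:
  assumes "(\<lambda>x. x) \<in> measurable A B" "space A = space B"
  shows "sets B \<subseteq> sets A"
proof
  fix S assume S: "S \<in> sets B"
  then have "(\<lambda>x. x) -` S \<inter> space A = S" using sets.sets_into_space[OF S] assms(2) by auto
  then show "S \<in> sets A" using measurable_sets[OF assms(1) S] by simp
qed

lemma nu_space: "c > 0 \<Longrightarrow> space (nu c) = {0<..}"
  using sets_eq_imp_space_eq[OF sets_nu[of c]] by (simp add: space_restrict_space)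

text \<open>\<open>nu c\<close> has infinite mass near 0; products with it and Fubini rest on the
  exhaustion of the half-line by the tails beyond 1 / (n + 1), each of finite mass.\<close>

lemma sigma_finite_nu:
  assumes "c > 0"
  shows "sigma_finite_measure (nu c)"
proof
  let ?A = "range (\<lambda>n. {1 / real (Suc n)<..})"
  have "{x<..} \<in> sets (nu c)" if "x > 0" for x
    unfolding sets_nu[OF assms] using that
    by (auto simp: sets_restrict_space intro!: image_eqI[of _ _ "{x<..}"])
  then have "?A \<subseteq> sets (nu c)" by (auto simp del: of_nat_Suc)
  moreover have "\<Union>?A = space (nu c)"
  proof -
    have "\<exists>n. 1 / real (Suc n) < y" if "y > 0" for y using nat_approx_posE[OF that] by blast
    moreover have "0 < y" if "1 / real (Suc n) < y" for n y
      using that by (rule less_trans[rotated]) simp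
    ultimately show ?thesis unfolding nu_space[OF assms] by auto
  qed
  moreover have "\<forall>a\<in>?A. emeasure (nu c) a \<noteq> \<infinity>"
    using assms by (auto simp: nu_tail simp del: of_nat_Suc)
  ultimately show "\<exists>A. countable A \<and> A \<subseteq> sets (nu c) \<and> \<Union>A = space (nu c) \<and> (\<forall>a\<in>A. emeasure (nu c) a \<noteq> \<infinity>)"
    by (intro exI[of _ ?A]) auto
qed

lemma measurable_nu_ident:
  assumes "c > 0"
  shows "(\<lambda>y. y) \<in> borel_measurable (nu c)"
proof -
  have "(\<lambda>y::real. y) \<in> borel_measurable (restrict_space borel {0<..})"
    by (rule measurable_restrict_space1) simp
  then show ?thesis using measurable_cong_sets[OF sets_nu[OF assms] refl] by blast
qed

lemma measurable_nu:
  assumes "c > 0" "f \<in> borel_measurable borel"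
  shows "f \<in> borel_measurable (nu c)"
  using measurable_compose[OF measurable_nu_ident[OF assms(1)] assms(2)] .

text \<open>Tails determine the measure, and the image of \<open>nu c\<close> under multiplication
  by s has tail (x / s)^-c = s^c x^-c. This homogeneity later turns a random factor into its moment
  and calibrates the scaling function.\<close>

lemma nu_distr_scale:
  assumes c: "c > 0" and s: "s > 0"
  shows "distr (nu c) (restrict_space borel {0<..}) (\<lambda>y. s * y) = scale_measure (ennreal (s powr c)) (nu c)"
proof -
  have m: "(\<lambda>y. s * y) \<in> measurable (nu c) (restrict_space borel {0<..})"
    using s by (intro measurable_restrict_space2 measurable_nu c) (auto simp: nu_space[OF c])
  have sx: "{x<..} \<in> sets (restrict_space borel {0::real<..})" if "x > 0" for x
    using that by (auto simp: sets_restrict_space intro!: image_eqI[of _ _ "{x<..}"])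
  \<comment> \<open>Divided by s^c, the image has exactly the tails of \<open>nu c\<close>, so
    \<open>tail_measure_unique\<close> applies.\<close>
  let ?d = "scale_measure (ennreal (s powr - c)) (distr (nu c) (restrict_space borel {0<..}) (\<lambda>y. s * y))"
  have "?d = nu c"
  proof (rule tail_measure_unique)
    fix x :: real assume x: "x > 0"
    have "x / s > 0" using s x by simp
    then have "(\<lambda>y. s * y) -` {x<..} \<inter> space (nu c) = {x / s<..}"
      using s by (auto simp: nu_space[OF c] pos_divide_less_eq mult.commute intro: less_trans[of 0 "x / s"])
    then have "emeasure (distr (nu c) (restrict_space borel {0<..}) (\<lambda>y. s * y)) {x<..} = ennreal ((x / s) powr - c)"
      using x s by (simp add: emeasure_distr[OF m sx] nu_tail[OF c])
    also have "(x / s) powr - c = s powr c * x powr - c"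
      using x s by (simp add: powr_divide powr_minus field_simps)
    finally show "emeasure ?d {x<..} = ennreal (x powr - c)"
      using s by (simp add: ennreal_mult'[symmetric] powr_minus field_simps)
  qed (simp_all add: sets_nu nu_tail c)
  then have "scale_measure (ennreal (s powr c)) (nu c) = scale_measure (ennreal (s powr c)) ?d" by simp
  also have "\<dots> = distr (nu c) (restrict_space borel {0<..}) (\<lambda>y. s * y)"
    using s by (simp add: ennreal_mult'[symmetric] powr_add[symmetric])
  finally show ?thesis by simp
qed

lemma integral_scale_measure:
  fixes f :: "'a \<Rightarrow> real"
  assumes "0 \<le> r" "f \<in> borel_measurable M"
  shows "integral\<^sup>L (scale_measure (ennreal r) M) f = r * integral\<^sup>L M f"
proof -
  have "scale_measure (ennreal r) M = density M (\<lambda>_. ennreal r)"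
    by (rule measure_eqI) (auto simp: emeasure_density nn_integral_cmult)
  then show ?thesis using assms by (simp add: integral_density)
qed

text \<open>Measurability of \<open>G\<close> is asked on the open half-line because
  \<open>G\<close> will be a test function along a ray, which is controlled away from the origin
  only.\<close>

lemma integral_nu_scale:
  fixes G :: "real \<Rightarrow> real"
  assumes c: "c > 0" and s: "s > 0" and G: "G \<in> borel_measurable (restrict_space borel {0<..})"
  shows "(\<integral>y. G (s * y) \<partial>nu c) = s powr c * (\<integral>y. G y \<partial>nu c)"
proof -
  have m: "(\<lambda>y. s * y) \<in> measurable (nu c) (restrict_space borel {0<..})"
    using s by (intro measurable_restrict_space2 measurable_nu c) (auto simp: nu_space[OF c])
  have "(\<integral>y. G (s * y) \<partial>nu c) = integral\<^sup>L (distr (nu c) (restrict_space borel {0<..}) (\<lambda>y. s * y)) G"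
    by (rule integral_distr[symmetric, OF m G])
  also have "\<dots> = s powr c * (\<integral>y. G y \<partial>nu c)"
    unfolding nu_distr_scale[OF c s] using G s
    by (intro integral_scale_measure) (auto simp: measurable_cong_sets[OF sets_nu[OF c] refl])
  finally show ?thesis .
qed


section \<open>Moments of the Dirichlet distribution\<close>

text \<open>Substituting x = s u reduces to the Beta integral over the unit interval; the exponent a
  + c - 1 of s collects a - 1, c - 1 and the Jacobian.\<close>

lemma nn_integral_Beta_interval:
  fixes a c s :: real
  assumes a: "a > 0" and c: "c > 0"
  shows "(\<integral>\<^sup>+x. ennreal (if 0 < x \<and> x < s then x powr (a - 1) * (s - x) powr (c - 1) else 0) \<partial>lborel)
       = ennreal (if 0 < s then Beta a c * s powr (a + c - 1) else 0)"
proof (cases "0 < s")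
  case False
  then have "(\<lambda>x. ennreal (if 0 < x \<and> x < s then x powr (a - 1) * (s - x) powr (c - 1) else 0)) = (\<lambda>_. 0)"
    by auto
  then show ?thesis using False by simp
next
  case True
  let ?g = "\<lambda>x::real. x powr (a - 1) * (1 - x) powr (c - 1)"
  have "(?g has_integral Beta a c) {0<..<1}"
    using has_integral_Beta_real[OF a c] by (simp add: has_integral_Icc_iff_Ioo)
  then have B: "(\<integral>\<^sup>+x. ennreal (indicator {0<..<1} x * ?g x) \<partial>lborel) = ennreal (Beta a c)"
    by (rule nn_integral_has_integral_lebesgue[rotated]) auto
  have "(\<integral>\<^sup>+x. ennreal (if 0 < x \<and> x < s then x powr (a - 1) * (s - x) powr (c - 1) else 0) \<partial>lborel)
     = ennreal \<bar>s\<bar> * (\<integral>\<^sup>+x. ennreal (if 0 < 0 + s * x \<and> 0 + s * x < s then (0 + s * x) powr (a - 1) * (s - (0 + s * x)) powr (c - 1) else 0) \<partial>lborel)"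
    by (rule nn_integral_real_affine) (use True in auto)
  also have "(\<lambda>x. ennreal (if 0 < 0 + s * x \<and> 0 + s * x < s then (0 + s * x) powr (a - 1) * (s - (0 + s * x)) powr (c - 1) else 0))
      = (\<lambda>x. ennreal (s powr (a + c - 2)) * ennreal (indicator {0<..<1} x * ?g x))"
  proof
    fix x
    have *: "(s * x) powr (a - 1) * (s - s * x) powr (c - 1) = s powr (a + c - 2) * ?g x" if "0 < x" "x < 1"
    proof -
      have "s - s * x = s * (1 - x)" by (simp add: algebra_simps)
      then have "(s * x) powr (a - 1) * (s - s * x) powr (c - 1) = (s powr (a - 1) * s powr (c - 1)) * ?g x"
        using that True by (simp add: powr_mult)
      also have "s powr (a - 1) * s powr (c - 1) = s powr (a + c - 2)"
        by (simp add: powr_add[symmetric] algebra_simps)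
      finally show ?thesis .
    qed
    show "ennreal (if 0 < 0 + s * x \<and> 0 + s * x < s then (0 + s * x) powr (a - 1) * (s - (0 + s * x)) powr (c - 1) else 0)
        = ennreal (s powr (a + c - 2)) * ennreal (indicator {0<..<1} x * ?g x)"
      using True * by (auto simp: zero_less_mult_iff indicator_def ennreal_mult'[symmetric])
  qed
  also have "ennreal \<bar>s\<bar> * (\<integral>\<^sup>+x. ennreal (s powr (a + c - 2)) * ennreal (indicator {0<..<1} x * ?g x) \<partial>lborel)
      = ennreal (s * s powr (a + c - 2) * Beta a c)"
    using True a c by (subst nn_integral_cmult) (auto simp: B ennreal_mult'[symmetric] mult.assoc)
  also have "s * s powr (a + c - 2) = s powr (a + c - 1)"
    using True powr_mult_base[of s "a + c - 2"] by simp
  finally show ?thesis using True by (simp add: mult.commute)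
qed

text \<open>The coordinates are integrated out one at a time. The inner integral has s - y in place
  of s, so the induction keeps s free; its value is a power of s - y, and the outer integral is
  again of Beta type. The exponent \<open>c\<close> belongs to the coordinate that the constraint on
  the sum eliminates.\<close>

lemma Dirichlet_nn_integral:
  fixes a :: "'i \<Rightarrow> real" and c s :: real
  assumes "finite I" and "\<And>i. i \<in> I \<Longrightarrow> a i > 0" and c: "c > 0"
  shows "(\<integral>\<^sup>+x. ennreal (if (\<forall>i\<in>I. 0 < x i) \<and> sum x I < s
                     then (\<Prod>i\<in>I. x i powr (a i - 1)) * (s - sum x I) powr (c - 1) else 0)
              \<partial>PiM I (\<lambda>_. lborel))
       = ennreal (if 0 < s then (\<Prod>i\<in>I. Gamma (a i)) * Gamma c / Gamma (sum a I + c) * s powr (sum a I + c - 1) else 0)"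
  using assms(1,2)
proof (induction I arbitrary: s rule: finite_induct)
  case empty
  have "Gamma c > 0" using c by simp
  then show ?case by (simp add: PiM_empty nn_integral_count_space_finite)
next
  case (insert i I)
  interpret product_sigma_finite "\<lambda>_::'i. lborel :: real measure" ..
  let ?F = "\<lambda>I s x. if (\<forall>i\<in>I. 0 < x i) \<and> sum x I < s
                     then (\<Prod>i\<in>I. x i powr (a i - 1)) * (s - sum x I) powr (c - 1) else 0"
  \<comment> \<open>\<open>?A\<close> is the parameter of the remaining coordinates lumped together,
    \<open>?K\<close> the constant of the induction hypothesis.\<close>
  let ?A = "sum a I + c" and ?K = "(\<Prod>i\<in>I. Gamma (a i)) * Gamma c / Gamma (sum a I + c)"
  have a: "a i > 0" "\<And>j. j \<in> I \<Longrightarrow> a j > 0" using insert.prems by auto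
  have A: "?A > 0" using a c by (simp add: add_nonneg_pos sum_nonneg less_imp_le)
  have K: "?K > 0" using a A c by (auto intro!: divide_pos_pos mult_pos_pos prod_pos)
  have upd: "?F (insert i I) s (x(i := y)) = (if 0 < y then y powr (a i - 1) * ?F I (s - y) x else 0)" for x y
  proof -
    have "sum (x(i := y)) (insert i I) = y + sum x I" "(\<Prod>j\<in>insert i I. (x(i := y)) j powr (a j - 1)) = y powr (a i - 1) * (\<Prod>j\<in>I. x j powr (a j - 1))"
      using insert.hyps by (auto intro!: sum.cong prod.cong arg_cong2[where f = "(+)"] arg_cong2[where f = "(*)"])
    moreover have "(\<forall>j\<in>insert i I. 0 < (x(i := y)) j) \<longleftrightarrow> 0 < y \<and> (\<forall>j\<in>I. 0 < x j)"
      using insert.hyps by auto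
    ultimately show ?thesis by (auto simp: algebra_simps)
  qed
  have [measurable]: "(\<lambda>x. ennreal (?F I s x)) \<in> borel_measurable (PiM I (\<lambda>_. lborel))"
    if "finite I" for I s
    using that by measurable
  have "(\<integral>\<^sup>+x. ennreal (?F (insert i I) s x) \<partial>PiM (insert i I) (\<lambda>_. lborel))
      = (\<integral>\<^sup>+y. \<integral>\<^sup>+x. ennreal (?F (insert i I) s (x(i := y))) \<partial>PiM I (\<lambda>_. lborel) \<partial>lborel)"
    using insert.hyps by (intro product_nn_integral_insert_rev) auto
  also have "\<dots> = (\<integral>\<^sup>+y. ennreal ?K * ennreal (if 0 < y \<and> y < s then y powr (a i - 1) * (s - y) powr (?A - 1) else 0) \<partial>lborel)"
  proof (intro nn_integral_cong)
    fix y :: real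
    show "(\<integral>\<^sup>+x. ennreal (?F (insert i I) s (x(i := y))) \<partial>PiM I (\<lambda>_. lborel))
       = ennreal ?K * ennreal (if 0 < y \<and> y < s then y powr (a i - 1) * (s - y) powr (?A - 1) else 0)"
    proof (cases "0 < y")
      case True
      have "(\<integral>\<^sup>+x. ennreal (?F (insert i I) s (x(i := y))) \<partial>PiM I (\<lambda>_. lborel))
          = (\<integral>\<^sup>+x. ennreal (y powr (a i - 1)) * ennreal (?F I (s - y) x) \<partial>PiM I (\<lambda>_. lborel))"
        unfolding upd using True by (simp only: if_True) (intro nn_integral_cong ennreal_mult', simp)
      also have "\<dots> = ennreal (y powr (a i - 1)) * ennreal (if 0 < s - y then ?K * (s - y) powr (?A - 1) else 0)"
        using insert.hyps by (subst nn_integral_cmult) (auto simp: insert.IH[OF a(2)])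
      also have "\<dots> = ennreal ?K * ennreal (if 0 < y \<and> y < s then y powr (a i - 1) * (s - y) powr (?A - 1) else 0)"
        using True K by (auto simp: ennreal_mult'[symmetric] mult_ac)
      finally show ?thesis .
    next
      case False
      then show ?thesis unfolding upd by simp
    qed
  qed
  also have "\<dots> = ennreal ?K * ennreal (if 0 < s then Beta (a i) ?A * s powr (a i + ?A - 1) else 0)"
    by (subst nn_integral_cmult) (auto simp: nn_integral_Beta_interval[OF a(1) A])
  also have "\<dots> = ennreal (if 0 < s then (\<Prod>i\<in>insert i I. Gamma (a i)) * Gamma c / Gamma (sum a (insert i I) + c) * s powr (sum a (insert i I) + c - 1) else 0)"
  proof -
    have G: "Gamma ?A > 0" "Gamma ?A \<noteq> 0" using A by (simp, metis Gamma_real_pos less_irrefl)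
    \<comment> \<open>The denominator \<open>Gamma ?A\<close> of \<open>?K\<close> cancels against
      the numerator of \<open>Beta (a i) ?A\<close>.\<close>
    have "?K * (Beta (a i) ?A * s powr (a i + ?A - 1)) = (\<Prod>i\<in>insert i I. Gamma (a i)) * Gamma c / Gamma (sum a (insert i I) + c) * s powr (sum a (insert i I) + c - 1)"
      unfolding Beta_def using G insert.hyps by (simp add: field_simps add_ac)
    then show ?thesis using K by (simp add: ennreal_mult'[symmetric] split del: if_split) simp
  qed
  finally show ?case .
qed

text \<open>Multiplying the Dirichlet density by the \<iota>-th power of coordinate k raises the
  k-th parameter by \<iota>. The moment is therefore a quotient of two normalizing constants, in
  which all Gamma factors cancel but those of k and of the parameter sum.\<close>

lemma dirichlet_moment:
  fixes \<alpha> :: "'k::finite \<Rightarrow> real"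
  assumes \<alpha>: "\<And>k. \<alpha> k > 0" and \<iota>: "\<iota> > 0"
  shows "(\<integral>\<^sup>+p. ennreal (p $ k powr \<iota>) \<partial>dirichlet \<alpha>)
       = ennreal (Gamma (\<alpha> k + \<iota>) * Gamma (\<Sum>k\<in>UNIV. \<alpha> k) / (Gamma (\<alpha> k) * Gamma ((\<Sum>k\<in>UNIV. \<alpha> k) + \<iota>)))"
proof -
  \<comment> \<open>The names repeat the local constants of \<open>dirichlet\<close>, so that its
    definition unfolds to exactly this form.\<close>
  define j :: 'k where "j = (SOME j. True)"
  define I where "I = UNIV - {j}"
  define point where "point = (\<lambda>x :: 'k \<Rightarrow> real. (\<chi> k. if k = j then 1 - (\<Sum>i\<in>I. x i) else x k) :: real ^ 'k)"
  define C where "C = Gamma (\<Sum>k\<in>UNIV. \<alpha> k) / (\<Prod>k\<in>UNIV. Gamma (\<alpha> k))"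
  define dens where "dens = (\<lambda>p :: real ^ 'k. if \<forall>k. 0 < p $ k
                    then C * (\<Prod>k\<in>UNIV. (p $ k) powr (\<alpha> k - 1)) else 0)"
  define \<beta> where "\<beta> = (\<lambda>i. \<alpha> i + (if i = k then \<iota> else 0))"
  have \<beta>: "\<beta> i > 0" for i using \<alpha>[of i] \<alpha>[of k] \<iota> by (auto simp: \<beta>_def)
  have dir: "dirichlet \<alpha> = distr (density (PiM I (\<lambda>_. lborel)) (\<lambda>x. ennreal (dens (point x)))) borel point"
    unfolding dirichlet_def Let_def dens_def C_def point_def I_def j_def ..
  have U: "UNIV = insert j I" and jI: "j \<notin> I" "finite I" by (auto simp: I_def)
  have C: "C > 0" unfolding C_def using \<alpha> by (intro divide_pos_pos prod_pos) (auto intro!: sum_pos)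
  have pm[measurable]: "point \<in> measurable (PiM I (\<lambda>_. lborel)) borel"
  proof (rule borel_measurable_vecI)
    fix i
    show "(\<lambda>x. point x $ i) \<in> borel_measurable (PiM I (\<lambda>_. lborel))"
      by (cases "i = j") (auto simp: point_def I_def)
  qed
  have dm[measurable]: "dens \<in> borel_measurable borel"
    unfolding dens_def by measurable
  have prodU: "(\<Prod>i\<in>UNIV. f i) = f j * (\<Prod>i\<in>I. f i)" for f :: "'k \<Rightarrow> real"
    unfolding U using jI by simp
  have sumU: "(\<Sum>i\<in>UNIV. f i) = f j + (\<Sum>i\<in>I. f i)" for f :: "'k \<Rightarrow> real"
    unfolding U using jI by simp
  have ptI: "point x $ i = x i" if "i \<in> I" for x i using that jI by (auto simp: point_def)
  have ptj: "point x $ j = 1 - sum x I" for x by (auto simp: point_def)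
  \<comment> \<open>Coordinate j is what the others leave of 1, so this is the region of the
    Dirichlet integral with s = 1.\<close>
  have pt: "(\<forall>i. 0 < point x $ i) \<longleftrightarrow> (\<forall>i\<in>I. 0 < x i) \<and> sum x I < 1" for x
    using U ptI ptj by (metis UNIV_I diff_gt_0_iff_gt insertE)
  have "(\<integral>\<^sup>+p. ennreal (p $ k powr \<iota>) \<partial>dirichlet \<alpha>)
      = (\<integral>\<^sup>+x. ennreal (dens (point x)) * ennreal (point x $ k powr \<iota>) \<partial>PiM I (\<lambda>_. lborel))"
    unfolding dir by (subst nn_integral_distr) (auto intro!: nn_integral_density)
  also have "\<dots> = (\<integral>\<^sup>+x. ennreal C * ennreal (if (\<forall>i\<in>I. 0 < x i) \<and> sum x I < 1
         then (\<Prod>i\<in>I. x i powr (\<beta> i - 1)) * (1 - sum x I) powr (\<beta> j - 1) else 0) \<partial>PiM I (\<lambda>_. lborel))"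
  proof (intro nn_integral_cong)
    fix x
    have *: "(\<Prod>i\<in>UNIV. point x $ i powr (\<alpha> i - 1)) * point x $ k powr \<iota> = (\<Prod>i\<in>I. x i powr (\<beta> i - 1)) * (1 - sum x I) powr (\<beta> j - 1)"
      if pos: "\<forall>i. 0 < point x $ i"
    proof -
      have "point x $ k powr \<iota> = (\<Prod>i\<in>UNIV. if i = k then point x $ i powr \<iota> else 1)"
        by (simp)
      then have "(\<Prod>i\<in>UNIV. point x $ i powr (\<alpha> i - 1)) * point x $ k powr \<iota> = (\<Prod>i\<in>UNIV. point x $ i powr (\<alpha> i - 1) * (if i = k then point x $ i powr \<iota> else 1))"
        by (simp add: prod.distrib)
      also have "\<dots> = (\<Prod>i\<in>UNIV. point x $ i powr (\<beta> i - 1))"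
        by (intro prod.cong) (auto simp: \<beta>_def powr_add[symmetric] algebra_simps)
      also have "\<dots> = (\<Prod>i\<in>I. x i powr (\<beta> i - 1)) * (1 - sum x I) powr (\<beta> j - 1)"
        unfolding prodU by (simp add: ptI ptj)
      finally show ?thesis .
    qed
    show "ennreal (dens (point x)) * ennreal (point x $ k powr \<iota>) = ennreal C * ennreal (if (\<forall>i\<in>I. 0 < x i) \<and> sum x I < 1
         then (\<Prod>i\<in>I. x i powr (\<beta> i - 1)) * (1 - sum x I) powr (\<beta> j - 1) else 0)"
      unfolding dens_def pt[symmetric] using * C
      by (auto simp: ennreal_mult'[symmetric] ennreal_mult''[symmetric] mult.assoc)
  qed
  also have "\<dots> = ennreal C * ennreal ((\<Prod>i\<in>I. Gamma (\<beta> i)) * Gamma (\<beta> j) / Gamma (sum \<beta> I + \<beta> j))"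
    using jI \<beta> by (subst nn_integral_cmult) (auto simp: Dirichlet_nn_integral)
  also have "\<dots> = ennreal (C * ((\<Prod>i\<in>UNIV. Gamma (\<beta> i)) / Gamma (sum \<beta> UNIV)))"
    using C by (simp add: ennreal_mult'[symmetric] prodU sumU mult_ac add_ac)
  also have "C * ((\<Prod>i\<in>UNIV. Gamma (\<beta> i)) / Gamma (sum \<beta> UNIV)) = Gamma (\<alpha> k + \<iota>) * Gamma (\<Sum>k\<in>UNIV. \<alpha> k) / (Gamma (\<alpha> k) * Gamma ((\<Sum>k\<in>UNIV. \<alpha> k) + \<iota>))"
  proof -
    have P: "(\<Prod>i\<in>UNIV. f i) = f k * (\<Prod>i\<in>UNIV - {k}. f i)" for f :: "'k \<Rightarrow> real"
      by (rule prod.remove) auto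
    have "(\<Prod>i\<in>UNIV - {k}. Gamma (\<alpha> i)) \<noteq> 0" "Gamma (\<alpha> k) > 0"
      using \<alpha> by (auto intro!: Gamma_real_pos simp: less_imp_neq[OF Gamma_real_pos, THEN not_sym])
    moreover have "(\<Prod>i\<in>UNIV - {k}. Gamma (\<beta> i)) = (\<Prod>i\<in>UNIV - {k}. Gamma (\<alpha> i))"
      by (intro prod.cong) (auto simp: \<beta>_def)
    moreover have "\<beta> k = \<alpha> k + \<iota>" "sum \<beta> UNIV = (\<Sum>k\<in>UNIV. \<alpha> k) + \<iota>"
      by (auto simp: \<beta>_def sum.distrib)
    ultimately show ?thesis
      unfolding C_def P[of "\<lambda>i. Gamma (\<alpha> i)"] P[of "\<lambda>i. Gamma (\<beta> i)"] by (simp add: field_simps del: prod_zero_iff)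
  qed
  finally show ?thesis .
qed


section \<open>Convergence of tails and vague convergence on the half-line\<close>

text \<open>The measures t P(U / b(t) \<in> .) have total mass t, but \<open>G\<close> vanishes
  below r. Conditioning on U / b(t) > s with 0 < s < r gives probability measures whose distribution
  functions converge, and the limit s^-\<iota> of t P(U > b(t) s) undoes the normalization.\<close>

lemma (in prob_space) tail_convergence_integral:
  fixes U :: "'a \<Rightarrow> real" and G b :: "real \<Rightarrow> real"
  assumes U[measurable]: "U \<in> borel_measurable M" and \<iota>: "\<iota> > 0"
    and tail: "\<And>x. x > 0 \<Longrightarrow> ((\<lambda>t. t * prob {\<omega>\<in>space M. U \<omega> > b t * x}) \<longlongrightarrow> x powr - \<iota>) at_top"
    and b: "\<forall>\<^sub>F t in at_top. b t > 0"
    and G: "continuous_on UNIV G" "\<And>y. \<bar>G y\<bar> \<le> B"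
    and r: "r > 0" "\<And>y. y < r \<Longrightarrow> G y = 0"
  shows "((\<lambda>t. t * expectation (\<lambda>\<omega>. G (U \<omega> / b t))) \<longlongrightarrow> (\<integral>y. G y \<partial>nu \<iota>)) at_top"
proof (rule tendsto_at_topI_sequentially)
  \<comment> \<open>Weak convergence is a notion for sequences of laws, so t runs along an arbitrary
    sequence.\<close>
  fix X :: "nat \<Rightarrow> real" assume X: "filterlim X at_top sequentially"
  define s where "s = r / 2"
  have s: "s > 0" "s < r" using r by (auto simp: s_def)
  have [measurable]: "G \<in> borel_measurable borel" by (rule borel_measurable_continuous_onI[OF G(1)])
  define p where "p = (\<lambda>n. prob {\<omega>\<in>space M. U \<omega> > b (X n) * s})"
  have lim: "(\<lambda>n. X n * prob {\<omega>\<in>space M. U \<omega> > b (X n) * x}) \<longlonglongrightarrow> x powr - \<iota>" if "x > 0" for x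
    using filterlim_compose[OF tail[OF that] X] .
  have "\<forall>\<^sub>F n in sequentially. X n * p n > 0"
    unfolding p_def by (rule order_tendstoD[OF lim[OF s(1)]]) (use s in simp)
  moreover have "\<forall>\<^sub>F n in sequentially. b (X n) > 0"
    using filterlim_iff X b by blast
  moreover have "\<forall>\<^sub>F n in sequentially. X n > 0"
    using filterlim_at_top_dense X by blast
  ultimately have "\<forall>\<^sub>F n in sequentially. X n > 0 \<and> b (X n) > 0 \<and> p n > 0"
    by eventually_elim (auto simp: zero_less_mult_iff)
  \<comment> \<open>A finite initial segment is dropped so that division by \<open>q n\<close> is
    sound; \<open>LIMSEQ_offset\<close> restores it at the end.\<close>
  then obtain n0 where n0: "\<And>n. n \<ge> n0 \<Longrightarrow> X n > 0 \<and> b (X n) > 0 \<and> p n > 0"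
    by (auto simp: eventually_sequentially)
  define Y where "Y = (\<lambda>n. X (n + n0))"
  define q where "q = (\<lambda>n. p (n + n0))"
  have Y: "Y n > 0" "b (Y n) > 0" "q n > 0" for n using n0[of "n + n0"] by (auto simp: Y_def q_def)
  have q: "q n = prob {\<omega>\<in>space M. U \<omega> > b (Y n) * s}" for n by (simp add: q_def p_def Y_def)
  have limY: "(\<lambda>n. Y n * prob {\<omega>\<in>space M. U \<omega> > b (Y n) * x}) \<longlonglongrightarrow> x powr - \<iota>" if "x > 0" for x
    using LIMSEQ_ignore_initial_segment[OF lim[OF that], of n0] by (simp add: Y_def)
  \<comment> \<open>\<open>\<mu> n\<close> is the law of U / b given that it exceeds s;
    \<open>m\<close> is the normalized restriction of \<open>nu \<iota>\<close> to the values above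
    s, moved to the Borel sets of the whole line.\<close>
  define \<mu> where "\<mu> = (\<lambda>n. density (distr M borel (\<lambda>\<omega>. U \<omega> / b (Y n))) (\<lambda>y. ennreal (indicator {s<..} y / q n)))"
  define m where "m = distr (density (nu \<iota>) (\<lambda>y. ennreal (indicator {s<..} y * s powr \<iota>))) borel (\<lambda>y. y)"
  note mn = measurable_nu[OF \<iota>]
  have \<mu>_tail: "emeasure (\<mu> n) {x<..} = ennreal (prob {\<omega>\<in>space M. U \<omega> > b (Y n) * max x s} / q n)" for n x
  proof -
    have "emeasure (\<mu> n) {x<..} = (\<integral>\<^sup>+y. ennreal (1 / q n) * indicator {max x s<..} y \<partial>distr M borel (\<lambda>\<omega>. U \<omega> / b (Y n)))"
      unfolding \<mu>_def by (subst emeasure_density) (auto intro!: nn_integral_cong simp: indicator_def)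
    also have "\<dots> = ennreal (1 / q n) * emeasure M ((\<lambda>\<omega>. U \<omega> / b (Y n)) -` {max x s<..} \<inter> space M)"
      by (simp add: nn_integral_cmult emeasure_distr)
    also have "(\<lambda>\<omega>. U \<omega> / b (Y n)) -` {max x s<..} \<inter> space M = {\<omega>\<in>space M. U \<omega> > b (Y n) * max x s}"
      using Y(2)[of n] by (auto simp: field_simps pos_less_divide_eq simp del: max_less_iff_conj)
    finally show ?thesis using Y(3)[of n] by (simp add: emeasure_eq_measure ennreal_mult'[symmetric])
  qed
  have m_tail: "emeasure m {x<..} = ennreal (max x s powr - \<iota> / s powr - \<iota>)" for x
  proof -
    have A: "{0<..} \<inter> {x<..} \<in> sets (nu \<iota>)"
      unfolding sets_nu[OF \<iota>] sets_restrict_space by (rule imageI) simp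
    have "emeasure m {x<..} = emeasure (density (nu \<iota>) (\<lambda>y. ennreal (indicator {s<..} y * s powr \<iota>))) ({0<..} \<inter> {x<..})"
      unfolding m_def
      by (subst emeasure_distr) (auto simp: measurable_nu_ident[OF \<iota>] nu_space[OF \<iota>] intro: arg_cong2[where f = emeasure])
    also have "\<dots> = (\<integral>\<^sup>+y. ennreal (s powr \<iota>) * indicator {max x s<..} y \<partial>nu \<iota>)"
      by (subst emeasure_density[OF _ A])
         (auto intro!: nn_integral_cong mn simp: indicator_def nu_space[OF \<iota>] simp del: max_less_iff_conj split: if_splits)
    also have "\<dots> = ennreal (s powr \<iota>) * emeasure (nu \<iota>) {max x s<..}"
      using s by (subst nn_integral_cmult_indicator) (auto simp: sets_nu[OF \<iota>] sets_restrict_space intro!: image_eqI[of _ _ "{max x s<..}"])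
    also have "\<dots> = ennreal (max x s powr - \<iota> / s powr - \<iota>)"
      using s \<iota> by (simp add: nu_tail ennreal_mult'[symmetric] powr_minus field_simps)
    finally show ?thesis .
  qed
  have UNIV_limit: "(\<Union>n. {- real n<..}) = (UNIV :: real set)"
    using reals_Archimedean2[of "- x" for x] by (auto simp: minus_less_iff)
  \<comment> \<open>Tails starting at or below s already have mass 1, and the tails from -n exhaust
    the line.\<close>
  have total: "emeasure N' UNIV = 1" if "sets N' = sets borel" "\<And>x. x \<le> s \<Longrightarrow> emeasure N' {x<..} = 1" for N' :: "real measure"
  proof -
    have "(\<lambda>n. emeasure N' {- real n<..}) \<longlonglongrightarrow> emeasure N' (\<Union>n. {- real n<..})"
      by (rule Lim_emeasure_incseq) (use that in \<open>auto simp: incseq_def\<close>)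
    moreover have "emeasure N' {- real n<..} = 1" for n using that(2)[of "- real n"] s by simp
    ultimately show ?thesis unfolding UNIV_limit by (simp add: LIMSEQ_const_iff)
  qed
  have max_s: "max x s = s" if "x \<le> s" for x using that by (simp add: max_def)
  have rm: "real_distribution m"
  proof (intro real_distribution.intro real_distribution_axioms.intro prob_spaceI)
    show "sets m = sets borel" by (auto simp: m_def)
    have "emeasure m UNIV = 1"
      by (rule total) (use s in \<open>simp_all add: m_tail max_s m_def[symmetric]\<close>, simp add: m_def)
    then show "emeasure m (space m) = 1" by (simp add: m_def)
  qed
  have rmu: "real_distribution (\<mu> n)" for n
  proof (intro real_distribution.intro real_distribution_axioms.intro prob_spaceI)
    show "sets (\<mu> n) = sets borel" by (auto simp: \<mu>_def)
    have "emeasure (\<mu> n) UNIV = 1"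
      by (rule total) (use s Y(3)[of n] in \<open>simp_all add: \<mu>_tail max_s q[symmetric]\<close>, simp add: \<mu>_def)
    then show "emeasure (\<mu> n) (space (\<mu> n)) = 1" by (simp add: \<mu>_def)
  qed
  have cdf: "cdf N' x = 1 - measure N' {x<..}" if "real_distribution N'" for N' x
  proof -
    interpret N': real_distribution N' by fact
    have "measure N' (space N' - {x<..}) = 1 - measure N' {x<..}" by (rule N'.prob_compl) simp
    moreover have "space N' - {x<..} = {..x}" by auto
    ultimately show ?thesis by (simp add: cdf_def)
  qed
  have "weak_conv_m \<mu> m"
    unfolding weak_conv_m_def weak_conv_def
  proof (intro allI impI)
    fix x
    \<comment> \<open>The conditioned laws have no mass up to s, so the tail at x is the one at
      \<open>max x s\<close>.\<close>
    let ?z = "max x s"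
    have z: "?z > 0" using s by auto
    have "(\<lambda>n. (Y n * prob {\<omega>\<in>space M. U \<omega> > b (Y n) * ?z}) / (Y n * q n)) \<longlonglongrightarrow> ?z powr - \<iota> / s powr - \<iota>"
      unfolding q by (intro tendsto_divide limY z s) (use s in simp)
    then have "(\<lambda>n. prob {\<omega>\<in>space M. U \<omega> > b (Y n) * ?z} / q n) \<longlonglongrightarrow> ?z powr - \<iota> / s powr - \<iota>"
      using Y(1) by (simp add: less_imp_neq[THEN not_sym])
    moreover have "measure (\<mu> n) {x<..} = prob {\<omega>\<in>space M. U \<omega> > b (Y n) * ?z} / q n" for n
      using \<mu>_tail[of n x] Y(3)[of n] by (simp add: measure_def)
    moreover have "measure m {x<..} = ?z powr - \<iota> / s powr - \<iota>"
      using m_tail[of x] by (simp add: measure_def)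
    ultimately have "(\<lambda>n. 1 - measure (\<mu> n) {x<..}) \<longlonglongrightarrow> 1 - measure m {x<..}"
      by (intro tendsto_diff tendsto_const) simp
    then show "(\<lambda>n. cdf (\<mu> n) x) \<longlonglongrightarrow> cdf m x"
      by (simp add: cdf[OF rm] cdf[OF rmu])
  qed
  then have "(\<lambda>n. integral\<^sup>L (\<mu> n) G) \<longlonglongrightarrow> integral\<^sup>L m G"
    using G by (intro weak_conv_imp_integral_bdd_continuous_conv[OF rmu rm]) (auto simp: continuous_on_eq_continuous_at)
  then have "(\<lambda>n. (Y n * q n) * integral\<^sup>L (\<mu> n) G) \<longlonglongrightarrow> s powr - \<iota> * integral\<^sup>L m G"
    unfolding q by (intro tendsto_mult limY s)
  moreover have "(Y n * q n) * integral\<^sup>L (\<mu> n) G = Y n * expectation (\<lambda>\<omega>. G (U \<omega> / b (Y n)))" for n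
  proof -
    have "integral\<^sup>L (\<mu> n) G = (\<integral>y. (indicator {s<..} y / q n) * G y \<partial>distr M borel (\<lambda>\<omega>. U \<omega> / b (Y n)))"
      unfolding \<mu>_def using Y(3)[of n] by (subst integral_density) auto
    also have "(\<lambda>y. (indicator {s<..} y / q n) * G y) = (\<lambda>y. G y / q n)"
      using r s by (auto simp: indicator_def fun_eq_iff)
    also have "(\<integral>y. G y / q n \<partial>distr M borel (\<lambda>\<omega>. U \<omega> / b (Y n))) = expectation (\<lambda>\<omega>. G (U \<omega> / b (Y n))) / q n"
      by (simp add: integral_distr)
    finally show ?thesis using Y(3)[of n] by simp
  qed
  moreover have "s powr - \<iota> * integral\<^sup>L m G = (\<integral>y. G y \<partial>nu \<iota>)"
  proof -
    have "integral\<^sup>L m G = (\<integral>y. G y \<partial>density (nu \<iota>) (\<lambda>y. ennreal (indicator {s<..} y * s powr \<iota>)))"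
      unfolding m_def by (subst integral_distr) (auto simp: measurable_nu_ident[OF \<iota>])
    also have "\<dots> = (\<integral>y. (indicator {s<..} y * s powr \<iota>) * G y \<partial>nu \<iota>)"
      by (subst integral_density) (auto simp: mn)
    also have "(\<lambda>y. (indicator {s<..} y * s powr \<iota>) * G y) = (\<lambda>y. s powr \<iota> * G y)"
      using r s by (auto simp: indicator_def fun_eq_iff)
    finally show ?thesis using s by (simp add: powr_minus field_simps)
  qed
  ultimately have "(\<lambda>n. Y n * expectation (\<lambda>\<omega>. G (U \<omega> / b (Y n)))) \<longlonglongrightarrow> (\<integral>y. G y \<partial>nu \<iota>)" by simp
  then show "(\<lambda>n. X n * expectation (\<lambda>\<omega>. G (U \<omega> / b (X n)))) \<longlonglongrightarrow> (\<integral>y. G y \<partial>nu \<iota>)"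
    unfolding Y_def by (rule LIMSEQ_offset)
qed


section \<open>Radial measures on the orthant\<close>

text \<open>Membership in \<open>cone_test_functions\<close> constrains a function on the cone only,
  while a count vector may be zero. With value 0 elsewhere, the integral against a restricted law
  becomes a plain expectation.\<close>

definition zero_outside :: "'a set \<Rightarrow> ('a \<Rightarrow> real) \<Rightarrow> 'a \<Rightarrow> real" where
  "zero_outside S f x = (if x \<in> S then f x else 0)"

lemma test_function_zero_near:
  assumes "f \<in> cone_test_functions C C0"
  obtains r where "r > 0" "\<And>x y. x \<in> C - C0 \<Longrightarrow> y \<in> C0 \<Longrightarrow> dist x y < r \<Longrightarrow> f x = 0"
proof -
  from assms obtain r where r: "r > 0" "\<And>x y. x \<in> (C - C0) \<inter> closure {x \<in> C - C0. f x \<noteq> 0} \<Longrightarrow> y \<in> C0 \<Longrightarrow> r \<le> dist x y"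
    by (auto simp: cone_test_functions_def bounded_away_def)
  show thesis
  proof (rule that[OF r(1)])
    fix x y assume xy: "x \<in> C - C0" "y \<in> C0" "dist x y < r"
    show "f x = 0"
    proof (rule ccontr)
      assume "f x \<noteq> 0"
      then have "x \<in> (C - C0) \<inter> closure {x \<in> C - C0. f x \<noteq> 0}"
        using xy closure_subset[of "{x \<in> C - C0. f x \<noteq> 0}"] by blast
      from r(2)[OF this xy(2)] show False using xy(3) by simp
    qed
  qed
qed

lemma test_function_bounded:
  assumes "f \<in> cone_test_functions C C0"
  obtains B where "B \<ge> 0" "\<And>x. \<bar>zero_outside (C - C0) f x\<bar> \<le> B"
proof -
  from assms have "bounded (f ` (C - C0))" by (simp add: cone_test_functions_def)
  then obtain B where "\<And>x. x \<in> C - C0 \<Longrightarrow> norm (f x) \<le> B" by (auto simp: bounded_iff)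
  then show thesis by (intro that[of "max B 0"]) (auto simp: zero_outside_def le_max_iff_disj)
qed

text \<open>The cone is covered by two relatively open pieces: \<open>C - C0\<close>, where the
  extension is \<open>f\<close>, and a uniform neighbourhood of \<open>C0\<close>, where it is
  zero.\<close>

lemma continuous_on_zero_outside:
  assumes f: "f \<in> cone_test_functions C C0" and C0: "closed C0"
  shows "continuous_on C (zero_outside (C - C0) f)"
proof -
  obtain r where r: "r > 0" "\<And>x y. x \<in> C - C0 \<Longrightarrow> y \<in> C0 \<Longrightarrow> dist x y < r \<Longrightarrow> f x = 0"
    using test_function_zero_near[OF f] by blast
  let ?T = "C \<inter> (\<Union>y\<in>C0. ball y r)"
  have "continuous_on (C - C0) f" using f by (simp add: cone_test_functions_def)
  then have 1: "continuous_on (C - C0) (zero_outside (C - C0) f)"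
    by (rule continuous_on_eq) (simp add: zero_outside_def)
  have "zero_outside (C - C0) f x = 0" if "x \<in> ?T" for x
    using that r(2)[of x] by (auto simp: zero_outside_def dist_commute)
  then have 2: "continuous_on ?T (zero_outside (C - C0) f)"
    by (intro continuous_on_eq[OF continuous_on_const[of ?T 0]]) auto
  have C: "(C - C0) \<union> ?T = C" using r(1) by (auto intro!: bexI)
  have "openin (top_of_set ((C - C0) \<union> ?T)) (C - C0)"
    unfolding C using C0 by (auto simp: Diff_eq intro!: openin_open_Int)
  moreover have "openin (top_of_set ((C - C0) \<union> ?T)) ?T"
    unfolding C by (intro openin_open_Int) auto
  ultimately have "continuous_on ((C - C0) \<union> ?T) (zero_outside (C - C0) f)"
    using 1 2 by (rule continuous_on_Un_local_open)
  then show ?thesis by (simp only: C)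
qed

lemma borel_measurable_zero_outside:
  fixes C :: "'a::metric_space set"
  assumes f: "f \<in> cone_test_functions C C0" and S: "C - C0 \<in> sets borel"
  shows "zero_outside (C - C0) f \<in> borel_measurable borel"
    and "f \<in> borel_measurable (restrict_space borel (C - C0))"
proof -
  show m: "f \<in> borel_measurable (restrict_space borel (C - C0))"
    using f by (intro borel_measurable_continuous_on_restrict) (simp add: cone_test_functions_def)
  have "zero_outside (C - C0) f = (\<lambda>x. indicator (C - C0) x *\<^sub>R f x)"
    by (auto simp: zero_outside_def indicator_def)
  moreover have "\<dots> \<in> borel_measurable borel"
    using m S by (subst (asm) borel_measurable_restrict_space_iff) auto
  ultimately show "zero_outside (C - C0) f \<in> borel_measurable borel" by simp
qed

lemma (in prob_space) integral_scaled_law: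
  fixes Y :: "'a \<Rightarrow> 'b::metric_space"
  assumes f: "f \<in> cone_test_functions C C0" and S: "C - C0 \<in> sets borel"
    and Y: "Y \<in> borel_measurable M" and t: "0 \<le> t"
  shows "integral\<^sup>L (scaled_law M (C - C0) t Y) f = t * expectation (\<lambda>\<omega>. zero_outside (C - C0) f (Y \<omega>))"
proof -
  note m = borel_measurable_zero_outside[OF f S]
  have "f \<in> borel_measurable (restrict_space (distr M borel Y) (C - C0))"
    using m(2) by (subst measurable_cong_sets[OF sets_restrict_space_cong refl, of _ borel]) auto
  then have "integral\<^sup>L (scaled_law M (C - C0) t Y) f = t * integral\<^sup>L (restrict_space (distr M borel Y) (C - C0)) f"
    unfolding scaled_law_def by (rule integral_scale_measure[OF t])
  also have "integral\<^sup>L (restrict_space (distr M borel Y) (C - C0)) f = (\<integral>x. indicator (C - C0) x *\<^sub>R f x \<partial>distr M borel Y)"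
    using S by (intro integral_restrict_space) auto
  also have "(\<lambda>x. indicator (C - C0) x *\<^sub>R f x) = zero_outside (C - C0) f"
    by (auto simp: zero_outside_def indicator_def)
  also have "integral\<^sup>L (distr M borel Y) (zero_outside (C - C0) f) = expectation (\<lambda>\<omega>. zero_outside (C - C0) f (Y \<omega>))"
    using Y m(1) by (rule integral_distr)
  finally show ?thesis .
qed

lemma (in prob_space) scaled_law_in_cone_measures:
  fixes Y :: "'a \<Rightarrow> 'b::metric_space"
  assumes S: "C - C0 \<in> sets borel" and Y: "Y \<in> borel_measurable M"
  shows "scaled_law M (C - C0) t Y \<in> cone_measures C C0"
proof -
  have s: "sets (scaled_law M (C - C0) t Y) = sets (restrict_space borel (C - C0))"
    unfolding scaled_law_def sets_scale_measure by (rule sets_restrict_space_cong) simp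
  have "emeasure (scaled_law M (C - C0) t Y) A < \<infinity>" if "A \<in> sets (scaled_law M (C - C0) t Y)" for A
  proof -
    have "A \<subseteq> C - C0" using that unfolding s sets_restrict_space by auto
    then have "emeasure (scaled_law M (C - C0) t Y) A = ennreal t * emeasure (distr M borel Y) A"
      unfolding scaled_law_def using S by (simp add: emeasure_restrict_space)
    also have "\<dots> \<le> ennreal t * 1"
      using prob_space.emeasure_le_1[OF prob_space_distr[OF Y]] by (intro mult_left_mono) auto
    finally show ?thesis by (simp add: less_top[symmetric] top_unique)
      (metis ennreal_neq_top mult.right_neutral top_unique)
  qed
  then show ?thesis using s by (simp add: cone_measures_def)
qed

lemma (in prob_space) cone_convergenceI:
  fixes Y :: "real \<Rightarrow> 'a \<Rightarrow> 'b::metric_space"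
  assumes S: "C - C0 \<in> sets borel" and Y: "\<And>t. Y t \<in> borel_measurable M"
    and \<mu>: "\<mu> \<in> cone_measures C C0"
    and conv: "\<And>f. f \<in> cone_test_functions C C0 \<Longrightarrow>
      ((\<lambda>t. t * expectation (\<lambda>\<omega>. zero_outside (C - C0) f (Y t \<omega>))) \<longlongrightarrow> integral\<^sup>L \<mu> f) at_top"
  shows "cone_convergence C C0 (\<lambda>t. scaled_law M (C - C0) t (Y t)) \<mu> at_top"
  unfolding cone_convergence_def
proof (intro conjI ballI)
  show "\<forall>\<^sub>F t in at_top. scaled_law M (C - C0) t (Y t) \<in> cone_measures C C0"
    using scaled_law_in_cone_measures[OF S Y] by simp
  fix f assume f: "f \<in> cone_test_functions C C0"
  \<comment> \<open>For negative t the factor \<open>ennreal t\<close> is 0, so the law integrates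
    to t times an expectation only from t = 0 on.\<close>
  have "\<forall>\<^sub>F t::real in at_top. 0 \<le> t" by (rule eventually_ge_at_top)
  then have "\<forall>\<^sub>F t in at_top. t * expectation (\<lambda>\<omega>. zero_outside (C - C0) f (Y t \<omega>)) = integral\<^sup>L (scaled_law M (C - C0) t (Y t)) f"
    by eventually_elim (simp add: integral_scaled_law[OF f S Y])
  then show "((\<lambda>t. integral\<^sup>L (scaled_law M (C - C0) t (Y t)) f) \<longlongrightarrow> integral\<^sup>L \<mu> f) at_top"
    by (rule Lim_transform_eventually[OF conv[OF f]])
qed fact

section \<open>Borel structure of the orthant and of the simplex\<close>

lemma closed_nonneg_orthant: "closed (nonneg_orthant :: (real ^ 'p) set)"
  unfolding nonneg_orthant_def by (intro closed_Collect_all closed_Collect_le continuous_intros)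

lemma closed_prob_simplex: "closed (prob_simplex :: (real ^ 'p) set)"
  unfolding prob_simplex_def
  by (intro closed_Collect_conj closed_Collect_all closed_Collect_le closed_Collect_eq continuous_intros)

lemma orthant_borel: "nonneg_orthant - {0} \<in> sets borel"
  by (intro sets.Diff borel_closed closed_nonneg_orthant) auto

lemma polar_cone_eq: "prob_simplex \<times> {0..} - prob_simplex \<times> {0} = prob_simplex \<times> {0::real<..}"
  by auto

lemma polar_cone_borel: "(prob_simplex :: (real ^ 'p) set) \<times> {0::real<..} \<in> sets borel"
  unfolding borel_prod[symmetric] by (rule pair_measureI[OF borel_closed[OF closed_prob_simplex]]) auto

lemma norm_prob_simplex_le:
  assumes "p \<in> prob_simplex" shows "norm p \<le> 1"
proof -
  have "norm p \<le> (\<Sum>i\<in>UNIV. \<bar>p $ i\<bar>)" by (rule norm_le_l1_cart)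
  also have "\<dots> = (\<Sum>i\<in>UNIV. p $ i)" using assms by (auto simp: prob_simplex_def)
  finally show ?thesis using assms by (simp add: prob_simplex_def)
qed

text \<open>Polar coordinates with respect to the sum of the entries: each p in the simplex has sum
  1, so y is the radial part of \<open>y *\<^sub>R p\<close> and \<open>Q\<close> is the angular
  law.\<close>

definition radial_measure :: "(real ^ 'p) measure \<Rightarrow> real \<Rightarrow> (real ^ 'p) measure" where
  "radial_measure Q c = distr (Q \<Otimes>\<^sub>M nu c) (restrict_space borel (nonneg_orthant - {0})) (\<lambda>(p, y). y *\<^sub>R p)"

section \<open>Angular law times power measure, and its radial image\<close>

context
  fixes Q :: "(real ^ 'p) measure" and c :: real
  assumes Q: "prob_space Q" "sets Q = sets (restrict_space borel prob_simplex)" and c: "c > 0"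
begin

interpretation Q: prob_space Q by (rule Q)
interpretation N: sigma_finite_measure "nu c" by (rule sigma_finite_nu[OF c])
interpretation pair_sigma_finite Q "nu c" ..

lemma simplex_space: "space Q = prob_simplex"
  using sets_eq_imp_space_eq[OF Q(2)] by (simp add: space_restrict_space)

lemma polar_space: "space (Q \<Otimes>\<^sub>M nu c) = prob_simplex \<times> {0<..}"
  by (simp add: space_pair_measure simplex_space nu_space[OF c])

text \<open>\<open>cone_measures\<close> asks for the trace of the Borel sets of the product space,
  whereas the product measure carries the product of two traces. They agree because the identity is
  measurable both ways.\<close>

lemma polar_sets: "sets (Q \<Otimes>\<^sub>M nu c) = sets (restrict_space borel (prob_simplex \<times> {0<..}))"
proof -
  let ?P = "restrict_space borel prob_simplex \<Otimes>\<^sub>M restrict_space borel {0<..} :: ((real ^ 'p) \<times> real) measure"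
  let ?R = "restrict_space borel (prob_simplex \<times> {0<..}) :: ((real ^ 'p) \<times> real) measure"
  have sp: "space ?P = space ?R" by (simp add: space_pair_measure space_restrict_space)
  have "fst \<in> measurable ?R (restrict_space borel prob_simplex)" "snd \<in> measurable ?R (restrict_space borel {0<..})"
    by (rule measurable_restrict_space2; auto intro!: measurable_restrict_space1 borel_measurable_continuous_onI
        continuous_on_fst continuous_on_snd simp: space_restrict_space)+
  then have "(\<lambda>z. (fst z, snd z)) \<in> measurable ?R ?P" by (rule measurable_Pair)
  then have "sets ?P \<subseteq> sets ?R" by (intro sets_subset_if_ident_measurable sp[symmetric]) simp
  moreover have "(\<lambda>z. z) \<in> measurable ?P ?R"
  proof (rule measurable_restrict_space2)
    have "(\<lambda>x. x) \<in> borel_measurable (restrict_space borel (prob_simplex :: (real ^ 'p) set))"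
      "(\<lambda>x. x) \<in> borel_measurable (restrict_space borel {0::real<..})"
      by (rule measurable_restrict_space1; simp)+
    then have "(\<lambda>z. (fst z, snd z)) \<in> measurable ?P (borel \<Otimes>\<^sub>M borel)"
      by (intro measurable_Pair measurable_compose[OF measurable_fst] measurable_compose[OF measurable_snd])
    then show "(\<lambda>z. z) \<in> measurable ?P borel" by (simp add: borel_prod)
  qed (auto simp: space_pair_measure space_restrict_space)
  then have "sets ?R \<subseteq> sets ?P" by (rule sets_subset_if_ident_measurable[OF _ sp])
  ultimately have "sets ?P = sets ?R" by simp
  moreover have "sets (Q \<Otimes>\<^sub>M nu c) = sets ?P" using Q(2) sets_nu[OF c] by (rule sets_pair_measure_cong)
  ultimately show ?thesis by simp
qed

lemma polar_tail:
  assumes "r > 0"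
  shows "emeasure (Q \<Otimes>\<^sub>M nu c) (prob_simplex \<times> {r<..}) = ennreal (r powr - c)"
    and "prob_simplex \<times> {r<..} \<in> sets (Q \<Otimes>\<^sub>M nu c)"
proof -
  have 1: "prob_simplex \<in> sets Q" using sets.top[of Q] by (simp add: simplex_space)
  have 2: "{r<..} \<in> sets (nu c)"
    unfolding sets_nu[OF c] using assms by (auto simp: sets_restrict_space intro!: image_eqI[of _ _ "{r<..}"])
  show "prob_simplex \<times> {r<..} \<in> sets (Q \<Otimes>\<^sub>M nu c)" using 1 2 by (rule pair_measureI)
  have "emeasure (Q \<Otimes>\<^sub>M nu c) (prob_simplex \<times> {r<..}) = emeasure Q prob_simplex * emeasure (nu c) {r<..}"
    by (rule N.emeasure_pair_measure_Times[OF 1 2])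
  also have "emeasure Q prob_simplex = 1" using Q.emeasure_space_1 by (simp add: simplex_space)
  finally show "emeasure (Q \<Otimes>\<^sub>M nu c) (prob_simplex \<times> {r<..}) = ennreal (r powr - c)"
    using assms by (simp add: nu_tail[OF c])
qed

lemma polar_finite:
  assumes "r > 0" "A \<subseteq> prob_simplex \<times> {r<..}"
  shows "emeasure (Q \<Otimes>\<^sub>M nu c) A < \<infinity>"
  using emeasure_mono[OF assms(2) polar_tail(2)[OF assms(1)]] polar_tail(1)[OF assms(1)]
  by (simp add: order_le_less_trans)

text \<open>The point (p, 0) of the removed cone lies at distance y from (p, y), so a set bounded
  away from that cone has radial parts bounded below.\<close>

lemma polar_measure_in_cone_measures:
  "Q \<Otimes>\<^sub>M nu c \<in> cone_measures (prob_simplex \<times> {0..}) (prob_simplex \<times> {0})"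
  unfolding cone_measures_def polar_cone_eq
proof (intro CollectI conjI ballI impI polar_sets)
  fix A assume A: "A \<in> sets (Q \<Otimes>\<^sub>M nu c)" "bounded_away A ((prob_simplex :: (real ^ 'p) set) \<times> {0::real})"
  then obtain r where r: "r > 0" "\<And>x y. x \<in> A \<Longrightarrow> y \<in> prob_simplex \<times> {0} \<Longrightarrow> r \<le> dist x y"
    by (auto simp: bounded_away_def)
  \<comment> \<open>The tail is open while the bound r \<le> y is not strict, hence r / 2.\<close>
  have "A \<subseteq> prob_simplex \<times> {r / 2<..}"
  proof
    fix x assume x: "x \<in> A"
    then have x': "fst x \<in> prob_simplex" "snd x > 0" using sets.sets_into_space[OF A(1)] by (auto simp: polar_space)
    then have "r \<le> dist x (fst x, 0)" using r(2)[OF x] by auto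
    also have "\<dots> = snd x" using x' by (simp add: dist_prod_def dist_real_def)
    finally show "x \<in> prob_simplex \<times> {r / 2<..}" using x' r(1) by (auto simp: mem_Times_iff)
  qed
  then show "emeasure (Q \<Otimes>\<^sub>M nu c) A < \<infinity>" using r(1) by (intro polar_finite[of "r / 2"]) auto
qed

text \<open>Fubini requires integrability: \<open>f\<close> is bounded and vanishes for small radial
  part, hence lives on a set of finite mass.\<close>

lemma polar_integral:
  fixes f :: "(real ^ 'p) \<times> real \<Rightarrow> real"
  assumes m: "f \<in> borel_measurable (Q \<Otimes>\<^sub>M nu c)"
    and B: "\<And>p y. p \<in> prob_simplex \<Longrightarrow> y > 0 \<Longrightarrow> \<bar>f (p, y)\<bar> \<le> B"
    and r: "r > 0" "\<And>p y. p \<in> prob_simplex \<Longrightarrow> 0 < y \<Longrightarrow> y < r \<Longrightarrow> f (p, y) = 0"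
  shows "integral\<^sup>L (Q \<Otimes>\<^sub>M nu c) f = (\<integral>y. (\<integral>p. f (p, y) \<partial>Q) \<partial>nu c)"
proof -
  have "integrable (Q \<Otimes>\<^sub>M nu c) f"
  proof (rule integrableI_bounded_set[where A = "prob_simplex \<times> {r / 2<..}" and B = B])
    show "emeasure (Q \<Otimes>\<^sub>M nu c) (prob_simplex \<times> {r / 2<..}) < \<infinity>"
      using r by (intro polar_finite[of "r / 2"]) auto
    show "prob_simplex \<times> {r / 2<..} \<in> sets (Q \<Otimes>\<^sub>M nu c)" using r by (intro polar_tail) simp
    show "AE x in Q \<Otimes>\<^sub>M nu c. x \<in> prob_simplex \<times> {r / 2<..} \<longrightarrow> norm (f x) \<le> B"
      by (rule AE_I2) (use B in \<open>auto simp: polar_space\<close>)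
    show "AE x in Q \<Otimes>\<^sub>M nu c. x \<notin> prob_simplex \<times> {r / 2<..} \<longrightarrow> f x = 0"
    proof (intro AE_I2 impI)
      fix x assume x: "x \<in> space (Q \<Otimes>\<^sub>M nu c)" "x \<notin> prob_simplex \<times> {r / 2<..}"
      then have "fst x \<in> prob_simplex" "0 < snd x" "snd x < r" using r(1) by (auto simp: polar_space)
      from r(2)[OF this] show "f x = 0" by simp
    qed
  qed fact
  then show ?thesis using integral_snd[of "\<lambda>p y. f (p, y)"] by simp
qed

lemma radial_map_measurable:
  "(\<lambda>(p, y). y *\<^sub>R p) \<in> measurable (Q \<Otimes>\<^sub>M nu c) (restrict_space borel (nonneg_orthant - {0}))"
proof (rule measurable_restrict_space2)
  show "(\<lambda>(p, y). y *\<^sub>R p) \<in> space (Q \<Otimes>\<^sub>M nu c) \<rightarrow> nonneg_orthant - {0}"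
    by (auto simp: polar_space nonneg_orthant_def prob_simplex_def)
  have "(\<lambda>(p, y). y *\<^sub>R p) \<in> borel_measurable (borel :: ((real ^ 'p) \<times> real) measure)"
    by (intro borel_measurable_continuous_onI) (simp add: case_prod_beta continuous_intros)
  then have "(\<lambda>(p, y). y *\<^sub>R p) \<in> borel_measurable (restrict_space (borel :: ((real ^ 'p) \<times> real) measure) (prob_simplex \<times> {0<..}))"
    by (rule measurable_restrict_space1)
  then show "(\<lambda>(p, y). y *\<^sub>R p) \<in> borel_measurable (Q \<Otimes>\<^sub>M nu c)"
    using measurable_cong_sets[OF polar_sets refl] by blast
qed

text \<open>Finiteness transfers from the product because vectors of the simplex have norm at most
  1: a point \<open>y *\<^sub>R p\<close> of norm at least r has y \<ge> r.\<close>

lemma radial_measure_in_cone_measures: "radial_measure Q c \<in> cone_measures nonneg_orthant {0}"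
  unfolding cone_measures_def
proof (intro CollectI conjI ballI impI)
  show "sets (radial_measure Q c) = sets (restrict_space borel (nonneg_orthant - {0}))"
    by (simp add: radial_measure_def)
  fix A assume A: "A \<in> sets (radial_measure Q c)" "bounded_away A {0}"
  then obtain r where r: "r > 0" "\<And>x. x \<in> A \<Longrightarrow> r \<le> norm x"
    by (auto simp: bounded_away_def)
  have "(\<lambda>(p, y). y *\<^sub>R p) -` A \<inter> space (Q \<Otimes>\<^sub>M nu c) \<subseteq> prob_simplex \<times> {r / 2<..}"
  proof
    fix z assume "z \<in> (\<lambda>(p, y). y *\<^sub>R p) -` A \<inter> space (Q \<Otimes>\<^sub>M nu c)"
    then obtain p y where z: "z = (p, y)" "y *\<^sub>R p \<in> A" "p \<in> prob_simplex" "y > 0"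
      by (auto simp: polar_space)
    have "r \<le> y * norm p" using r(2)[OF z(2)] z(4) by simp
    also have "\<dots> \<le> y * 1" using norm_prob_simplex_le[OF z(3)] z(4) by (intro mult_left_mono) auto
    finally show "z \<in> prob_simplex \<times> {r / 2<..}" using r(1) z by auto
  qed
  moreover have "emeasure (radial_measure Q c) A = emeasure (Q \<Otimes>\<^sub>M nu c) ((\<lambda>(p, y). y *\<^sub>R p) -` A \<inter> space (Q \<Otimes>\<^sub>M nu c))"
    using A(1) unfolding radial_measure_def by (intro emeasure_distr radial_map_measurable) simp
  ultimately show "emeasure (radial_measure Q c) A < \<infinity>"
    using polar_finite[of "r / 2"] r(1) by simp
qed

lemma radial_measure_nonzero: "emeasure (radial_measure Q c) (space (radial_measure Q c)) \<noteq> 0"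
proof -
  have "ennreal (1 powr - c) \<le> emeasure (Q \<Otimes>\<^sub>M nu c) (space (Q \<Otimes>\<^sub>M nu c))"
    using polar_tail(1)[of 1] emeasure_space[of "Q \<Otimes>\<^sub>M nu c" "prob_simplex \<times> {1<..}"] by simp
  moreover have "emeasure (radial_measure Q c) (space (radial_measure Q c)) = emeasure (Q \<Otimes>\<^sub>M nu c) (space (Q \<Otimes>\<^sub>M nu c))"
    unfolding radial_measure_def
    using emeasure_distr[OF radial_map_measurable sets.top] measurable_space[OF radial_map_measurable]
    by (auto simp: intro!: arg_cong2[where f = emeasure])
  ultimately show ?thesis by auto
qed

lemma radial_integral:
  assumes f: "f \<in> cone_test_functions nonneg_orthant {0}"
  shows "integral\<^sup>L (radial_measure Q c) f = (\<integral>y. (\<integral>p. f (y *\<^sub>R p) \<partial>Q) \<partial>nu c)"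
proof -
  note m = borel_measurable_zero_outside(2)[OF f orthant_borel]
  obtain B where B: "\<And>x. \<bar>zero_outside (nonneg_orthant - {0}) f x\<bar> \<le> B"
    using test_function_bounded[OF f] by blast
  obtain r where r: "r > 0" "\<And>x. x \<in> nonneg_orthant - {0} \<Longrightarrow> norm x < r \<Longrightarrow> f x = 0"
    using test_function_zero_near[OF f] by (metis dist_0_norm dist_commute singletonI)
  have cone: "y *\<^sub>R p \<in> nonneg_orthant - {0}" if "p \<in> prob_simplex" "y > 0" for p :: "real ^ 'p" and y
    using that by (auto simp: nonneg_orthant_def prob_simplex_def)
  have "integral\<^sup>L (radial_measure Q c) f = (\<integral>z. f (case z of (p, y) \<Rightarrow> y *\<^sub>R p) \<partial>(Q \<Otimes>\<^sub>M nu c))"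
    unfolding radial_measure_def by (rule integral_distr[OF radial_map_measurable m])
  also have "\<dots> = (\<integral>y. (\<integral>p. f (case (p, y) of (p, y) \<Rightarrow> y *\<^sub>R p) \<partial>Q) \<partial>nu c)"
  proof (rule polar_integral[where B = B and r = r])
    show "(\<lambda>z. f (case z of (p, y) \<Rightarrow> y *\<^sub>R p)) \<in> borel_measurable (Q \<Otimes>\<^sub>M nu c)"
      by (rule measurable_compose[OF radial_map_measurable m])
    show "\<bar>f (case (p, y) of (p, y) \<Rightarrow> y *\<^sub>R p)\<bar> \<le> B" if "p \<in> prob_simplex" "y > 0" for p y
      using B[of "y *\<^sub>R p"] cone[OF that] by (simp add: zero_outside_def)
    show "f (case (p, y) of (p, y) \<Rightarrow> y *\<^sub>R p) = 0" if "p \<in> prob_simplex" "0 < y" "y < r" for p y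
    proof -
      have "norm (y *\<^sub>R p) = y * norm p" using that by simp
      also have "\<dots> \<le> y * 1" using norm_prob_simplex_le[OF that(1)] that(2) by (intro mult_left_mono) auto
      finally have "norm (y *\<^sub>R p) < r" using that(3) by simp
      from r(2)[OF cone[OF that(1,2)] this] show ?thesis by simp
    qed
  qed (rule r)
  finally show ?thesis by simp
qed

end

text \<open>Division by zero gives 0, so the quotient of \<open>b t\<close> by itself can tend to 1
  only if \<open>b t\<close> is eventually nonzero.\<close>

lemma RV_eventually_pos:
  assumes "b \<in> RV c"
  shows "\<forall>\<^sub>F t in at_top. b t > 0"
proof -
  have "((\<lambda>t. b (t * 1) / b t) \<longlongrightarrow> 1 powr c) at_top" using assms zero_less_one unfolding RV_def by blast
  then have "\<forall>\<^sub>F t in at_top. b (t * 1) / b t > 1 / 2" by (rule order_tendstoD) simp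
  then show ?thesis using eventually_ge_at_top[of 0]
  proof eventually_elim
    case (elim t)
    then have "b t \<ge> 0" "b t \<noteq> 0" using assms by (auto simp: RV_def)
    then show ?case by simp
  qed
qed

section \<open>Polar coordinates as a change of test function\<close>

lemma sum_nth_le_norm: "(\<Sum>i\<in>UNIV. x $ i) \<le> real CARD('p) * norm (x :: real ^ 'p)"
proof -
  have "(\<Sum>i\<in>UNIV. x $ i) \<le> (\<Sum>i\<in>(UNIV :: 'p set). norm x)"
  proof (rule sum_mono)
    show "x $ i \<le> norm x" for i using component_le_norm_cart[of x i] by simp
  qed
  then show ?thesis by simp
qed

lemma orthant_sum_pos:
  assumes "x \<in> nonneg_orthant - {0}"
  shows "(\<Sum>i\<in>UNIV. x $ i) > 0"
proof -
  from assms obtain i where "x $ i \<noteq> 0" by (auto simp: vec_eq_iff)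
  then show ?thesis using assms by (intro sum_pos2[of _ i]) (auto simp: nonneg_orthant_def less_le)
qed

text \<open>Polar coordinates turn the distance from (p, 0) into the sum of the entries. Where the
  composed function is nonzero this sum is at least r, and the norm is at least the sum divided by
  the dimension.\<close>

lemma polar_test_function_pullback:
  fixes f :: "(real ^ 'p) \<times> real \<Rightarrow> real"
  assumes f: "f \<in> cone_test_functions (prob_simplex \<times> {0..}) (prob_simplex \<times> {0})"
  shows "(\<lambda>x. f ((1 / (\<Sum>i\<in>UNIV. x $ i)) *\<^sub>R x, \<Sum>i\<in>UNIV. x $ i)) \<in> cone_test_functions nonneg_orthant {0}"
proof -
  let ?s = "\<lambda>x :: real ^ 'p. \<Sum>i\<in>UNIV. x $ i"
  let ?T = "\<lambda>x. ((1 / ?s x) *\<^sub>R x, ?s x)"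
  have T: "?T x \<in> prob_simplex \<times> {0<..}" if "x \<in> nonneg_orthant - {0}" for x
    using that orthant_sum_pos[OF that]
    by (auto simp: prob_simplex_def nonneg_orthant_def sum_divide_distrib[symmetric])
  have fc: "continuous_on (prob_simplex \<times> {0<..}) f" and fb: "bounded (f ` (prob_simplex \<times> {0<..}))"
    and fn: "\<And>z. z \<in> prob_simplex \<times> {0<..} \<Longrightarrow> 0 \<le> f z"
    using f unfolding cone_test_functions_def polar_cone_eq by auto
  obtain r where r: "r > 0" "\<And>x y. x \<in> prob_simplex \<times> {0<..} \<Longrightarrow> y \<in> prob_simplex \<times> {0} \<Longrightarrow> dist x y < r \<Longrightarrow> f x = 0"
    using test_function_zero_near[OF f] unfolding polar_cone_eq by metis
  have "continuous_on (nonneg_orthant - {0}) ?T"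
    using orthant_sum_pos by (intro continuous_intros) force
  then have "continuous_on (nonneg_orthant - {0}) (\<lambda>x. f (?T x))"
    using T by (intro continuous_on_compose2[OF fc]) auto
  moreover have "bounded ((\<lambda>x. f (?T x)) ` (nonneg_orthant - {0}))"
    using T by (intro bounded_subset[OF fb]) auto
  moreover have "\<forall>x\<in>nonneg_orthant - {0}. 0 \<le> f (?T x)" using fn T by blast
  moreover have "bounded_away ((nonneg_orthant - {0}) \<inter> closure {x \<in> nonneg_orthant - {0}. f (?T x) \<noteq> 0}) {0}"
  proof -
    have "{x \<in> nonneg_orthant - {0}. f (?T x) \<noteq> 0} \<subseteq> {x. r \<le> ?s x}"
    proof (rule subsetI)
      fix x assume x: "x \<in> {x \<in> nonneg_orthant - {0}. f (?T x) \<noteq> 0}"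
      then have "?T x \<in> prob_simplex \<times> {0<..}" by (intro T) auto
      moreover from this have "dist (?T x) (fst (?T x), 0) = ?s x" by (simp add: dist_prod_def dist_real_def)
      ultimately show "x \<in> {x. r \<le> ?s x}" using r(2)[of "?T x" "(fst (?T x), 0)"] x by (auto simp: not_le[symmetric])
    qed
    moreover have "closed {x :: real ^ 'p. r \<le> ?s x}" by (intro closed_Collect_le continuous_intros)
    ultimately have "closure {x \<in> nonneg_orthant - {0}. f (?T x) \<noteq> 0} \<subseteq> {x. r \<le> ?s x}"
      by (rule closure_minimal)
    moreover have "r / real CARD('p) \<le> dist x 0" if "r \<le> ?s x" for x
      using that sum_nth_le_norm[of x] by (simp add: field_simps)
    ultimately show ?thesis
      unfolding bounded_away_def using r(1) by (intro exI[of _ "r / real CARD('p)"]) auto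
  qed
  ultimately show ?thesis unfolding cone_test_functions_def by blast
qed

text \<open>The polar statement is the Cartesian one for the pulled-back test function: scaling by 1
  / b(t) leaves the proportions unchanged and divides the sum. The limits agree because
  \<open>y *\<^sub>R p\<close> has polar coordinates (p, y).\<close>

lemma (in prob_space) MRV_polarI:
  fixes Z :: "'a \<Rightarrow> real ^ 'p" and Q :: "(real ^ 'p) measure"
  assumes Z: "Z \<in> borel_measurable M" "\<And>\<omega>. \<omega> \<in> space M \<Longrightarrow> Z \<omega> \<in> nonneg_orthant"
    and c: "c > 0" and b: "b \<in> RV (1 / c)"
    and Q: "prob_space Q" "sets Q = sets (restrict_space borel prob_simplex)"
    and conv: "\<And>f. f \<in> cone_test_functions nonneg_orthant {0} \<Longrightarrow>
      ((\<lambda>t. t * expectation (\<lambda>\<omega>. zero_outside (nonneg_orthant - {0}) f ((1 / b t) *\<^sub>R Z \<omega>)))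
         \<longlongrightarrow> (\<integral>y. (\<integral>p. f (y *\<^sub>R p) \<partial>Q) \<partial>nu c)) at_top"
  shows "MRV M Z c b (radial_measure Q c)"
    and "polar_convergence M (\<lambda>t \<omega>. (proportions q (\<Sum>i\<in>UNIV. Z \<omega> $ i) (Z \<omega>), (\<Sum>i\<in>UNIV. Z \<omega> $ i) / b t)) (Q \<Otimes>\<^sub>M nu c)"
proof -
  show "MRV M Z c b (radial_measure Q c)"
    unfolding MRV_def
    using Z c b radial_measure_in_cone_measures[OF Q c] radial_measure_nonzero[OF Q c]
    by (auto intro!: cone_convergenceI orthant_borel simp: radial_integral[OF Q c] conv)
  let ?s = "\<lambda>x :: real ^ 'p. \<Sum>i\<in>UNIV. x $ i"
  let ?Y = "\<lambda>t \<omega>. (proportions q (?s (Z \<omega>)) (Z \<omega>), ?s (Z \<omega>) / b t)"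
  have [measurable]: "(\<lambda>\<omega>. Z \<omega> $ i) \<in> borel_measurable M" for i
    by (rule borel_measurable_vec_nth[OF Z(1)])
  have "(\<lambda>\<omega>. proportions q (?s (Z \<omega>)) (Z \<omega>)) \<in> borel_measurable M"
    unfolding proportions_def by (intro measurable_If borel_measurable_vecI) auto
  then have Ym: "?Y t \<in> borel_measurable M" for t
    by (subst borel_prod[symmetric]) auto
  show "polar_convergence M ?Y (Q \<Otimes>\<^sub>M nu c)"
    unfolding polar_convergence_def polar_cone_eq[symmetric]
  proof (rule cone_convergenceI)
    show "prob_simplex \<times> {0..} - prob_simplex \<times> {0} \<in> sets (borel :: ((real ^ 'p) \<times> real) measure)"
      unfolding polar_cone_eq by (rule polar_cone_borel)
    show "Q \<Otimes>\<^sub>M nu c \<in> cone_measures (prob_simplex \<times> {0..}) (prob_simplex \<times> {0})"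
      by (rule polar_measure_in_cone_measures[OF Q c])
    fix f assume f: "f \<in> cone_test_functions (prob_simplex \<times> {0..}) ((prob_simplex :: (real ^ 'p) set) \<times> {0::real})"
    let ?g = "\<lambda>x. f ((1 / ?s x) *\<^sub>R x, ?s x)"
    have eq: "zero_outside (prob_simplex \<times> {0<..}) f (?Y t \<omega>) = zero_outside (nonneg_orthant - {0}) ?g ((1 / b t) *\<^sub>R Z \<omega>)"
      if "b t > 0" "\<omega> \<in> space M" for t \<omega>
    proof (cases "Z \<omega> = 0")
      \<comment> \<open>The radial part is 0 here and both extensions vanish, whatever the
        conventional value \<open>q\<close>.\<close>
      case True
      then show ?thesis by (simp add: zero_outside_def)
    next
      case False
      then have Zc: "Z \<omega> \<in> nonneg_orthant - {0}" using Z(2)[OF that(2)] by simp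
      note pos = orthant_sum_pos[OF Zc]
      have "proportions q (?s (Z \<omega>)) (Z \<omega>) = (1 / ?s (Z \<omega>)) *\<^sub>R Z \<omega>"
        using pos by (auto simp: proportions_def vec_eq_iff)
      moreover from this have "?Y t \<omega> \<in> prob_simplex \<times> {0<..}"
        using pos Zc that(1) by (auto simp: prob_simplex_def nonneg_orthant_def sum_divide_distrib[symmetric])
      moreover have "?s ((1 / b t) *\<^sub>R Z \<omega>) = ?s (Z \<omega>) / b t" by (simp add: sum_divide_distrib)
      moreover have "(1 / b t) *\<^sub>R Z \<omega> \<in> nonneg_orthant - {0}"
        using Zc that(1) by (auto simp: nonneg_orthant_def)
      ultimately show ?thesis using that(1) pos by (simp add: zero_outside_def)
    qed
    have "((\<lambda>t. t * expectation (\<lambda>\<omega>. zero_outside (nonneg_orthant - {0}) ?g ((1 / b t) *\<^sub>R Z \<omega>)))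
         \<longlongrightarrow> (\<integral>y. (\<integral>p. ?g (y *\<^sub>R p) \<partial>Q) \<partial>nu c)) at_top"
      by (rule conv[OF polar_test_function_pullback[OF f]])
    moreover have "\<forall>\<^sub>F t in at_top. t * expectation (\<lambda>\<omega>. zero_outside (nonneg_orthant - {0}) ?g ((1 / b t) *\<^sub>R Z \<omega>))
       = t * expectation (\<lambda>\<omega>. zero_outside (prob_simplex \<times> {0<..}) f (?Y t \<omega>))"
      using RV_eventually_pos[OF b]
      by eventually_elim (auto simp: eq intro!: Bochner_Integration.integral_cong)
    moreover have "(\<integral>y. (\<integral>p. ?g (y *\<^sub>R p) \<partial>Q) \<partial>nu c) = (\<integral>y. (\<integral>p. f (p, y) \<partial>Q) \<partial>nu c)"
    proof (intro Bochner_Integration.integral_cong refl)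
      fix y p assume "y \<in> space (nu c)" "p \<in> space Q"
      then have "y > 0" "?s p = 1" by (auto simp: nu_space[OF c] simplex_space[OF Q c] prob_simplex_def)
      then have "?s (y *\<^sub>R p) = y" by (simp add: sum_distrib_left[symmetric])
      then show "?g (y *\<^sub>R p) = f (p, y)" using \<open>y > 0\<close> by simp
    qed
    moreover have "(\<integral>y. (\<integral>p. f (p, y) \<partial>Q) \<partial>nu c) = integral\<^sup>L (Q \<Otimes>\<^sub>M nu c) f"
    proof -
      obtain B where B: "\<And>x. \<bar>zero_outside (prob_simplex \<times> {0<..}) f x\<bar> \<le> B"
        using test_function_bounded[OF f] unfolding polar_cone_eq by blast
      obtain r where r: "r > 0" "\<And>x y. x \<in> prob_simplex \<times> {0<..} \<Longrightarrow> y \<in> prob_simplex \<times> {0} \<Longrightarrow> dist x y < r \<Longrightarrow> f x = 0"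
        using test_function_zero_near[OF f] unfolding polar_cone_eq by metis
      have "f \<in> borel_measurable (restrict_space borel (prob_simplex \<times> {0<..}))"
        using borel_measurable_zero_outside(2)[OF f] polar_cone_borel unfolding polar_cone_eq by blast
      then have "f \<in> borel_measurable (Q \<Otimes>\<^sub>M nu c)"
        using measurable_cong_sets[OF polar_sets[OF Q c] refl] by blast
      then show ?thesis
      proof (rule polar_integral[OF Q c, symmetric])
        show "\<bar>f (p, y)\<bar> \<le> B" if "p \<in> prob_simplex" "y > 0" for p y
          using B[of "(p, y)"] that by (simp add: zero_outside_def)
        show "f (p, y) = 0" if "p \<in> prob_simplex" "0 < y" "y < r" for p y
          using r(2)[of "(p, y)" "(p, 0)"] that by (simp add: dist_prod_def dist_real_def)
      qed (rule r)
    qed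
    ultimately show "((\<lambda>t. t * expectation (\<lambda>\<omega>. zero_outside (prob_simplex \<times> {0..} - prob_simplex \<times> {0}) f (?Y t \<omega>)))
         \<longlongrightarrow> integral\<^sup>L (Q \<Otimes>\<^sub>M nu c) f) at_top"
      unfolding polar_cone_eq using Lim_transform_eventually by fastforce
  qed (rule Ym)
qed


section \<open>Deviations of the token counts\<close>

text \<open>This bounds the variance of a sum of independent centred variables
  \<open>h i (s i)\<close>, coordinate l of s having weights \<open>q l\<close>, written as finite
  sums. Off-diagonal terms factor and contain a vanishing mean; coordinates outside \<open>A\<close>
  contribute factors 1.\<close>

lemma sum_PiE_square_le_card:
  fixes q :: "'l \<Rightarrow> 'v::finite \<Rightarrow> real" and h :: "'l \<Rightarrow> 'v \<Rightarrow> real"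
  assumes J: "finite J" and A: "A \<subseteq> J"
    and q: "\<And>l. l \<in> J \<Longrightarrow> (\<Sum>v\<in>UNIV. q l v) = 1"
    and h: "\<And>l. l \<in> A \<Longrightarrow> (\<Sum>v\<in>UNIV. q l v * h l v) = 0"
    and h2: "\<And>l. l \<in> A \<Longrightarrow> (\<Sum>v\<in>UNIV. q l v * (h l v)\<^sup>2) \<le> 1"
  shows "(\<Sum>s\<in>PiE J (\<lambda>_. UNIV). (\<Prod>l\<in>J. q l (s l)) * (\<Sum>i\<in>A. h i (s i))\<^sup>2) \<le> real (card A)"
proof -
  have fA: "finite A" using J A finite_subset by blast
  have E: "(\<Sum>s\<in>PiE J (\<lambda>_. UNIV). (\<Prod>l\<in>J. q l (s l)) * (h i (s i) * h j (s j)))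
      = (if i = j then (\<Sum>v\<in>UNIV. q i v * (h i v)\<^sup>2) else 0)" if ij: "i \<in> A" "j \<in> A" for i j
  proof -
    \<comment> \<open>\<open>?u\<close> spreads the product of the two factors over all coordinates,
      with 1 elsewhere, so that a sum of products over \<open>PiE\<close> becomes a product of
      sums.\<close>
    let ?u = "\<lambda>l v. (if l = i then h l v else 1) * (if l = j then h l v else 1)"
    have "(\<Prod>l\<in>J. ?u l (s l)) = h i (s i) * h j (s j)" for s
      using J A ij by (auto simp: prod.distrib)
    then have "(\<Sum>s\<in>PiE J (\<lambda>_. UNIV). (\<Prod>l\<in>J. q l (s l)) * (h i (s i) * h j (s j)))
        = (\<Sum>s\<in>PiE J (\<lambda>_. UNIV). \<Prod>l\<in>J. q l (s l) * ?u l (s l))"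
      by (simp add: prod.distrib)
    also have "\<dots> = (\<Prod>l\<in>J. \<Sum>v\<in>UNIV. q l v * ?u l v)"
      using J by (intro prod_sum_PiE[symmetric]) auto
    also have "\<dots> = (if i = j then (\<Sum>v\<in>UNIV. q i v * (h i v)\<^sup>2) else 0)"
    proof (cases "i = j")
      case True
      have "(\<Prod>l\<in>J. \<Sum>v\<in>UNIV. q l v * ?u l v) = (\<Prod>l\<in>J. if l = i then (\<Sum>v\<in>UNIV. q l v * (h l v)\<^sup>2) else 1)"
        using True q by (intro prod.cong) (auto simp: power2_eq_square)
      then show ?thesis using True ij A J by auto
    next
      case False
      then have "(\<Sum>v\<in>UNIV. q i v * ?u i v) = 0" using h ij by simp
      then have "(\<Prod>l\<in>J. \<Sum>v\<in>UNIV. q l v * ?u l v) = 0"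
        using ij A by (intro prod_zero J bexI[of _ i]) (assumption, blast)
      then show ?thesis using False by simp
    qed
    finally show ?thesis .
  qed
  have "(\<Sum>s\<in>PiE J (\<lambda>_. UNIV). (\<Prod>l\<in>J. q l (s l)) * (\<Sum>i\<in>A. h i (s i))\<^sup>2)
      = (\<Sum>s\<in>PiE J (\<lambda>_. UNIV). \<Sum>i\<in>A. \<Sum>j\<in>A. (\<Prod>l\<in>J. q l (s l)) * (h i (s i) * h j (s j)))"
    by (simp only: power2_eq_square sum_product) (simp only: sum_distrib_left)
  also have "\<dots> = (\<Sum>i\<in>A. \<Sum>j\<in>A. \<Sum>s\<in>PiE J (\<lambda>_. UNIV). (\<Prod>l\<in>J. q l (s l)) * (h i (s i) * h j (s j)))"
    by (subst sum.swap) (intro sum.cong refl, rule sum.swap)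
  also have "\<dots> = (\<Sum>i\<in>A. \<Sum>v\<in>UNIV. q i v * (h i v)\<^sup>2)"
    using fA by (simp add: E)
  also have "\<dots> \<le> (\<Sum>i\<in>A. 1)" by (intro sum_mono h2)
  finally show ?thesis by simp
qed

lemma prob_simplex_le_1:
  assumes "p \<in> prob_simplex"
  shows "0 \<le> p $ i" "p $ i \<le> 1"
proof -
  show "0 \<le> p $ i" using assms by (auto simp: prob_simplex_def)
  have "p $ i \<le> (\<Sum>i\<in>UNIV. p $ i)" using assms by (intro member_le_sum) (auto simp: prob_simplex_def)
  then show "p $ i \<le> 1" using assms by (simp add: prob_simplex_def)
qed

section \<open>Second moments of token counts given lengths and proportions\<close>

context lda begin

lemmas [measurable] = N_measurable theta_measurable X_measurable Z_measurable

lemma theta_nth_measurable[measurable]: "(\<lambda>\<omega>. \<theta> d \<omega> $ k) \<in> borel_measurable M"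
  by (intro borel_measurable_vec_nth theta_measurable)

lemma token_count_measurable[measurable]: "token_count N X Z d k w \<in> measurable M (count_space UNIV)"
proof -
  have "token_count N X Z d k w = (\<lambda>\<omega>. \<Sum>i\<in>{1..N d \<omega>}. if X d i \<omega> = w \<and> Z d i \<omega> = k then 1 else 0)"
    by (simp add: token_count_def fun_eq_iff sum.If_cases Int_def)
  also have "\<dots> \<in> measurable M (count_space UNIV)"
  \<comment> \<open>The number of summands is random but has countably many values; for each of them
    the sum has fixed length.\<close>
  proof (rule measurable_compose_countable[OF _ N_measurable])
    fix n
    show "(\<lambda>\<omega>. \<Sum>i\<in>{1..n}. if X d i \<omega> = w \<and> Z d i \<omega> = k then 1 else 0 :: nat) \<in> measurable M (count_space UNIV)"
      by (induction n) (auto simp: atLeastAtMostSuc_conv)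
  qed
  finally show ?thesis .
qed

lemma token_count_le: "token_count N X Z d k w \<omega> \<le> N d \<omega>"
proof -
  have "token_count N X Z d k w \<omega> \<le> card {1..N d \<omega>}"
    unfolding token_count_def by (intro card_mono) auto
  then show ?thesis by simp
qed

lemma conditioning_subalgebra: "subalgebra M (lda_conditioning M N \<theta>)"
proof -
  have "(\<lambda>\<omega> d. (N d \<omega>, \<theta> d \<omega>)) \<in> measurable M (PiM UNIV (\<lambda>_. count_space UNIV \<Otimes>\<^sub>M borel))"
    by (rule measurable_PiM_single') (auto simp: space_pair_measure)
  then have "(\<lambda>\<omega>. \<omega>) \<in> measurable M (lda_conditioning M N \<theta>)"
    unfolding lda_conditioning_def by (intro measurable_vimage_algebra2) auto
  moreover have sp: "space (lda_conditioning M N \<theta>) = space M" by (simp add: lda_conditioning_def)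
  ultimately have "sets (lda_conditioning M N \<theta>) \<subseteq> sets M"
    by (intro sets_subset_if_ident_measurable) simp_all
  then show ?thesis unfolding subalgebra_def sp by blast
qed

sublocale cond: finite_measure_subalgebra M "lda_conditioning M N \<theta>"
  by unfold_locales (rule conditioning_subalgebra)

lemma conditioning_measurable:
  "N d \<in> measurable (lda_conditioning M N \<theta>) (count_space UNIV)"
  "\<theta> d \<in> borel_measurable (lda_conditioning M N \<theta>)"
proof -
  have "(\<lambda>\<omega> d. (N d \<omega>, \<theta> d \<omega>)) \<in> measurable (lda_conditioning M N \<theta>) (PiM UNIV (\<lambda>_. count_space UNIV \<Otimes>\<^sub>M borel))"
    unfolding lda_conditioning_def by (intro measurable_vimage_algebra1) (auto simp: space_PiM space_pair_measure)
  then have *: "(\<lambda>\<omega>. (N d \<omega>, \<theta> d \<omega>)) \<in> measurable (lda_conditioning M N \<theta>) (count_space UNIV \<Otimes>\<^sub>M borel)"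
    using measurable_compose[OF _ measurable_component_singleton[OF UNIV_I, of d]] by fastforce
  show "N d \<in> measurable (lda_conditioning M N \<theta>) (count_space UNIV)"
    "\<theta> d \<in> borel_measurable (lda_conditioning M N \<theta>)"
    using measurable_compose[OF * measurable_fst] measurable_compose[OF * measurable_snd] by simp_all
qed

definition positions :: "('d \<Rightarrow> nat) \<Rightarrow> ('d \<times> nat) set" where
  "positions n = Sigma UNIV (\<lambda>d. {1..n d})"

text \<open>The event of assumption \<open>tokens\<close>, with word and topic coded as one pair per
  position. Restricted to \<open>positions n\<close>, the codes form a finite \<open>PiE\<close>,
  which makes conditional moments finite sums.\<close>

definition assigned :: "('d \<Rightarrow> nat) \<Rightarrow> ('d \<times> nat \<Rightarrow> 'w \<times> 'k) \<Rightarrow> 'a set" where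
  "assigned n s = {\<omega>\<in>space M. \<forall>d. N d \<omega> = n d \<and> (\<forall>i\<in>{1..n d}. X d i \<omega> = fst (s (d, i)) \<and> Z d i \<omega> = snd (s (d, i)))}"

definition lengths :: "('d \<Rightarrow> nat) \<Rightarrow> 'a set" where
  "lengths n = {\<omega>\<in>space M. \<forall>d. N d \<omega> = n d}"

lemma assigned_measurable[measurable]: "assigned n s \<in> sets M"
  unfolding assigned_def by measurable

lemma lengths_measurable[measurable]: "lengths n \<in> sets M"
  unfolding lengths_def by measurable

lemma finite_positions[simp]: "finite (positions n)"
  by (simp add: positions_def)

text \<open>A bounded weight that depends on lengths and proportions only passes through the
  conditional expectation, and \<open>tokens\<close> then replaces the indicator by its conditional
  probability.\<close>

lemma expectation_assigned:
  assumes G: "G \<in> borel_measurable (lda_conditioning M N \<theta>)" and B: "\<And>\<omega>. \<omega> \<in> space M \<Longrightarrow> \<bar>G \<omega>\<bar> \<le> B"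
  shows "expectation (\<lambda>\<omega>. G \<omega> * indicator (assigned n s) \<omega>)
       = expectation (\<lambda>\<omega>. G \<omega> * (indicator (lengths n) \<omega> * (\<Prod>(d, i)\<in>positions n. \<theta> d \<omega> $ snd (s (d, i)) * \<phi> (snd (s (d, i))) $ fst (s (d, i)))))"
proof -
  have [measurable]: "G \<in> borel_measurable M"
    by (rule measurable_from_subalg[OF conditioning_subalgebra G])
  have "integrable M (\<lambda>\<omega>. G \<omega> * indicator (assigned n s) \<omega>)"
    using B by (intro integrable_const_bound[where B = B] AE_I2) (auto simp: indicator_def intro: order_trans[OF abs_ge_zero])
  then have "expectation (\<lambda>\<omega>. G \<omega> * indicator (assigned n s) \<omega>)
      = expectation (\<lambda>\<omega>. G \<omega> * real_cond_exp M (lda_conditioning M N \<theta>) (indicator (assigned n s)) \<omega>)"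
    by (intro cond.real_cond_exp_intg(2)[symmetric] G) auto
  also have "\<dots> = expectation (\<lambda>\<omega>. G \<omega> * (indicator (lengths n) \<omega> * (\<Prod>(d, i)\<in>positions n. \<theta> d \<omega> $ snd (s (d, i)) * \<phi> (snd (s (d, i))) $ fst (s (d, i)))))"
  proof (rule integral_cong_AE)
    show "AE \<omega> in M. G \<omega> * real_cond_exp M (lda_conditioning M N \<theta>) (indicator (assigned n s)) \<omega>
       = G \<omega> * (indicator (lengths n) \<omega> * (\<Prod>(d, i)\<in>positions n. \<theta> d \<omega> $ snd (s (d, i)) * \<phi> (snd (s (d, i))) $ fst (s (d, i))))"
      using tokens[of n "\<lambda>d i. fst (s (d, i))" "\<lambda>d i. snd (s (d, i))"] AE_space
    proof eventually_elim
      case (elim \<omega>)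
      have "(\<Prod>d\<in>UNIV. \<Prod>i\<in>{1..n d}. \<theta> d \<omega> $ snd (s (d, i)) * \<phi> (snd (s (d, i))) $ fst (s (d, i)))
          = (\<Prod>(d, i)\<in>positions n. \<theta> d \<omega> $ snd (s (d, i)) * \<phi> (snd (s (d, i))) $ fst (s (d, i)))"
        unfolding positions_def by (rule prod.Sigma) auto
      then show ?case using elim by (simp add: assigned_def lengths_def indicator_def)
    qed
  qed (auto simp: case_prod_beta)
  finally show ?thesis .
qed

text \<open>Given the lengths and proportions, the count is a sum of \<open>n d\<close> independent
  indicators of probability \<open>\<theta> d \<omega> $ k * \<phi> k $ w\<close>, so its
  conditional variance is at most \<open>n d\<close>. As \<open>tokens\<close> fixes all documents
  together, the sum below ranges over assignments of all positions, although only those of d enter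
  the square.\<close>

lemma token_count_second_moment:
  "expectation (\<lambda>\<omega>. indicator (lengths n) \<omega> * (real (token_count N X Z d k w \<omega>) - real (n d) * (\<theta> d \<omega> $ k * \<phi> k $ w))\<^sup>2)
     \<le> real (n d) * prob (lengths n)"
proof -
  let ?p = "\<lambda>\<omega>. \<theta> d \<omega> $ k * \<phi> k $ w"
  let ?A = "Pair d ` {1..n d}"
  let ?S = "PiE (positions n) (\<lambda>_. UNIV :: ('w \<times> 'k) set)"
  \<comment> \<open>The indicator of the cell (w, k), centred at its conditional mean, which is
    random through \<theta>.\<close>
  let ?h = "\<lambda>\<omega> v. (if v = (w, k) then 1 else 0) - ?p \<omega>"
  let ?g = "\<lambda>\<omega> s. (\<Sum>i\<in>?A. ?h \<omega> (s i))\<^sup>2"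
  define q where "q = (\<lambda>\<omega> (l :: 'd \<times> nat) v. \<theta> (fst l) \<omega> $ snd v * \<phi> (snd v) $ fst v)"
  have fS: "finite ?S" by (intro finite_PiE) auto
  have p01: "0 \<le> ?p \<omega>" "?p \<omega> \<le> 1" if "\<omega> \<in> space M" for \<omega>
    using prob_simplex_le_1[OF theta_simplex[OF that]] prob_simplex_le_1[OF topics] by (auto intro: mult_le_one)
  have h1: "\<bar>?h \<omega> v\<bar> \<le> 1" if "\<omega> \<in> space M" for \<omega> v using p01[OF that] by auto
  \<comment> \<open>On \<open>lengths n\<close> the outcome realizes exactly one assignment,
    \<open>s0\<close> below. The squared deviation is thus a sum of weights depending on the
    proportions times indicators, the form that \<open>expectation_assigned\<close> treats.\<close>
  have split: "indicator (lengths n) \<omega> * (real (token_count N X Z d k w \<omega>) - real (n d) * ?p \<omega>)\<^sup>2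
      = (\<Sum>s\<in>?S. ?g \<omega> s * indicator (assigned n s) \<omega>)" if \<omega>: "\<omega> \<in> space M" for \<omega>
  proof (cases "\<omega> \<in> lengths n")
    case False
    then have "\<omega> \<notin> assigned n s" for s by (auto simp: lengths_def assigned_def)
    then show ?thesis using False by simp
  next
    case True
    define s0 where "s0 = restrict (\<lambda>l. (X (fst l) (snd l) \<omega>, Z (fst l) (snd l) \<omega>)) (positions n)"
    have "indicator (assigned n s) \<omega> = (if s = s0 then 1 else 0 :: real)" if s: "s \<in> ?S" for s
    proof -
      have "\<omega> \<in> assigned n s \<longleftrightarrow> (\<forall>l\<in>positions n. s l = (X (fst l) (snd l) \<omega>, Z (fst l) (snd l) \<omega>))"
        using True by (auto simp: assigned_def lengths_def positions_def prod_eq_iff)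
      also have "\<dots> \<longleftrightarrow> s = s0"
        using s by (auto simp: s0_def fun_eq_iff PiE_iff extensional_def)
      finally show ?thesis by (simp add: indicator_def)
    qed
    then have "(\<Sum>s\<in>?S. ?g \<omega> s * indicator (assigned n s) \<omega>) = (\<Sum>s\<in>?S. if s = s0 then ?g \<omega> s else 0)"
      by (intro sum.cong) auto
    also have "\<dots> = ?g \<omega> s0" using fS by (simp add: s0_def)
    also have "(\<Sum>i\<in>?A. ?h \<omega> (s0 i)) = (\<Sum>i\<in>{1..n d}. ?h \<omega> (X d i \<omega>, Z d i \<omega>))"
      by (subst sum.reindex) (auto simp: inj_on_def s0_def positions_def intro!: sum.cong)
    also have "\<dots> = real (token_count N X Z d k w \<omega>) - real (n d) * ?p \<omega>"
      using True by (simp add: sum_subtractf token_count_def lengths_def sum.If_cases Int_def)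
    finally show ?thesis using True by simp
  qed
  have nd: "N d \<omega> = n d" if "\<omega> \<in> lengths n" for \<omega> using that by (auto simp: lengths_def)
  note [measurable] = conditioning_measurable
  have gm: "(\<lambda>\<omega>. ?g \<omega> s) \<in> borel_measurable (lda_conditioning M N \<theta>)" for s
  proof -
    have "(\<lambda>\<omega>. \<theta> d \<omega> $ k) \<in> borel_measurable (lda_conditioning M N \<theta>)"
      by (intro borel_measurable_vec_nth conditioning_measurable)
    then show ?thesis by simp
  qed
  have gb: "\<bar>?g \<omega> s\<bar> \<le> (real (card ?A))\<^sup>2" if "\<omega> \<in> space M" for \<omega> s
  proof -
    have "\<bar>\<Sum>i\<in>?A. ?h \<omega> (s i)\<bar> \<le> (\<Sum>i\<in>?A. 1)"
      by (rule order_trans[OF sum_abs sum_mono]) (use h1[OF that] in auto)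
    then have "\<bar>\<Sum>i\<in>?A. ?h \<omega> (s i)\<bar> \<le> real (card ?A)" by simp
    then show ?thesis by (simp only: abs_power2 flip: power2_abs[of "\<Sum>i\<in>?A. ?h \<omega> (s i)"]) (intro power_mono, auto)
  qed
  have [measurable]: "(\<lambda>\<omega>. ?g \<omega> s) \<in> borel_measurable M" for s
    by (rule measurable_from_subalg[OF conditioning_subalgebra gm])
  let ?P = "\<lambda>\<omega> s. \<Prod>(d, i)\<in>positions n. \<theta> d \<omega> $ snd (s (d, i)) * \<phi> (snd (s (d, i))) $ fst (s (d, i))"
  have P: "?P \<omega> s = (\<Prod>l\<in>positions n. q \<omega> l (s l))" for \<omega> s
    by (auto simp: q_def case_prod_beta)
  have P01: "0 \<le> ?P \<omega> s" "?P \<omega> s \<le> 1" if "\<omega> \<in> space M" for \<omega> s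
    using prob_simplex_le_1[OF theta_simplex[OF that]] prob_simplex_le_1[OF topics]
    by (auto simp: case_prod_beta intro!: prod_nonneg prod_le_1 mult_le_one)
  have int1: "integrable M (\<lambda>\<omega>. ?g \<omega> s * indicator (assigned n s) \<omega>)" for s
    using gb by (intro integrable_const_bound[where B = "(real (card ?A))\<^sup>2"] AE_I2) (auto simp: indicator_def)
  have int2: "integrable M (\<lambda>\<omega>. ?g \<omega> s * (indicator (lengths n) \<omega> * ?P \<omega> s))" for s
  proof (intro integrable_const_bound[where B = "(real (card ?A))\<^sup>2"] AE_I2)
    fix \<omega> assume "\<omega> \<in> space M"
    then show "norm (?g \<omega> s * (indicator (lengths n) \<omega> * ?P \<omega> s)) \<le> (real (card ?A))\<^sup>2"
      using gb[of \<omega> s] P01[of \<omega> s] mult_mono[of "\<bar>?g \<omega> s\<bar>" "(real (card ?A))\<^sup>2" "?P \<omega> s" 1]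
      by (auto simp: abs_mult indicator_def)
  qed (auto simp: case_prod_beta)
  have "expectation (\<lambda>\<omega>. indicator (lengths n) \<omega> * (real (token_count N X Z d k w \<omega>) - real (n d) * ?p \<omega>)\<^sup>2)
      = expectation (\<lambda>\<omega>. \<Sum>s\<in>?S. ?g \<omega> s * indicator (assigned n s) \<omega>)"
    by (intro Bochner_Integration.integral_cong refl split)
  also have "\<dots> = (\<Sum>s\<in>?S. expectation (\<lambda>\<omega>. ?g \<omega> s * (indicator (lengths n) \<omega> * ?P \<omega> s)))"
    using int1 expectation_assigned[OF gm gb] by (subst Bochner_Integration.integral_sum) auto
  also have "\<dots> = expectation (\<lambda>\<omega>. \<Sum>s\<in>?S. ?g \<omega> s * (indicator (lengths n) \<omega> * ?P \<omega> s))"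
    using int2 by (subst Bochner_Integration.integral_sum) auto
  also have "\<dots> \<le> expectation (\<lambda>\<omega>. real (n d) * indicator (lengths n) \<omega>)"
  proof (rule integral_mono)
    \<comment> \<open>For fixed \<omega> the integrand is bounded by the finite variance estimate
      with weights \<open>q \<omega>\<close>.\<close>
    fix \<omega> assume \<omega>: "\<omega> \<in> space M"
    have th: "(\<Sum>k\<in>UNIV. \<theta> d' \<omega> $ k) = 1" for d' using theta_simplex[OF \<omega>, of d'] by (auto simp: prob_simplex_def)
    have ph: "(\<Sum>w\<in>UNIV. \<phi> k $ w) = 1" for k using topics[of k] by (auto simp: prob_simplex_def)
    have q1: "(\<Sum>v\<in>UNIV. q \<omega> l v) = 1" for l
    proof -
      have "(\<Sum>v\<in>UNIV. q \<omega> l v) = (\<Sum>w\<in>UNIV. \<Sum>k\<in>UNIV. \<theta> (fst l) \<omega> $ k * \<phi> k $ w)"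
        unfolding UNIV_Times_UNIV[symmetric] q_def by (subst sum.cartesian_product) (simp add: case_prod_beta)
      also have "\<dots> = (\<Sum>k\<in>UNIV. \<theta> (fst l) \<omega> $ k * (\<Sum>w\<in>UNIV. \<phi> k $ w))"
        by (subst sum.swap) (simp add: sum_distrib_left)
      finally show ?thesis by (simp add: ph th)
    qed
    have q0: "q \<omega> l v \<ge> 0" for l v
      unfolding q_def using prob_simplex_le_1[OF theta_simplex[OF \<omega>]] prob_simplex_le_1[OF topics] by simp
    have qh: "(\<Sum>v\<in>UNIV. q \<omega> l v * ?h \<omega> v) = 0" if "l \<in> ?A" for l
    proof -
      have "(\<Sum>v\<in>UNIV. q \<omega> l v * ?h \<omega> v) = (\<Sum>v\<in>UNIV. q \<omega> l v * (if v = (w, k) then 1 else 0)) - (\<Sum>v\<in>UNIV. q \<omega> l v) * ?p \<omega>"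
        by (simp add: right_diff_distrib sum_subtractf sum_distrib_right)
      also have "\<dots> = q \<omega> l (w, k) - ?p \<omega>" by (simp add: q1 if_distrib cong: if_cong)
      finally show ?thesis using that by (auto simp: q_def)
    qed
    have "(\<Sum>s\<in>?S. ?P \<omega> s * ?g \<omega> s) \<le> real (card ?A)"
      unfolding P
    proof (rule sum_PiE_square_le_card)
      fix l assume "l \<in> ?A"
      have "(\<Sum>v\<in>UNIV. q \<omega> l v * (?h \<omega> v)\<^sup>2) \<le> (\<Sum>v\<in>UNIV. q \<omega> l v * 1)"
        using h1[OF \<omega>] by (intro sum_mono mult_left_mono q0) (simp add: abs_square_le_1)
      then show "(\<Sum>v\<in>UNIV. q \<omega> l v * (?h \<omega> v)\<^sup>2) \<le> 1" by (simp add: q1)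
    qed (use q1 qh in \<open>auto simp: positions_def\<close>)
    moreover have "card ?A = n d" by (simp add: card_image inj_on_def)
    ultimately show "(\<Sum>s\<in>?S. ?g \<omega> s * (indicator (lengths n) \<omega> * ?P \<omega> s)) \<le> real (n d) * indicator (lengths n) \<omega>"
      by (auto simp: indicator_def mult.commute)
  next
    show "integrable M (\<lambda>\<omega>. real (n d) * indicator (lengths n) \<omega>)"
      by (intro integrable_mult_right integrable_real_indicator; simp add: less_top[symmetric])
  qed (intro Bochner_Integration.integrable_sum int2)
  also have "\<dots> = real (n d) * prob (lengths n)" by simp
  finally show ?thesis .
qed

text \<open>Chebyshev relative to the length: for each length vector with \<open>n d\<close> above
  m, the second moment gives at most 1 / (\<epsilon>^2 m) times the probability of these lengths.
  Summing over all vectors leaves the tail of the length as the only quantity in the bound.\<close>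

lemma token_count_deviation:
  assumes \<epsilon>: "\<epsilon> > 0" and m: "m > 0"
  shows "prob {\<omega>\<in>space M. real (N d \<omega>) > m \<and> \<bar>real (token_count N X Z d k w \<omega>) - real (N d \<omega>) * (\<theta> d \<omega> $ k * \<phi> k $ w)\<bar> > \<epsilon> * real (N d \<omega>)}
     \<le> prob {\<omega>\<in>space M. real (N d \<omega>) > m} / (\<epsilon>\<^sup>2 * m)"
proof -
  let ?R = "\<lambda>\<omega>. \<bar>real (token_count N X Z d k w \<omega>) - real (N d \<omega>) * (\<theta> d \<omega> $ k * \<phi> k $ w)\<bar>"
  define E where "E = {\<omega>\<in>space M. real (N d \<omega>) > m \<and> ?R \<omega> > \<epsilon> * real (N d \<omega>)}"
  define F where "F = {\<omega>\<in>space M. real (N d \<omega>) > m}"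
  have [measurable]: "E \<in> sets M" "F \<in> sets M" unfolding E_def F_def by measurable
  \<comment> \<open>With finitely many documents there are countably many length vectors, and their
    events partition the space.\<close>
  have decomp: "emeasure M G = (\<integral>\<^sup>+n. emeasure M (G \<inter> lengths n) \<partial>count_space UNIV)" if [measurable]: "G \<in> sets M" for G
  proof -
    have "G = (\<Union>n. G \<inter> lengths n)"
      using sets.sets_into_space[OF that] by (auto simp: lengths_def)
    then have "emeasure M G = emeasure M (\<Union>n. G \<inter> lengths n)" by simp
    also have "\<dots> = (\<integral>\<^sup>+n. emeasure M (G \<inter> lengths n) \<partial>count_space UNIV)"
      by (rule emeasure_UN_countable) (auto simp: disjoint_family_on_def lengths_def fun_eq_iff)
    finally show ?thesis .
  qed
  have one: "prob (E \<inter> lengths n) \<le> prob (F \<inter> lengths n) / (\<epsilon>\<^sup>2 * m)" for n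
  proof (cases "real (n d) > m")
    case False
    then have "E \<inter> lengths n = {}" by (auto simp: E_def lengths_def)
    then show ?thesis using m by simp
  next
    case True
    then have FL: "F \<inter> lengths n = lengths n" by (auto simp: F_def lengths_def)
    have n0: "real (n d) > 0" using True m by linarith
    let ?Q = "\<lambda>\<omega>. real (token_count N X Z d k w \<omega>) - real (n d) * (\<theta> d \<omega> $ k * \<phi> k $ w)"
    have pb: "\<bar>\<theta> d \<omega> $ k * \<phi> k $ w\<bar> \<le> 1" if "\<omega> \<in> space M" for \<omega>
      using prob_simplex_le_1[OF theta_simplex[OF that]] prob_simplex_le_1[OF topics] by (auto simp: abs_mult intro: mult_le_one)
    have int: "integrable M (\<lambda>\<omega>. indicator (lengths n) \<omega> * (?Q \<omega>)\<^sup>2)"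
    proof (rule integrable_const_bound[where B = "(2 * real (n d))\<^sup>2"])
      show "AE \<omega> in M. norm (indicator (lengths n) \<omega> * (?Q \<omega>)\<^sup>2) \<le> (2 * real (n d))\<^sup>2"
      proof (rule AE_I2)
        fix \<omega> assume \<omega>: "\<omega> \<in> space M"
        show "norm (indicator (lengths n) \<omega> * (?Q \<omega>)\<^sup>2) \<le> (2 * real (n d))\<^sup>2"
        proof (cases "\<omega> \<in> lengths n")
          case True
          then have "real (token_count N X Z d k w \<omega>) \<le> real (n d)"
            using token_count_le[of d k w \<omega>] by (auto simp: lengths_def)
          moreover have "\<bar>real (n d) * (\<theta> d \<omega> $ k * \<phi> k $ w)\<bar> \<le> real (n d) * 1"
            unfolding abs_mult[of "real (n d)"] using pb[OF \<omega>] by (intro mult_mono) auto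
          ultimately have "\<bar>?Q \<omega>\<bar> \<le> 2 * real (n d)" by linarith
          then have "\<bar>?Q \<omega>\<bar>\<^sup>2 \<le> (2 * real (n d))\<^sup>2" by (rule power_mono) simp
          then show ?thesis using True by simp
        qed simp
      qed
    qed measurable
    have "(\<epsilon> * real (n d))\<^sup>2 * prob (E \<inter> lengths n) = expectation (\<lambda>\<omega>. (\<epsilon> * real (n d))\<^sup>2 * indicator (E \<inter> lengths n) \<omega>)"
      by simp
    also have "\<dots> \<le> expectation (\<lambda>\<omega>. indicator (lengths n) \<omega> * (?Q \<omega>)\<^sup>2)"
    proof (rule integral_mono[OF _ int])
      fix \<omega> assume \<omega>: "\<omega> \<in> space M"
      show "(\<epsilon> * real (n d))\<^sup>2 * indicator (E \<inter> lengths n) \<omega> \<le> indicator (lengths n) \<omega> * (?Q \<omega>)\<^sup>2"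
      proof (cases "\<omega> \<in> E \<inter> lengths n")
        case True
        then have "\<epsilon> * real (n d) \<le> \<bar>?Q \<omega>\<bar>" by (auto simp: E_def lengths_def)
        then have "(\<epsilon> * real (n d))\<^sup>2 \<le> \<bar>?Q \<omega>\<bar>\<^sup>2" using \<epsilon> by (intro power_mono) auto
        then show ?thesis using True by simp
      qed simp
    qed (intro integrable_mult_right integrable_real_indicator; simp add: less_top[symmetric])
    also have "\<dots> \<le> real (n d) * prob (lengths n)" by (rule token_count_second_moment)
    finally have "real (n d) * (\<epsilon>\<^sup>2 * real (n d) * prob (E \<inter> lengths n)) \<le> real (n d) * prob (lengths n)"
      by (simp add: power2_eq_square mult_ac)
    then have "\<epsilon>\<^sup>2 * real (n d) * prob (E \<inter> lengths n) \<le> prob (lengths n)"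
      using n0 by (simp only: mult_le_cancel_left_pos)
    \<comment> \<open>One factor \<open>n d\<close> has cancelled against the variance bound; the
      other is bounded below by m.\<close>
    moreover have "\<epsilon>\<^sup>2 * m * prob (E \<inter> lengths n) \<le> \<epsilon>\<^sup>2 * real (n d) * prob (E \<inter> lengths n)"
      using True by (intro mult_right_mono mult_left_mono) auto
    ultimately have "\<epsilon>\<^sup>2 * m * prob (E \<inter> lengths n) \<le> prob (lengths n)" by (rule order_trans[rotated])
    then show ?thesis using \<epsilon> m by (simp add: FL pos_le_divide_eq mult_ac)
  qed
  have "emeasure M E \<le> (\<integral>\<^sup>+n. ennreal (1 / (\<epsilon>\<^sup>2 * m)) * emeasure M (F \<inter> lengths n) \<partial>count_space UNIV)"
    unfolding decomp[OF \<open>E \<in> sets M\<close>]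
    using one \<epsilon> m by (intro nn_integral_mono) (auto simp: emeasure_eq_measure ennreal_mult'[symmetric])
  also have "\<dots> = ennreal (1 / (\<epsilon>\<^sup>2 * m)) * emeasure M F"
    unfolding decomp[OF \<open>F \<in> sets M\<close>] by (rule nn_integral_cmult) simp
  finally have "prob E \<le> prob F / (\<epsilon>\<^sup>2 * m)"
    using \<epsilon> m by (simp add: emeasure_eq_measure ennreal_mult'[symmetric])
  then show ?thesis by (simp add: E_def F_def)
qed

end


section \<open>Sums of heavy-tailed radial vectors\<close>

lemma orthant_test_functionE:
  assumes f: "f \<in> cone_test_functions (nonneg_orthant :: (real ^ 'p) set) {0}"
  obtains B r where "B \<ge> 0" "\<And>x. \<bar>zero_outside (nonneg_orthant - {0}) f x\<bar> \<le> B"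
    "r > 0" "\<And>x. norm x < r \<Longrightarrow> zero_outside (nonneg_orthant - {0}) f x = 0"
    "continuous_on nonneg_orthant (zero_outside (nonneg_orthant - {0}) f)"
    "zero_outside (nonneg_orthant - {0}) f \<in> borel_measurable borel"
proof -
  obtain B where B: "B \<ge> 0" "\<And>x. \<bar>zero_outside (nonneg_orthant - {0}) f x\<bar> \<le> B"
    using test_function_bounded[OF f] by blast
  obtain r where r: "r > 0" "\<And>x y. x \<in> nonneg_orthant - {0} \<Longrightarrow> y \<in> {0} \<Longrightarrow> dist x y < r \<Longrightarrow> f x = 0"
    using test_function_zero_near[OF f] by blast
  have "zero_outside (nonneg_orthant - {0}) f x = 0" if "norm x < r" for x
    using r(2)[of x 0] that by (auto simp: zero_outside_def)
  then show thesis
    using that B r(1) continuous_on_zero_outside[OF f] borel_measurable_zero_outside(1)[OF f orthant_borel] by auto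
qed

lemma scaleR_orthant: "a \<in> nonneg_orthant \<Longrightarrow> 0 \<le> y \<Longrightarrow> y *\<^sub>R a \<in> nonneg_orthant"
  by (auto simp: nonneg_orthant_def)

context prob_space begin

text \<open>Independence allows integrating out the angular part first, replacing f by G(y) = E f(y
  a). This \<open>G\<close> is continuous by dominated convergence and vanishes below r because a
  has norm at most 1, so the one-dimensional limit applies.\<close>

lemma indep_radial_limit:
  fixes U :: "'a \<Rightarrow> real" and a :: "'a \<Rightarrow> real ^ 'p" and b :: "real \<Rightarrow> real"
  assumes Um[measurable]: "U \<in> borel_measurable M" and am[measurable]: "a \<in> borel_measurable M"
    and law: "distr M (borel \<Otimes>\<^sub>M borel) (\<lambda>\<omega>. (U \<omega>, a \<omega>)) = distr M borel U \<Otimes>\<^sub>M distr M borel a"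
    and \<iota>: "\<iota> > 0"
    and U: "\<And>\<omega>. \<omega> \<in> space M \<Longrightarrow> 0 \<le> U \<omega>"
    and tail: "\<And>x. x > 0 \<Longrightarrow> ((\<lambda>t. t * prob {\<omega>\<in>space M. U \<omega> > b t * x}) \<longlongrightarrow> x powr - \<iota>) at_top"
    and b: "\<forall>\<^sub>F t in at_top. b t > 0"
    and a: "\<And>\<omega>. \<omega> \<in> space M \<Longrightarrow> a \<omega> \<in> nonneg_orthant" "\<And>\<omega>. \<omega> \<in> space M \<Longrightarrow> norm (a \<omega>) \<le> 1"
    and f: "f \<in> cone_test_functions nonneg_orthant {0}"
  shows "((\<lambda>t. t * expectation (\<lambda>\<omega>. zero_outside (nonneg_orthant - {0}) f ((U \<omega> / b t) *\<^sub>R a \<omega>)))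
    \<longlongrightarrow> (\<integral>y. expectation (\<lambda>\<omega>. zero_outside (nonneg_orthant - {0}) f (y *\<^sub>R a \<omega>)) \<partial>nu \<iota>)) at_top"
proof -
  let ?F = "zero_outside (nonneg_orthant - {0}) f"
  obtain B r where B: "B \<ge> 0" "\<And>x. \<bar>?F x\<bar> \<le> B" and r: "r > 0" "\<And>x. norm x < r \<Longrightarrow> ?F x = 0"
    and Fc: "continuous_on nonneg_orthant ?F" and Fm[measurable]: "?F \<in> borel_measurable borel"
    using orthant_test_functionE[OF f] by metis
  \<comment> \<open>The one-dimensional result asks for continuity on the whole line, but the
    extension of f is continuous on the orthant only; \<open>max 0 y\<close> keeps the argument
    there.\<close>
  define G where "G = (\<lambda>y. expectation (\<lambda>\<omega>. ?F (max 0 y *\<^sub>R a \<omega>)))"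
  have int: "integrable M (\<lambda>\<omega>. ?F (z \<omega> *\<^sub>R a \<omega>))" if "z \<in> borel_measurable M" for z
    using that B by (intro integrable_const_bound[where B = B] AE_I2) auto
  have Gc: "continuous_on UNIV G"
    unfolding continuous_on_sequentially
  proof (intro allI ballI impI, elim conjE)
    fix X y assume X: "X \<longlonglongrightarrow> (y :: real)"
    have "(\<lambda>n. G (X n)) \<longlonglongrightarrow> G y"
      unfolding G_def
    proof (rule integral_dominated_convergence[where w = "\<lambda>_. B"])
      show "AE \<omega> in M. (\<lambda>n. ?F (max 0 (X n) *\<^sub>R a \<omega>)) \<longlonglongrightarrow> ?F (max 0 y *\<^sub>R a \<omega>)"
      proof (rule AE_I2)
        fix \<omega> assume \<omega>: "\<omega> \<in> space M"
        have "(\<lambda>n. max 0 (X n) *\<^sub>R a \<omega>) \<longlonglongrightarrow> max 0 y *\<^sub>R a \<omega>" by (intro tendsto_intros X)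
        then show "(\<lambda>n. ?F (max 0 (X n) *\<^sub>R a \<omega>)) \<longlonglongrightarrow> ?F (max 0 y *\<^sub>R a \<omega>)"
          using Fc a(1)[OF \<omega>] by (intro continuous_on_tendsto_compose[OF Fc] always_eventually allI scaleR_orthant) auto
      qed
    qed (use B in auto)
    then show "(G \<circ> X) \<longlonglongrightarrow> G y" by (simp add: o_def)
  qed
  have Gb: "\<bar>G y\<bar> \<le> B" for y
  proof -
    have "\<bar>G y\<bar> \<le> expectation (\<lambda>\<omega>. \<bar>?F (max 0 y *\<^sub>R a \<omega>)\<bar>)" unfolding G_def by (rule integral_abs_bound)
    also have "\<dots> \<le> expectation (\<lambda>\<omega>. B)" using B by (intro integral_mono integrable_abs int) auto
    finally show ?thesis by (simp add: prob_space)
  qed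
  have G0: "G y = 0" if "y < r" for y
  proof -
    have "?F (max 0 y *\<^sub>R a \<omega>) = 0" if "\<omega> \<in> space M" for \<omega>
    proof (rule r(2))
      have "norm (max 0 y *\<^sub>R a \<omega>) \<le> max 0 y * 1"
        using a(2)[OF that] by (simp only: norm_scaleR) (intro mult_mono, auto)
      then show "norm (max 0 y *\<^sub>R a \<omega>) < r" using \<open>y < r\<close> r(1) by simp
    qed
    then have "G y = expectation (\<lambda>\<omega>. 0)" unfolding G_def by (intro Bochner_Integration.integral_cong) auto
    then show ?thesis by simp
  qed
  have lim: "((\<lambda>t. t * expectation (\<lambda>\<omega>. G (U \<omega> / b t))) \<longlongrightarrow> (\<integral>y. G y \<partial>nu \<iota>)) at_top"
    by (rule tail_convergence_integral[OF Um \<iota> tail b Gc Gb r(1) G0])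
  have eq: "expectation (\<lambda>\<omega>. G (U \<omega> / b t)) = expectation (\<lambda>\<omega>. ?F ((U \<omega> / b t) *\<^sub>R a \<omega>))" if "b t > 0" for t
  proof -
    \<comment> \<open>The same \<open>max\<close> as in \<open>G\<close>, since under the product
      law the first coordinate ranges over all reals.\<close>
    let ?h = "\<lambda>z :: real \<times> (real ^ 'p). ?F (max 0 (fst z / b t) *\<^sub>R snd z)"
    interpret DU: prob_space "distr M borel U" by (rule prob_space_distr) simp
    interpret Da: prob_space "distr M borel a" by (rule prob_space_distr) simp
    interpret pair_prob_space "distr M borel U" "distr M borel a" ..
    have hm: "?h \<in> borel_measurable (borel \<Otimes>\<^sub>M borel)" by measurable
    have hi: "integrable (distr M borel U \<Otimes>\<^sub>M distr M borel a) ?h"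
    proof (rule P.integrable_const_bound[where B = B])
      have "sets (distr M borel U \<Otimes>\<^sub>M distr M borel a) = sets (borel \<Otimes>\<^sub>M borel)"
        by (intro sets_pair_measure_cong) simp_all
      then show "?h \<in> borel_measurable (distr M borel U \<Otimes>\<^sub>M distr M borel a)"
        using hm measurable_cong_sets by blast
    qed (use B in simp)
    have "(\<integral>\<omega>. ?F ((U \<omega> / b t) *\<^sub>R a \<omega>) \<partial>M) = (\<integral>\<omega>. ?h (U \<omega>, a \<omega>) \<partial>M)"
      using U that by (intro Bochner_Integration.integral_cong) (auto simp: max_def)
    also have "\<dots> = integral\<^sup>L (distr M (borel \<Otimes>\<^sub>M borel) (\<lambda>\<omega>. (U \<omega>, a \<omega>))) ?h"
      by (rule integral_distr[symmetric, OF _ hm]) simp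
    also have "distr M (borel \<Otimes>\<^sub>M borel) (\<lambda>\<omega>. (U \<omega>, a \<omega>)) = distr M borel U \<Otimes>\<^sub>M distr M borel a"
      by (rule law)
    also have "integral\<^sup>L (distr M borel U \<Otimes>\<^sub>M distr M borel a) ?h
        = (\<integral>u. (\<integral>p. ?h (u, p) \<partial>distr M borel a) \<partial>distr M borel U)"
      by (rule integral_fst'[symmetric, OF hi])
    also have "\<dots> = (\<integral>u. G (u / b t) \<partial>distr M borel U)"
      by (intro Bochner_Integration.integral_cong refl) (simp add: G_def integral_distr)
    also have "\<dots> = (\<integral>\<omega>. G (U \<omega> / b t) \<partial>M)"
      using borel_measurable_continuous_onI[OF Gc] by (intro integral_distr) auto
    finally show ?thesis by simp
  qed
  moreover have "(\<integral>y. G y \<partial>nu \<iota>) = (\<integral>y. expectation (\<lambda>\<omega>. ?F (y *\<^sub>R a \<omega>)) \<partial>nu \<iota>)"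
    by (intro Bochner_Integration.integral_cong refl) (simp add: G_def nu_space[OF \<iota>])
  moreover have "\<forall>\<^sub>F t in at_top. t * expectation (\<lambda>\<omega>. G (U \<omega> / b t)) = t * expectation (\<lambda>\<omega>. ?F ((U \<omega> / b t) *\<^sub>R a \<omega>))"
    using b by eventually_elim (simp only: eq)
  ultimately show ?thesis using Lim_transform_eventually[OF lim] by simp
qed

text \<open>The errors that are invisible on the scale \<open>b\<close> even after multiplication by
  t.\<close>

definition tail_negligible :: "(real \<Rightarrow> real) \<Rightarrow> ('a \<Rightarrow> real) \<Rightarrow> bool" where
  "tail_negligible b R \<longleftrightarrow> R \<in> borel_measurable M \<and>
     (\<forall>\<epsilon>>0. ((\<lambda>t. t * prob {\<omega>\<in>space M. \<bar>R \<omega>\<bar> > \<epsilon> * b t}) \<longlongrightarrow> 0) at_top)"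

text \<open>A union bound: an error above the threshold forces one of the \<open>r j\<close> above
  its share of it. The share is taken among card J + 1, which keeps it positive for empty
  \<open>J\<close>.\<close>

lemma tail_negligible_dominated:
  assumes J: "finite J" and r: "\<And>j. j \<in> J \<Longrightarrow> tail_negligible b (r j)"
    and b: "\<forall>\<^sub>F t in at_top. b t > 0" and R: "R \<in> borel_measurable M"
    and le: "\<And>\<omega>. \<omega> \<in> space M \<Longrightarrow> \<bar>R \<omega>\<bar> \<le> (\<Sum>j\<in>J. \<bar>r j \<omega>\<bar>)"
  shows "tail_negligible b R"
  unfolding tail_negligible_def
proof (intro conjI allI impI R)
  fix \<epsilon> :: real assume \<epsilon>: "\<epsilon> > 0"
  let ?e = "\<epsilon> / real (card J + 1)"
  have e: "?e > 0" using \<epsilon> by simp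
  have rm: "r j \<in> borel_measurable M" if "j \<in> J" for j using r[OF that] by (simp add: tail_negligible_def)
  have lim: "((\<lambda>t. \<Sum>j\<in>J. t * prob {\<omega>\<in>space M. \<bar>r j \<omega>\<bar> > ?e * b t}) \<longlongrightarrow> (\<Sum>j\<in>J. 0)) at_top"
    using r e unfolding tail_negligible_def by (intro tendsto_sum) blast
  have "\<forall>\<^sub>F t in at_top. t * prob {\<omega>\<in>space M. \<bar>R \<omega>\<bar> > \<epsilon> * b t} \<le> (\<Sum>j\<in>J. t * prob {\<omega>\<in>space M. \<bar>r j \<omega>\<bar> > ?e * b t})"
    using b eventually_ge_at_top[of 0]
  proof eventually_elim
    case (elim t)
    have meas: "{\<omega>\<in>space M. \<bar>r j \<omega>\<bar> > ?e * b t} \<in> events" if "j \<in> J" for j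
      using rm[OF that] by measurable
    have "{\<omega>\<in>space M. \<bar>R \<omega>\<bar> > \<epsilon> * b t} \<subseteq> (\<Union>j\<in>J. {\<omega>\<in>space M. \<bar>r j \<omega>\<bar> > ?e * b t})"
    proof (rule subsetI, rule ccontr)
      fix \<omega> assume \<omega>: "\<omega> \<in> {\<omega>\<in>space M. \<bar>R \<omega>\<bar> > \<epsilon> * b t}" "\<omega> \<notin> (\<Union>j\<in>J. {\<omega>\<in>space M. \<bar>r j \<omega>\<bar> > ?e * b t})"
      then have "\<bar>R \<omega>\<bar> \<le> (\<Sum>j\<in>J. ?e * b t)" by (intro order_trans[OF le sum_mono]) auto
      also have "\<dots> = real (card J) / real (card J + 1) * (\<epsilon> * b t)" by simp
      also have "\<dots> \<le> 1 * (\<epsilon> * b t)" using \<epsilon> elim by (intro mult_right_mono) auto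
      finally show False using \<omega>(1) by simp
    qed
    then have "prob {\<omega>\<in>space M. \<bar>R \<omega>\<bar> > \<epsilon> * b t} \<le> prob (\<Union>j\<in>J. {\<omega>\<in>space M. \<bar>r j \<omega>\<bar> > ?e * b t})"
      using meas J by (intro finite_measure_mono) auto
    also have "\<dots> \<le> (\<Sum>j\<in>J. prob {\<omega>\<in>space M. \<bar>r j \<omega>\<bar> > ?e * b t})"
      using meas J by (intro finite_measure_subadditive_finite) auto
    finally show ?case using elim by (simp add: sum_distrib_left[symmetric] mult_left_mono)
  qed
  moreover have "\<forall>\<^sub>F t in at_top. 0 \<le> t * prob {\<omega>\<in>space M. \<bar>R \<omega>\<bar> > \<epsilon> * b t}"
    using eventually_ge_at_top[of "0::real"] by eventually_elim simp
  ultimately show "((\<lambda>t. t * prob {\<omega>\<in>space M. \<bar>R \<omega>\<bar> > \<epsilon> * b t}) \<longlongrightarrow> 0) at_top"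
    using tendsto_sandwich[OF _ _ tendsto_const lim] by simp
qed

text \<open>Two of the \<open>U d\<close> exceed a fixed multiple of b(t) together with probability
  of order t^-2, by independence, so in the limit at most one summand counts and limits add. The
  proof compares f at the total with the sum of f at the pieces pointwise, then takes
  expectations.\<close>

lemma one_big_jump:
  fixes U :: "'d \<Rightarrow> 'a \<Rightarrow> real" and a Y :: "'d \<Rightarrow> 'a \<Rightarrow> real ^ 'p" and b :: "real \<Rightarrow> real"
  assumes D: "finite D" and \<iota>: "\<iota> > 0"
    and U: "\<And>d. d \<in> D \<Longrightarrow> U d \<in> borel_measurable M" "\<And>d \<omega>. d \<in> D \<Longrightarrow> \<omega> \<in> space M \<Longrightarrow> 0 \<le> U d \<omega>"
    and tail: "\<And>d x. d \<in> D \<Longrightarrow> x > 0 \<Longrightarrow> ((\<lambda>t. t * prob {\<omega>\<in>space M. U d \<omega> > b t * x}) \<longlongrightarrow> x powr - \<iota>) at_top"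
    and pair: "\<And>d d' x. d \<in> D \<Longrightarrow> d' \<in> D \<Longrightarrow> d \<noteq> d' \<Longrightarrow>
      prob {\<omega>\<in>space M. U d \<omega> > x \<and> U d' \<omega> > x} = prob {\<omega>\<in>space M. U d \<omega> > x} * prob {\<omega>\<in>space M. U d' \<omega> > x}"
    and b: "\<forall>\<^sub>F t in at_top. b t > 0"
    and am: "\<And>d. d \<in> D \<Longrightarrow> a d \<in> borel_measurable M"
    and a: "\<And>d \<omega>. d \<in> D \<Longrightarrow> \<omega> \<in> space M \<Longrightarrow> a d \<omega> \<in> nonneg_orthant" "\<And>d \<omega>. d \<in> D \<Longrightarrow> \<omega> \<in> space M \<Longrightarrow> norm (a d \<omega>) \<le> 1"
    and Ym: "\<And>d. d \<in> D \<Longrightarrow> Y d \<in> borel_measurable M"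
    and Yc: "\<And>d \<omega>. d \<in> D \<Longrightarrow> \<omega> \<in> space M \<Longrightarrow> Y d \<omega> \<in> nonneg_orthant"
    and neg: "\<And>d. d \<in> D \<Longrightarrow> tail_negligible b (\<lambda>\<omega>. norm (Y d \<omega> - U d \<omega> *\<^sub>R a d \<omega>))"
    and f: "f \<in> cone_test_functions nonneg_orthant {0}"
  shows "((\<lambda>t. t * expectation (\<lambda>\<omega>. zero_outside (nonneg_orthant - {0}) f ((1 / b t) *\<^sub>R (\<Sum>d\<in>D. Y d \<omega>)))
    - (\<Sum>d\<in>D. t * expectation (\<lambda>\<omega>. zero_outside (nonneg_orthant - {0}) f ((U d \<omega> / b t) *\<^sub>R a d \<omega>)))) \<longlongrightarrow> 0) at_top"
proof -
  let ?F = "zero_outside (nonneg_orthant - {0}) f"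
  obtain B r where B: "B \<ge> 0" "\<And>x. \<bar>?F x\<bar> \<le> B" and r: "r > 0" "\<And>x. norm x < r \<Longrightarrow> ?F x = 0"
    and Fc: "continuous_on nonneg_orthant ?F" and Fm[measurable]: "?F \<in> borel_measurable borel"
    using orthant_test_functionE[OF f] by metis
  define n where "n = real (card D)"
  have n0: "n \<ge> 0" by (simp add: n_def)
  \<comment> \<open>The trivial bound for the difference: n + 1 values of the extension of f, each
    at most B.\<close>
  define K where "K = (n + 1) * B"
  have K: "K \<ge> 0" using n0 B by (simp add: K_def)
  \<comment> \<open>If every U / b(t) is at most \<rho>, the pieces add up to norm at most n \<rho>,
    and the approximation errors add at most n \<rho> more; 2 n \<rho> < r puts the total where f
    vanishes.\<close>
  define \<rho> where "\<rho> = r / (2 * (n + 1))"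
  have \<rho>: "\<rho> > 0" "\<rho> < r" "2 * n * \<rho> < r" using r(1) n0
    by (auto simp: \<rho>_def field_simps intro: add_pos_nonneg)
  let ?V = "\<lambda>t \<omega>. (1 / b t) *\<^sub>R (\<Sum>d\<in>D. Y d \<omega>)"
  let ?W = "\<lambda>t d \<omega>. (U d \<omega> / b t) *\<^sub>R a d \<omega>"
  let ?E = "\<lambda>t d x. {\<omega>\<in>space M. U d \<omega> > b t * x}"
  let ?N = "\<lambda>t d x. {\<omega>\<in>space M. \<bar>norm (Y d \<omega> - U d \<omega> *\<^sub>R a d \<omega>)\<bar> > x * b t}"
  have Em: "?E t d x \<in> events" if "d \<in> D" for t d x using U(1)[OF that] by measurable
  have Nm: "?N t d x \<in> events" if "d \<in> D" for t d x using U(1)[OF that] am[OF that] Ym[OF that] by measurable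
  \<comment> \<open>Unless some length is huge, two lengths are not small, or some \<open>Y d\<close> is badly approximated, the
    total is close to its largest summand and \<open>f\<close> vanishes at all the others.\<close>
  have bound: "\<exists>\<delta>>0. \<forall>t>0. b t > 0 \<longrightarrow> (\<forall>\<omega>\<in>space M. \<bar>?F (?V t \<omega>) - (\<Sum>d\<in>D. ?F (?W t d \<omega>))\<bar>
      \<le> e * (\<Sum>d\<in>D. indicator (?E t d \<rho>) \<omega>) + K * ((\<Sum>d\<in>D. indicator (?E t d \<Lambda>) \<omega>)
        + (\<Sum>d\<in>D. \<Sum>d'\<in>D - {d}. indicator (?E t d \<delta> \<inter> ?E t d' \<delta>) \<omega>) + (\<Sum>d\<in>D. indicator (?N t d \<delta>) \<omega>)))"
    if e: "e > 0" and \<Lambda>: "\<Lambda> > 0" for e \<Lambda> :: real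
  proof -
    \<comment> \<open>Off the bad events the largest piece has norm at most \<Lambda> and the total
      is within 1 of it, so both lie in this compact set, where f is uniformly continuous.\<close>
    have "compact (nonneg_orthant \<inter> cball (0 :: real ^ 'p) (\<Lambda> + 1))"
      by (intro closed_Int_compact closed_nonneg_orthant) simp
    then have "uniformly_continuous_on (nonneg_orthant \<inter> cball 0 (\<Lambda> + 1)) ?F"
      by (intro compact_uniformly_continuous continuous_on_subset[OF Fc]) auto
    then obtain \<eta> where \<eta>: "\<eta> > 0" "\<And>x x'. x \<in> nonneg_orthant \<Longrightarrow> norm x \<le> \<Lambda> + 1 \<Longrightarrow> x' \<in> nonneg_orthant \<Longrightarrow> norm x' \<le> \<Lambda> + 1 \<Longrightarrow> dist x' x < \<eta> \<Longrightarrow> dist (?F x') (?F x) < e"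
      using e unfolding uniformly_continuous_on_def by (auto simp: Ball_def)
    \<comment> \<open>The total differs from its largest piece by at most n \<delta> through the
      approximation of the \<open>Y d\<close> and n \<delta> through the other pieces. Hence 2 n
      \<delta>, to be kept below both \<eta> and 1.\<close>
    define \<delta> where "\<delta> = min \<rho> (min \<eta> 1 / (2 * (n + 1)))"
    have \<delta>: "\<delta> > 0" "\<delta> \<le> \<rho>" using \<rho> \<eta> n0 by (auto simp: \<delta>_def)
    have "\<delta> \<le> min \<eta> 1 / (2 * (n + 1))" by (simp add: \<delta>_def)
    then have "2 * (n + 1) * \<delta> \<le> min \<eta> 1" using n0 by (simp add: pos_le_divide_eq mult.commute)
    then have \<delta>2: "2 * n * \<delta> < \<eta>" "2 * n * \<delta> < 1" using \<delta>(1) n0 by (auto simp: algebra_simps)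
    show ?thesis
    proof (intro exI[of _ \<delta>] conjI allI impI ballI \<delta>(1))
      fix t \<omega> assume t: "t > 0" and bt: "b t > 0" and \<omega>: "\<omega> \<in> space M"
      let ?L = "\<bar>?F (?V t \<omega>) - (\<Sum>d\<in>D. ?F (?W t d \<omega>))\<bar>"
      let ?A1 = "(\<Sum>d\<in>D. indicator (?E t d \<rho>) \<omega>) :: real"
      let ?A2 = "(\<Sum>d\<in>D. indicator (?E t d \<Lambda>) \<omega>) :: real"
      let ?A3 = "(\<Sum>d\<in>D. \<Sum>d'\<in>D - {d}. indicator (?E t d \<delta> \<inter> ?E t d' \<delta>) \<omega>) :: real"
      let ?A4 = "(\<Sum>d\<in>D. indicator (?N t d \<delta>) \<omega>) :: real"
      have pos: "?A1 \<ge> 0" "?A2 \<ge> 0" "?A3 \<ge> 0" "?A4 \<ge> 0" by (auto intro!: sum_nonneg)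
      have LK: "?L \<le> K"
      proof -
        have "?L \<le> \<bar>?F (?V t \<omega>)\<bar> + \<bar>\<Sum>d\<in>D. ?F (?W t d \<omega>)\<bar>" by (rule abs_triangle_ineq4)
        also have "\<dots> \<le> B + (\<Sum>d\<in>D. B)"
          by (intro add_mono B order_trans[OF sum_abs sum_mono])
        finally show ?thesis by (simp add: K_def n_def algebra_simps)
      qed
      have one_le: "1 \<le> (\<Sum>d\<in>D. indicator (S d) \<omega> :: real)" if "d \<in> D" "\<omega> \<in> S d" for d S
        using member_le_sum[of d D "\<lambda>d. indicator (S d) \<omega> :: real"] that D by simp
      have big: "?L \<le> e * ?A1 + K * (?A2 + ?A3 + ?A4)" if "1 \<le> ?A2 + ?A3 + ?A4"
      proof -
        have "?L \<le> K * 1" using LK by simp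
        also have "\<dots> \<le> K * (?A2 + ?A3 + ?A4)" by (intro mult_left_mono that K)
        finally show ?thesis using mult_nonneg_nonneg[OF less_imp_le[OF e] pos(1)] by linarith
      qed
      show "?L \<le> e * ?A1 + K * (?A2 + ?A3 + ?A4)"
      proof (cases "1 \<le> ?A2 + ?A3 + ?A4")
        case True
        then show ?thesis by (rule big)
      next
        case False
        have n2: "\<omega> \<notin> ?E t d \<Lambda>" if "d \<in> D" for d
          using one_le[of d "\<lambda>d. ?E t d \<Lambda>"] that False pos by fastforce
        have n4: "\<omega> \<notin> ?N t d \<delta>" if "d \<in> D" for d
          using one_le[of d "\<lambda>d. ?N t d \<delta>"] that False pos by fastforce
        have n3: "\<omega> \<notin> ?E t d \<delta> \<inter> ?E t d' \<delta>" if "d \<in> D" "d' \<in> D" "d \<noteq> d'" for d d'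
        proof
          assume *: "\<omega> \<in> ?E t d \<delta> \<inter> ?E t d' \<delta>"
          have "(1::real) \<le> (\<Sum>d'\<in>D - {d}. indicator (?E t d \<delta> \<inter> ?E t d' \<delta>) \<omega>)"
            using member_le_sum[of d' "D - {d}" "\<lambda>d'. indicator (?E t d \<delta> \<inter> ?E t d' \<delta>) \<omega> :: real"] * that D by simp
          also have "\<dots> \<le> ?A3"
            using member_le_sum[of d D "\<lambda>d. \<Sum>d'\<in>D - {d}. indicator (?E t d \<delta> \<inter> ?E t d' \<delta>) \<omega> :: real"] that D
            by (simp add: sum_nonneg)
          finally show False using False pos by linarith
        qed
        define u where "u = (\<lambda>d. U d \<omega> / b t)"
        have u0: "u d \<ge> 0" if "d \<in> D" for d using U(2)[OF that \<omega>] bt by (simp add: u_def)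
        have E: "\<omega> \<in> ?E t d x \<longleftrightarrow> u d > x" for d x
          using \<omega> bt by (simp add: u_def pos_less_divide_eq mult.commute)
        have Wn: "norm (?W t d \<omega>) \<le> u d" if "d \<in> D" for d
        proof -
          have "norm (?W t d \<omega>) = u d * norm (a d \<omega>)" using u0[OF that] by (simp only: u_def norm_scaleR abs_of_nonneg)
          also have "\<dots> \<le> u d * 1" using u0[OF that] a(2)[OF that \<omega>] by (intro mult_left_mono)
          finally show ?thesis by simp
        qed
        have Wc: "?W t d \<omega> \<in> nonneg_orthant" if "d \<in> D" for d
          using a(1)[OF that \<omega>] u0[OF that] by (intro scaleR_orthant) (auto simp: u_def)
        have Vc: "?V t \<omega> \<in> nonneg_orthant"
          using Yc[OF _ \<omega>] bt by (intro scaleR_orthant) (auto simp: nonneg_orthant_def intro!: sum_nonneg)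
        have YW: "norm ((1 / b t) *\<^sub>R Y d \<omega> - ?W t d \<omega>) \<le> \<delta>" if "d \<in> D" for d
        proof -
          have "(1 / b t) *\<^sub>R Y d \<omega> - ?W t d \<omega> = (1 / b t) *\<^sub>R (Y d \<omega> - U d \<omega> *\<^sub>R a d \<omega>)"
            by (simp add: scaleR_diff_right)
          then have "norm ((1 / b t) *\<^sub>R Y d \<omega> - ?W t d \<omega>) = norm (Y d \<omega> - U d \<omega> *\<^sub>R a d \<omega>) / b t"
            using bt by simp
          moreover have "norm (Y d \<omega> - U d \<omega> *\<^sub>R a d \<omega>) \<le> \<delta> * b t" using n4[OF that] \<omega> by simp
          ultimately show ?thesis by (simp only: pos_divide_le_eq[OF bt])
        qed
        have VS: "norm (?V t \<omega> - (\<Sum>d\<in>D. ?W t d \<omega>)) \<le> n * \<delta>"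
        proof -
          have "?V t \<omega> - (\<Sum>d\<in>D. ?W t d \<omega>) = (\<Sum>d\<in>D. (1 / b t) *\<^sub>R Y d \<omega> - ?W t d \<omega>)"
            by (simp add: scaleR_sum_right sum_subtractf)
          also have "norm \<dots> \<le> (\<Sum>d\<in>D. \<delta>)" by (intro order_trans[OF norm_sum sum_mono] YW)
          finally show ?thesis by (simp add: n_def)
        qed
        show ?thesis
        proof (cases "\<exists>d\<in>D. u d > \<rho>")
          \<comment> \<open>No jump: all arguments lie in the ball where f vanishes.\<close>
          case False
          have "norm (?V t \<omega>) \<le> n * \<delta> + norm (\<Sum>d\<in>D. ?W t d \<omega>)"
            using VS norm_triangle_sub[of "?V t \<omega>" "\<Sum>d\<in>D. ?W t d \<omega>"] by linarith
          moreover have "norm (\<Sum>d\<in>D. ?W t d \<omega>) \<le> (\<Sum>d\<in>D. \<rho>)"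
            using False by (intro order_trans[OF norm_sum sum_mono] order_trans[OF Wn]) (auto simp: not_less)
          moreover have "(\<Sum>d\<in>D. \<rho>) = n * \<rho>" by (simp add: n_def)
          moreover have "n * \<delta> \<le> n * \<rho>" using \<delta>(2) n0 by (rule mult_left_mono)
          ultimately have "norm (?V t \<omega>) < r" using \<rho>(3) by linarith
          then have "?F (?V t \<omega>) = 0" by (rule r(2))
          moreover have "?F (?W t d \<omega>) = 0" if "d \<in> D" for d
            using False that Wn[OF that] \<rho>(2) by (intro r(2)) (auto simp: not_less)
          ultimately have "?L = 0" by simp
          then show ?thesis using e K pos by simp
        next
          case True
          \<comment> \<open>\<open>d0\<close> is the only index above \<delta>, since a second one
            would be a bad event.\<close>
          then obtain d0 where d0: "d0 \<in> D" "u d0 > \<rho>" by blast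
          have small: "u d \<le> \<delta>" if "d \<in> D - {d0}" for d
            using n3[of d d0] that d0 \<delta>(2) unfolding Int_iff E by fastforce
          have "?F (?W t d \<omega>) = 0" if "d \<in> D - {d0}" for d
            using small[OF that] Wn[of d] that \<delta>(2) \<rho>(2) by (intro r(2)) auto
          then have S: "(\<Sum>d\<in>D. ?F (?W t d \<omega>)) = ?F (?W t d0 \<omega>)"
            using D d0(1) by (subst sum.remove[of _ d0]) auto
          have "(\<Sum>d\<in>D. ?W t d \<omega>) - ?W t d0 \<omega> = (\<Sum>d\<in>D - {d0}. ?W t d \<omega>)"
            using D d0(1) by (simp add: sum.remove[of _ d0])
          also have "norm \<dots> \<le> (\<Sum>d\<in>D - {d0}. \<delta>)"
            using small by (intro order_trans[OF norm_sum sum_mono] order_trans[OF Wn]) auto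
          also have "\<dots> \<le> n * \<delta>" using \<delta>(1) D by (simp add: n_def card_Diff_singleton_if)
          finally have d1: "norm (?V t \<omega> - ?W t d0 \<omega>) \<le> 2 * n * \<delta>"
            using VS norm_triangle_ineq[of "?V t \<omega> - (\<Sum>d\<in>D. ?W t d \<omega>)" "(\<Sum>d\<in>D. ?W t d \<omega>) - ?W t d0 \<omega>"] by simp
          have nW: "norm (?W t d0 \<omega>) \<le> \<Lambda>" using Wn[OF d0(1)] n2[OF d0(1)] unfolding E by linarith
          then have nV: "norm (?V t \<omega>) \<le> \<Lambda> + 1"
            using d1 \<delta>2(2) norm_triangle_sub[of "?V t \<omega>" "?W t d0 \<omega>"] by linarith
          have "dist (?F (?V t \<omega>)) (?F (?W t d0 \<omega>)) < e"
            using nW nV d1 \<delta>2(1) by (intro \<eta>(2) Wc Vc d0(1)) (auto simp: dist_norm)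
          then have "?L \<le> e * 1" unfolding S by (simp add: dist_real_def)
          also have "\<dots> \<le> e * ?A1"
            using one_le[of d0 "\<lambda>d. ?E t d \<rho>"] d0 e unfolding E by (intro mult_left_mono) auto
          also have "\<dots> \<le> e * ?A1 + K * (?A2 + ?A3 + ?A4)" using K pos by simp
          finally show ?thesis .
        qed
      qed
    qed
  qed
  \<comment> \<open>As t P converges, P itself tends to 0; against the convergent t P of another
    index this makes the pair terms vanish.\<close>
  have P0: "((\<lambda>t. prob (?E t d x)) \<longlongrightarrow> 0) at_top" if "d \<in> D" "x > 0" for d x
  proof -
    have "((\<lambda>t. (t * prob (?E t d x)) * inverse t) \<longlongrightarrow> x powr - \<iota> * 0) at_top"
      by (intro tendsto_mult tail that tendsto_inverse_0_at_top filterlim_ident)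
    moreover have "\<forall>\<^sub>F t::real in at_top. (t * prob (?E t d x)) * inverse t = prob (?E t d x)"
      using eventually_gt_at_top[of 0] by eventually_elim simp
    ultimately show ?thesis using Lim_transform_eventually by fastforce
  qed
  show ?thesis
  proof (rule tendstoI)
    fix e0 :: real assume e0: "e0 > 0"
    \<comment> \<open>\<rho> depends on f and the number of summands only, so \<open>e\<close> can
      be fixed before \<Lambda> and \<delta>; it keeps the uniform-continuity term below e0 / 2 in
      the limit. \<Lambda> then does the same for the huge values, and the other terms tend to 0 for
      the resulting \<delta>. The added 1 keeps the denominator positive for empty
      \<open>D\<close>.\<close>
    define e where "e = e0 / (2 * (n * \<rho> powr - \<iota> + 1))"
    have n\<rho>: "n * \<rho> powr - \<iota> \<ge> 0" using n0 by simp
    have e: "e > 0" using e0 n\<rho> by (simp add: e_def add_nonneg_pos)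
    have "e * (n * \<rho> powr - \<iota>) < e * (n * \<rho> powr - \<iota> + 1)" using e by simp
    also have "\<dots> = e0 / 2" using n\<rho> by (simp add: e_def field_simps add_nonneg_eq_0_iff)
    finally have e1: "e * (n * \<rho> powr - \<iota>) < e0 / 2" .
    have "((\<lambda>\<Lambda>. K * (n * \<Lambda> powr - \<iota>)) \<longlongrightarrow> K * (n * 0)) at_top"
      using \<iota> by (intro tendsto_intros tendsto_neg_powr filterlim_ident) simp
    then have "\<forall>\<^sub>F \<Lambda> in at_top. K * (n * \<Lambda> powr - \<iota>) < e0 / 2"
      using e0 by (intro order_tendstoD(2)) auto
    then have "\<forall>\<^sub>F \<Lambda> in at_top. K * (n * \<Lambda> powr - \<iota>) < e0 / 2 \<and> \<Lambda> > 0"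
      using eventually_gt_at_top[of 0] by eventually_elim simp
    then obtain \<Lambda> where \<Lambda>: "\<Lambda> > 0" "K * (n * \<Lambda> powr - \<iota>) < e0 / 2"
      using eventually_happens[of _ "at_top :: real filter"] by auto
    obtain \<delta> where \<delta>: "\<delta> > 0" and bd: "\<And>t \<omega>. t > 0 \<Longrightarrow> b t > 0 \<Longrightarrow> \<omega> \<in> space M \<Longrightarrow> \<bar>?F (?V t \<omega>) - (\<Sum>d\<in>D. ?F (?W t d \<omega>))\<bar>
      \<le> e * (\<Sum>d\<in>D. indicator (?E t d \<rho>) \<omega>) + K * ((\<Sum>d\<in>D. indicator (?E t d \<Lambda>) \<omega>)
        + (\<Sum>d\<in>D. \<Sum>d'\<in>D - {d}. indicator (?E t d \<delta> \<inter> ?E t d' \<delta>) \<omega>) + (\<Sum>d\<in>D. indicator (?N t d \<delta>) \<omega>))"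
      by (rule exE[OF bound[OF e \<Lambda>(1)]]) blast
    let ?g = "\<lambda>t. e * (\<Sum>d\<in>D. t * prob (?E t d \<rho>)) + K * ((\<Sum>d\<in>D. t * prob (?E t d \<Lambda>))
        + (\<Sum>d\<in>D. \<Sum>d'\<in>D - {d}. (t * prob (?E t d \<delta>)) * prob (?E t d' \<delta>)) + (\<Sum>d\<in>D. t * prob (?N t d \<delta>)))"
    have "(?g \<longlongrightarrow> e * (\<Sum>d\<in>D. \<rho> powr - \<iota>) + K * ((\<Sum>d\<in>D. \<Lambda> powr - \<iota>)
        + (\<Sum>d\<in>D. \<Sum>d'\<in>D - {d}. \<delta> powr - \<iota> * 0) + (\<Sum>d\<in>D. 0))) at_top"
      using \<rho> \<Lambda> \<delta> neg unfolding tail_negligible_def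
      by (intro tendsto_add tendsto_mult tendsto_const tendsto_sum tail P0) auto
    moreover have "e * (\<Sum>d\<in>D. \<rho> powr - \<iota>) + K * ((\<Sum>d\<in>D. \<Lambda> powr - \<iota>)
        + (\<Sum>d\<in>D. \<Sum>d'\<in>D - {d}. \<delta> powr - \<iota> * 0) + (\<Sum>d\<in>D. 0)) < e0"
      using e1 \<Lambda>(2) by (simp add: n_def)
    ultimately have "\<forall>\<^sub>F t in at_top. ?g t < e0" by (rule order_tendstoD(2))
    then show "\<forall>\<^sub>F t in at_top. dist (t * expectation (\<lambda>\<omega>. ?F (?V t \<omega>)) - (\<Sum>d\<in>D. t * expectation (\<lambda>\<omega>. ?F (?W t d \<omega>)))) 0 < e0"
      using b eventually_gt_at_top[of 0]
    proof eventually_elim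
      case (elim t)
      have iV: "integrable M (\<lambda>\<omega>. ?F (?V t \<omega>))"
        using B Ym by (intro integrable_const_bound[where B = B] AE_I2 measurable_compose[OF _ Fm]) auto
      have iW: "integrable M (\<lambda>\<omega>. ?F (?W t d \<omega>))" if "d \<in> D" for d
        using B U(1)[OF that] am[OF that] by (intro integrable_const_bound[where B = B] AE_I2 measurable_compose[OF _ Fm]) auto
      have ii: "integrable M (indicator S :: 'a \<Rightarrow> real)" if "S \<in> events" for S
        using that by (simp add: less_top[symmetric])
      let ?H = "\<lambda>\<omega>. ?F (?V t \<omega>) - (\<Sum>d\<in>D. ?F (?W t d \<omega>))"
      have "\<bar>expectation ?H\<bar> \<le> expectation (\<lambda>\<omega>. \<bar>?H \<omega>\<bar>)" by (rule integral_abs_bound)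
      also have "\<dots> \<le> expectation (\<lambda>\<omega>. e * (\<Sum>d\<in>D. indicator (?E t d \<rho>) \<omega>) + K * ((\<Sum>d\<in>D. indicator (?E t d \<Lambda>) \<omega>)
        + (\<Sum>d\<in>D. \<Sum>d'\<in>D - {d}. indicator (?E t d \<delta> \<inter> ?E t d' \<delta>) \<omega>) + (\<Sum>d\<in>D. indicator (?N t d \<delta>) \<omega>)))"
        by (intro integral_mono bd elim integrable_abs Bochner_Integration.integrable_diff Bochner_Integration.integrable_sum iV iW
            Bochner_Integration.integrable_add integrable_mult_right ii Em Nm sets.Int) auto
      also have "\<dots> = e * (\<Sum>d\<in>D. prob (?E t d \<rho>)) + K * ((\<Sum>d\<in>D. prob (?E t d \<Lambda>))
        + (\<Sum>d\<in>D. \<Sum>d'\<in>D - {d}. prob (?E t d \<delta> \<inter> ?E t d' \<delta>)) + (\<Sum>d\<in>D. prob (?N t d \<delta>)))"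
      proof -
        have sm: "integrable M (\<lambda>\<omega>. \<Sum>d\<in>I. indicator (S d) \<omega> :: real)"
          "expectation (\<lambda>\<omega>. \<Sum>d\<in>I. indicator (S d) \<omega>) = (\<Sum>d\<in>I. prob (S d))"
          if "\<And>d. d \<in> I \<Longrightarrow> S d \<in> events" for I and S :: "'d \<Rightarrow> 'a set"
          using that ii by (auto intro!: Bochner_Integration.integrable_sum sum.cong simp: Bochner_Integration.integral_sum)
        have s3: "integrable M (\<lambda>\<omega>. \<Sum>d\<in>D. \<Sum>d'\<in>D - {d}. indicator (?E t d \<delta> \<inter> ?E t d' \<delta>) \<omega> :: real)"
          "expectation (\<lambda>\<omega>. \<Sum>d\<in>D. \<Sum>d'\<in>D - {d}. indicator (?E t d \<delta> \<inter> ?E t d' \<delta>) \<omega>)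
            = (\<Sum>d\<in>D. \<Sum>d'\<in>D - {d}. prob (?E t d \<delta> \<inter> ?E t d' \<delta>))"
        proof -
          have i: "integrable M (\<lambda>\<omega>. \<Sum>d'\<in>D - {d}. indicator (?E t d \<delta> \<inter> ?E t d' \<delta>) \<omega> :: real)"
            "expectation (\<lambda>\<omega>. \<Sum>d'\<in>D - {d}. indicator (?E t d \<delta> \<inter> ?E t d' \<delta>) \<omega>) = (\<Sum>d'\<in>D - {d}. prob (?E t d \<delta> \<inter> ?E t d' \<delta>))"
            if "d \<in> D" for d
            using Em that by (intro sm sets.Int; blast)+
          show "integrable M (\<lambda>\<omega>. \<Sum>d\<in>D. \<Sum>d'\<in>D - {d}. indicator (?E t d \<delta> \<inter> ?E t d' \<delta>) \<omega> :: real)"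
            by (intro Bochner_Integration.integrable_sum i)
          show "expectation (\<lambda>\<omega>. \<Sum>d\<in>D. \<Sum>d'\<in>D - {d}. indicator (?E t d \<delta> \<inter> ?E t d' \<delta>) \<omega>)
            = (\<Sum>d\<in>D. \<Sum>d'\<in>D - {d}. prob (?E t d \<delta> \<inter> ?E t d' \<delta>))"
            by (subst Bochner_Integration.integral_sum) (simp_all only: i cong: sum.cong)
        qed
        note s1 = sm[of D "\<lambda>d. ?E t d \<rho>", OF Em] and s2 = sm[of D "\<lambda>d. ?E t d \<Lambda>", OF Em] and s4 = sm[of D "\<lambda>d. ?N t d \<delta>", OF Nm]
        show ?thesis
          by (simp only: Bochner_Integration.integral_add Bochner_Integration.integrable_add
              integral_mult_right_zero integrable_mult_right s1 s2 s3 s4)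
      qed
      also have "(\<Sum>d\<in>D. \<Sum>d'\<in>D - {d}. prob (?E t d \<delta> \<inter> ?E t d' \<delta>)) = (\<Sum>d\<in>D. \<Sum>d'\<in>D - {d}. prob (?E t d \<delta>) * prob (?E t d' \<delta>))"
      proof (intro sum.cong refl)
        fix d d' assume d: "d \<in> D" "d' \<in> D - {d}"
        have "?E t d \<delta> \<inter> ?E t d' \<delta> = {\<omega>\<in>space M. U d \<omega> > b t * \<delta> \<and> U d' \<omega> > b t * \<delta>}" by auto
        then show "prob (?E t d \<delta> \<inter> ?E t d' \<delta>) = prob (?E t d \<delta>) * prob (?E t d' \<delta>)" using pair[of d d'] d by auto
      qed
      finally have "t * \<bar>expectation ?H\<bar> \<le> t * (e * (\<Sum>d\<in>D. prob (?E t d \<rho>)) + K * ((\<Sum>d\<in>D. prob (?E t d \<Lambda>))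
        + (\<Sum>d\<in>D. \<Sum>d'\<in>D - {d}. prob (?E t d \<delta>) * prob (?E t d' \<delta>)) + (\<Sum>d\<in>D. prob (?N t d \<delta>))))"
        using elim(3) by (intro mult_left_mono) auto
      also have "\<dots> = ?g t" by (simp add: distrib_left sum_distrib_left mult_ac)
      finally have "t * \<bar>expectation ?H\<bar> \<le> ?g t" .
      then have "t * \<bar>expectation ?H\<bar> < e0" using elim(1) by (rule order_le_less_trans)
      moreover have "expectation ?H = expectation (\<lambda>\<omega>. ?F (?V t \<omega>)) - (\<Sum>d\<in>D. expectation (\<lambda>\<omega>. ?F (?W t d \<omega>)))"
        using iV iW by simp
      then have "t * expectation (\<lambda>\<omega>. ?F (?V t \<omega>)) - (\<Sum>d\<in>D. t * expectation (\<lambda>\<omega>. ?F (?W t d \<omega>))) = t * expectation ?H"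
        by (simp only: right_diff_distrib sum_distrib_left)
      then have "dist (t * expectation (\<lambda>\<omega>. ?F (?V t \<omega>)) - (\<Sum>d\<in>D. t * expectation (\<lambda>\<omega>. ?F (?W t d \<omega>)))) 0 = t * \<bar>expectation ?H\<bar>"
        using elim(3) by (simp only: dist_real_def diff_0_right abs_mult abs_of_pos)
      ultimately show ?case by linarith
    qed
  qed
qed

lemma sum_radial_limit:
  fixes U :: "'d \<Rightarrow> 'a \<Rightarrow> real" and a Y :: "'d \<Rightarrow> 'a \<Rightarrow> real ^ 'p" and b :: "real \<Rightarrow> real"
  assumes D: "finite D" and \<iota>: "\<iota> > 0"
    and m: "\<And>d. d \<in> D \<Longrightarrow> U d \<in> borel_measurable M" "\<And>d. d \<in> D \<Longrightarrow> a d \<in> borel_measurable M"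
    and law: "\<And>d. d \<in> D \<Longrightarrow> distr M (borel \<Otimes>\<^sub>M borel) (\<lambda>\<omega>. (U d \<omega>, a d \<omega>)) = distr M borel (U d) \<Otimes>\<^sub>M distr M borel (a d)"
    and U: "\<And>d \<omega>. d \<in> D \<Longrightarrow> \<omega> \<in> space M \<Longrightarrow> 0 \<le> U d \<omega>"
    and tail: "\<And>d x. d \<in> D \<Longrightarrow> x > 0 \<Longrightarrow> ((\<lambda>t. t * prob {\<omega>\<in>space M. U d \<omega> > b t * x}) \<longlongrightarrow> x powr - \<iota>) at_top"
    and pair: "\<And>d d' x. d \<in> D \<Longrightarrow> d' \<in> D \<Longrightarrow> d \<noteq> d' \<Longrightarrow>
      prob {\<omega>\<in>space M. U d \<omega> > x \<and> U d' \<omega> > x} = prob {\<omega>\<in>space M. U d \<omega> > x} * prob {\<omega>\<in>space M. U d' \<omega> > x}"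
    and b: "\<forall>\<^sub>F t in at_top. b t > 0"
    and a: "\<And>d \<omega>. d \<in> D \<Longrightarrow> \<omega> \<in> space M \<Longrightarrow> a d \<omega> \<in> nonneg_orthant" "\<And>d \<omega>. d \<in> D \<Longrightarrow> \<omega> \<in> space M \<Longrightarrow> norm (a d \<omega>) \<le> 1"
    and Ym: "\<And>d. d \<in> D \<Longrightarrow> Y d \<in> borel_measurable M"
    and Yc: "\<And>d \<omega>. d \<in> D \<Longrightarrow> \<omega> \<in> space M \<Longrightarrow> Y d \<omega> \<in> nonneg_orthant"
    and neg: "\<And>d. d \<in> D \<Longrightarrow> tail_negligible b (\<lambda>\<omega>. norm (Y d \<omega> - U d \<omega> *\<^sub>R a d \<omega>))"
    and f: "f \<in> cone_test_functions nonneg_orthant {0}"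
  shows "((\<lambda>t. t * expectation (\<lambda>\<omega>. zero_outside (nonneg_orthant - {0}) f ((1 / b t) *\<^sub>R (\<Sum>d\<in>D. Y d \<omega>))))
    \<longlongrightarrow> (\<Sum>d\<in>D. \<integral>y. expectation (\<lambda>\<omega>. zero_outside (nonneg_orthant - {0}) f (y *\<^sub>R a d \<omega>)) \<partial>nu \<iota>)) at_top"
proof -
  have "((\<lambda>t. \<Sum>d\<in>D. t * expectation (\<lambda>\<omega>. zero_outside (nonneg_orthant - {0}) f ((U d \<omega> / b t) *\<^sub>R a d \<omega>)))
    \<longlongrightarrow> (\<Sum>d\<in>D. \<integral>y. expectation (\<lambda>\<omega>. zero_outside (nonneg_orthant - {0}) f (y *\<^sub>R a d \<omega>)) \<partial>nu \<iota>)) at_top"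
    by (intro tendsto_sum indep_radial_limit m law \<iota> U tail b a f)
  with one_big_jump[OF D \<iota> m(1) U tail pair b m(2) a Ym Yc neg f]
  show ?thesis using tendsto_add[of _ 0] by fastforce
qed

end


section \<open>Limits of the counts\<close>

lemma orthant_test_functionI:
  fixes f :: "real ^ 'p \<Rightarrow> real"
  assumes "continuous_on (nonneg_orthant - {0}) f" "bounded (f ` (nonneg_orthant - {0}))"
    and "\<And>x. x \<in> nonneg_orthant - {0} \<Longrightarrow> 0 \<le> f x"
    and r: "r > 0" "\<And>x. x \<in> nonneg_orthant - {0} \<Longrightarrow> norm x < r \<Longrightarrow> f x = 0"
  shows "f \<in> cone_test_functions nonneg_orthant {0}"
proof -
  have "{x \<in> nonneg_orthant - {0}. f x \<noteq> 0} \<subseteq> {x. r \<le> norm x}" using r(2) by (force simp: not_le[symmetric])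
  then have "closure {x \<in> nonneg_orthant - {0}. f x \<noteq> 0} \<subseteq> {x. r \<le> norm x}"
    by (intro closure_minimal closed_Collect_le continuous_intros)
  then have "bounded_away ((nonneg_orthant - {0}) \<inter> closure {x \<in> nonneg_orthant - {0}. f x \<noteq> 0}) {0}"
    unfolding bounded_away_def using r(1) by (intro exI[of _ r]) auto
  then show ?thesis unfolding cone_test_functions_def using assms(1-3) by blast
qed

text \<open>A constant factor in the scaling function can be moved into the test function; this
  carries the limit for \<open>b\<close> over to the scaling of the topics in (c).\<close>

lemma test_function_scale:
  fixes f :: "real ^ 'p \<Rightarrow> real"
  assumes f: "f \<in> cone_test_functions nonneg_orthant {0}" and s: "s > 0"
  shows "(\<lambda>x. f (s *\<^sub>R x)) \<in> cone_test_functions nonneg_orthant {0}"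
proof -
  obtain B r where r: "r > 0" "\<And>x. norm x < r \<Longrightarrow> zero_outside (nonneg_orthant - {0}) f x = 0"
    using orthant_test_functionE[OF f] by metis
  have sc: "s *\<^sub>R x \<in> nonneg_orthant - {0}" if "x \<in> nonneg_orthant - {0}" for x :: "real ^ 'p"
    using that s by (auto simp: nonneg_orthant_def)
  have fc: "continuous_on (nonneg_orthant - {0}) f" "bounded (f ` (nonneg_orthant - {0}))"
    "\<And>x. x \<in> nonneg_orthant - {0} \<Longrightarrow> 0 \<le> f x"
    using f by (auto simp: cone_test_functions_def)
  show ?thesis
  proof (rule orthant_test_functionI[where r = "r / s"])
    show "continuous_on (nonneg_orthant - {0}) (\<lambda>x. f (s *\<^sub>R x))"
      using sc by (intro continuous_on_compose2[OF fc(1)] continuous_intros) auto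
    show "bounded ((\<lambda>x. f (s *\<^sub>R x)) ` (nonneg_orthant - {0}))"
      using sc by (intro bounded_subset[OF fc(2)]) blast
    show "f (s *\<^sub>R x) = 0" if "x \<in> nonneg_orthant - {0}" "norm x < r / s" for x
      using r(2)[of "s *\<^sub>R x"] that sc[OF that(1)] s by (simp add: zero_outside_def field_simps)
  qed (use r s fc(3) sc in auto)
qed

lemma zero_outside_scale:
  assumes "s > 0"
  shows "zero_outside (nonneg_orthant - {0}) (\<lambda>x. f (s *\<^sub>R x)) x = zero_outside (nonneg_orthant - {0}) f (s *\<^sub>R (x :: real ^ 'p))"
  using assms by (auto simp: zero_outside_def nonneg_orthant_def zero_le_mult_iff)

lemma prob_simplex_cone: "p \<in> prob_simplex \<Longrightarrow> y > 0 \<Longrightarrow> y *\<^sub>R p \<in> nonneg_orthant - {0}"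
  by (auto simp: nonneg_orthant_def prob_simplex_def)

lemma measurable_test_function_ray:
  assumes f: "f \<in> cone_test_functions nonneg_orthant {0}" and y: "y > 0"
  shows "(\<lambda>p. f (y *\<^sub>R p)) \<in> borel_measurable (restrict_space borel (prob_simplex :: (real ^ 'p) set))"
proof (rule measurable_compose[OF _ borel_measurable_zero_outside(2)[OF f orthant_borel]])
  show "(\<lambda>p. y *\<^sub>R p) \<in> measurable (restrict_space borel (prob_simplex :: (real ^ 'p) set)) (restrict_space borel (nonneg_orthant - {0}))"
  proof (rule measurable_restrict_space2)
    show "(\<lambda>p. y *\<^sub>R p) \<in> space (restrict_space borel (prob_simplex :: (real ^ 'p) set)) \<rightarrow> nonneg_orthant - {0}"
      using prob_simplex_cone[OF _ y] by (intro funcsetI) (simp only: space_restrict_space Int_iff, blast)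
    show "(\<lambda>p. y *\<^sub>R p) \<in> borel_measurable (restrict_space borel (prob_simplex :: (real ^ 'p) set))"
      by (intro measurable_restrict_space1 borel_measurable_continuous_onI continuous_intros)
  qed
qed

lemma RV_cmult:
  assumes "b \<in> RV c" "s > 0"
  shows "(\<lambda>t. s * b t) \<in> RV c"
  using assms by (auto simp: RV_def)

lemma polar_convergence_cong:
  assumes "\<And>t \<omega>. \<omega> \<in> space M \<Longrightarrow> Y t \<omega> = Y' t \<omega>"
  shows "polar_convergence M Y \<mu> \<longleftrightarrow> polar_convergence M Y' \<mu>"
proof -
  have "distr M borel (Y t) = distr M borel (Y' t)" for t
    using assms by (intro distr_cong) auto
  then show ?thesis by (simp add: polar_convergence_def scaled_law_def)
qed

context prob_space begin

lemma measurable_simplex: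
  assumes "Y \<in> borel_measurable M" "\<And>\<omega>. \<omega> \<in> space M \<Longrightarrow> Y \<omega> \<in> prob_simplex"
  shows "Y \<in> measurable M (restrict_space borel prob_simplex)"
  using assms by (intro measurable_restrict_space2) auto

text \<open>The laws of the proportions are compared on the whole space. In this form the law on the
  simplex is seen to depend on that law alone, so identically distributed vectors share one limit
  measure.\<close>

lemma simplex_law_restrict:
  assumes Y: "Y \<in> borel_measurable M" "\<And>\<omega>. \<omega> \<in> space M \<Longrightarrow> Y \<omega> \<in> prob_simplex"
  shows "simplex_law M Y = restrict_space (distr M borel Y) prob_simplex"
proof (rule measure_eqI)
  show s: "sets (simplex_law M Y) = sets (restrict_space (distr M borel Y) prob_simplex)"
    unfolding simplex_law_def by (simp, intro sets_restrict_space_cong[symmetric]) simp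
  fix A assume A: "A \<in> sets (simplex_law M Y)"
  then have A': "A \<in> sets (restrict_space borel prob_simplex)" by (simp add: simplex_law_def)
  then have "A \<subseteq> prob_simplex" "A \<in> sets borel"
    using borel_closed[OF closed_prob_simplex] by (auto simp: sets_restrict_space)
  then have "emeasure (restrict_space (distr M borel Y) prob_simplex) A = emeasure (distr M borel Y) A"
    using borel_closed[OF closed_prob_simplex] by (intro emeasure_restrict_space) auto
  with \<open>A \<in> sets borel\<close> A' Y show "emeasure (simplex_law M Y) A = emeasure (restrict_space (distr M borel Y) prob_simplex) A"
    unfolding simplex_law_def by (simp add: emeasure_distr measurable_simplex)
qed

lemma radial_expectation:
  fixes a :: "'a \<Rightarrow> real ^ 'p"
  assumes f: "f \<in> cone_test_functions nonneg_orthant {0}" and \<iota>: "\<iota> > 0"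
    and a: "a \<in> borel_measurable M" "\<And>\<omega>. \<omega> \<in> space M \<Longrightarrow> a \<omega> \<in> prob_simplex"
  shows "(\<integral>y. expectation (\<lambda>\<omega>. f (y *\<^sub>R a \<omega>)) \<partial>nu \<iota>) = (\<integral>y. (\<integral>p. f (y *\<^sub>R p) \<partial>simplex_law M a) \<partial>nu \<iota>)"
    and "(\<integral>y. expectation (\<lambda>\<omega>. zero_outside (nonneg_orthant - {0}) f (y *\<^sub>R a \<omega>)) \<partial>nu \<iota>) = (\<integral>y. expectation (\<lambda>\<omega>. f (y *\<^sub>R a \<omega>)) \<partial>nu \<iota>)"
proof -
  show "(\<integral>y. expectation (\<lambda>\<omega>. f (y *\<^sub>R a \<omega>)) \<partial>nu \<iota>) = (\<integral>y. (\<integral>p. f (y *\<^sub>R p) \<partial>simplex_law M a) \<partial>nu \<iota>)"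
  proof (intro Bochner_Integration.integral_cong refl)
    fix y assume "y \<in> space (nu \<iota>)"
    then have "y > 0" by (simp add: nu_space[OF \<iota>])
    then show "expectation (\<lambda>\<omega>. f (y *\<^sub>R a \<omega>)) = (\<integral>p. f (y *\<^sub>R p) \<partial>simplex_law M a)"
      unfolding simplex_law_def by (intro integral_distr[symmetric] measurable_simplex a measurable_test_function_ray f)
  qed
  show "(\<integral>y. expectation (\<lambda>\<omega>. zero_outside (nonneg_orthant - {0}) f (y *\<^sub>R a \<omega>)) \<partial>nu \<iota>) = (\<integral>y. expectation (\<lambda>\<omega>. f (y *\<^sub>R a \<omega>)) \<partial>nu \<iota>)"
    using prob_simplex_cone[OF a(2)]
    by (intro Bochner_Integration.integral_cong refl) (auto simp: nu_space[OF \<iota>] zero_outside_def)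
qed

text \<open>Fubini puts the radial integral inside, where scaling by \<open>h \<omega>\<close>
  contributes \<open>h \<omega> powr \<iota>\<close>; the outer integral is then a moment.\<close>

lemma radial_moment:
  fixes h :: "'a \<Rightarrow> real" and p :: "real ^ 'p"
  assumes f: "f \<in> cone_test_functions nonneg_orthant {0}" and \<iota>: "\<iota> > 0"
    and h[measurable]: "h \<in> borel_measurable M" and h01: "\<And>\<omega>. \<omega> \<in> space M \<Longrightarrow> 0 \<le> h \<omega> \<and> h \<omega> \<le> 1"
    and p: "p \<in> prob_simplex"
  shows "(\<integral>y. expectation (\<lambda>\<omega>. zero_outside (nonneg_orthant - {0}) f (y *\<^sub>R (h \<omega> *\<^sub>R p))) \<partial>nu \<iota>)
       = expectation (\<lambda>\<omega>. h \<omega> powr \<iota>) * (\<integral>y. f (y *\<^sub>R p) \<partial>nu \<iota>)"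
proof -
  let ?F = "zero_outside (nonneg_orthant - {0}) f"
  obtain B r where B: "B \<ge> 0" "\<And>x. \<bar>?F x\<bar> \<le> B" and r: "r > 0" "\<And>x. norm x < r \<Longrightarrow> ?F x = 0"
    and Fm[measurable]: "?F \<in> borel_measurable borel"
    using orthant_test_functionE[OF f] by metis
  interpret N: sigma_finite_measure "nu \<iota>" by (rule sigma_finite_nu[OF \<iota>])
  interpret P: pair_sigma_finite M "nu \<iota>" ..
  note mn[measurable] = measurable_nu_ident[OF \<iota>]
  have half: "{r / 2<..} \<in> sets (nu \<iota>)"
    unfolding sets_nu[OF \<iota>] using r(1) by (auto simp: sets_restrict_space intro!: image_eqI[of _ _ "{r / 2<..}"])
  \<comment> \<open>With h and the norm of p at most 1, the argument is no longer than y, so the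
    integrand lives on y > r / 2, where the product has finite mass.\<close>
  have "integrable (M \<Otimes>\<^sub>M nu \<iota>) (\<lambda>(\<omega>, y). ?F (y *\<^sub>R (h \<omega> *\<^sub>R p)))"
  proof (rule integrableI_bounded_set[where A = "space M \<times> {r / 2<..}" and B = B])
    show "space M \<times> {r / 2<..} \<in> sets (M \<Otimes>\<^sub>M nu \<iota>)" using half by (intro pair_measureI) auto
    have "emeasure (M \<Otimes>\<^sub>M nu \<iota>) (space M \<times> {r / 2<..}) = emeasure M (space M) * emeasure (nu \<iota>) {r / 2<..}"
      using half by (intro N.emeasure_pair_measure_Times) auto
    then show "emeasure (M \<Otimes>\<^sub>M nu \<iota>) (space M \<times> {r / 2<..}) < \<infinity>"
      using r(1) by (simp add: emeasure_space_1 nu_tail[OF \<iota>])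
    show "(\<lambda>(\<omega>, y). ?F (y *\<^sub>R (h \<omega> *\<^sub>R p))) \<in> borel_measurable (M \<Otimes>\<^sub>M nu \<iota>)" by measurable
    show "AE z in M \<Otimes>\<^sub>M nu \<iota>. z \<in> space M \<times> {r / 2<..} \<longrightarrow> norm (case z of (\<omega>, y) \<Rightarrow> ?F (y *\<^sub>R (h \<omega> *\<^sub>R p))) \<le> B"
      using B by (intro AE_I2) (auto split: prod.split)
    show "AE z in M \<Otimes>\<^sub>M nu \<iota>. z \<notin> space M \<times> {r / 2<..} \<longrightarrow> (case z of (\<omega>, y) \<Rightarrow> ?F (y *\<^sub>R (h \<omega> *\<^sub>R p))) = 0"
    proof (intro AE_I2 impI)
      fix z assume zM: "z \<in> space (M \<Otimes>\<^sub>M nu \<iota>)" "z \<notin> space M \<times> {r / 2<..}"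
      obtain \<omega> y where "z = (\<omega>, y)" by (cases z)
      with zM have z: "z = (\<omega>, y)" "\<omega> \<in> space M" "0 < y" and "y \<le> r / 2"
        by (auto simp: space_pair_measure nu_space[OF \<iota>])
      then have "y < r" using r(1) by simp
      have "norm (y *\<^sub>R (h \<omega> *\<^sub>R p)) = y * (h \<omega> * norm p)" using z h01[OF z(2)] by simp
      also have "\<dots> \<le> y * (1 * 1)"
        using z h01[OF z(2)] norm_prob_simplex_le[OF p] by (intro mult_left_mono mult_mono) auto
      finally show "(case z of (\<omega>, y) \<Rightarrow> ?F (y *\<^sub>R (h \<omega> *\<^sub>R p))) = 0" using z \<open>y < r\<close> by (auto intro: r(2))
    qed
  qed
  then have "(\<integral>y. expectation (\<lambda>\<omega>. ?F (y *\<^sub>R (h \<omega> *\<^sub>R p))) \<partial>nu \<iota>) = expectation (\<lambda>\<omega>. \<integral>y. ?F (y *\<^sub>R (h \<omega> *\<^sub>R p)) \<partial>nu \<iota>)"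
    by (rule P.Fubini_integral)
  also have "\<dots> = expectation (\<lambda>\<omega>. h \<omega> powr \<iota> * (\<integral>y. ?F (y *\<^sub>R p) \<partial>nu \<iota>))"
  proof (intro Bochner_Integration.integral_cong refl)
    fix \<omega> assume \<omega>: "\<omega> \<in> space M"
    show "(\<integral>y. ?F (y *\<^sub>R (h \<omega> *\<^sub>R p)) \<partial>nu \<iota>) = h \<omega> powr \<iota> * (\<integral>y. ?F (y *\<^sub>R p) \<partial>nu \<iota>)"
    proof (cases "h \<omega> = 0")
      \<comment> \<open>Here the scaling argument fails, but the extension is 0 at the origin and so
        is \<open>0 powr \<iota>\<close>.\<close>
      case True
      then show ?thesis using r by simp
    next
      case False
      then have "h \<omega> > 0" using h01[OF \<omega>] by simp
      have "(\<lambda>y. ?F (y *\<^sub>R p)) \<in> borel_measurable (restrict_space borel {0<..})"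
        by (rule measurable_restrict_space1) measurable
      from integral_nu_scale[OF \<iota> \<open>h \<omega> > 0\<close> this] show ?thesis by (simp add: mult.commute)
    qed
  qed
  also have "\<dots> = expectation (\<lambda>\<omega>. h \<omega> powr \<iota>) * (\<integral>y. ?F (y *\<^sub>R p) \<partial>nu \<iota>)" by simp
  also have "(\<integral>y. ?F (y *\<^sub>R p) \<partial>nu \<iota>) = (\<integral>y. f (y *\<^sub>R p) \<partial>nu \<iota>)"
    using prob_simplex_cone[OF p] by (intro Bochner_Integration.integral_cong refl) (auto simp: nu_space[OF \<iota>] zero_outside_def)
  finally show ?thesis .
qed

end

context lda begin

text \<open>Independence of the two generated sigma-algebras is evaluated on cylinders over
  coordinate d; rectangles then determine the joint law.\<close>

lemma product_law:
  fixes g :: "real ^ 'k \<Rightarrow> real ^ 'p"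
  assumes [measurable]: "g \<in> borel_measurable borel"
  shows "distr M (borel \<Otimes>\<^sub>M borel) (\<lambda>\<omega>. (real (N d \<omega>), g (\<theta> d \<omega>))) = distr M borel (\<lambda>\<omega>. real (N d \<omega>)) \<Otimes>\<^sub>M distr M borel (\<lambda>\<omega>. g (\<theta> d \<omega>))"
proof (rule pair_measure_eqI[symmetric])
  show "sigma_finite_measure (distr M borel (\<lambda>\<omega>. real (N d \<omega>)))" "sigma_finite_measure (distr M borel (\<lambda>\<omega>. g (\<theta> d \<omega>)))"
    by (intro prob_space_imp_sigma_finite prob_space_distr; simp)+
  show "sets (distr M borel (\<lambda>\<omega>. real (N d \<omega>)) \<Otimes>\<^sub>M distr M borel (\<lambda>\<omega>. g (\<theta> d \<omega>))) = sets (distr M (borel \<Otimes>\<^sub>M borel) (\<lambda>\<omega>. (real (N d \<omega>), g (\<theta> d \<omega>))))"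
    unfolding sets_distr by (intro sets_pair_measure_cong) simp_all
  fix A B assume "A \<in> sets (distr M borel (\<lambda>\<omega>. real (N d \<omega>)))" "B \<in> sets (distr M borel (\<lambda>\<omega>. g (\<theta> d \<omega>)))"
  then have A[measurable]: "A \<in> sets borel" and B[measurable]: "B \<in> sets borel" by auto
  let ?A = "{\<omega>\<in>space M. real (N d \<omega>) \<in> A}" and ?B = "{\<omega>\<in>space M. g (\<theta> d \<omega>) \<in> B}"
  have "{v \<in> space (PiM UNIV (\<lambda>_. count_space UNIV)). real (v d) \<in> A} \<in> sets (PiM UNIV (\<lambda>_::'d. count_space (UNIV :: nat set)))"
    by measurable
  from in_vimage_algebra[OF this, of "\<lambda>\<omega> d. N d \<omega>" "space M"]
  have 1: "?A \<in> sets (vimage_algebra (space M) (\<lambda>\<omega> d. N d \<omega>) (PiM UNIV (\<lambda>_. count_space UNIV)))"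
    by (rule back_subst[where P = "\<lambda>S. S \<in> _"]) (auto simp: space_PiM)
  have "{v \<in> space (PiM UNIV (\<lambda>_. borel)). g (v d) \<in> B} \<in> sets (PiM UNIV (\<lambda>_::'d. borel :: (real ^ 'k) measure))"
    by measurable
  from in_vimage_algebra[OF this, of "\<lambda>\<omega> d. \<theta> d \<omega>" "space M"]
  have 2: "?B \<in> sets (vimage_algebra (space M) (\<lambda>\<omega> d. \<theta> d \<omega>) (PiM UNIV (\<lambda>_. borel)))"
    by (rule back_subst[where P = "\<lambda>S. S \<in> _"]) (auto simp: space_PiM)
  have "prob (?A \<inter> ?B) = prob ?A * prob ?B"
    using lengths_indep_proportions 1 2 unfolding indep_sets2_eq by blast
  moreover have "(\<lambda>\<omega>. (real (N d \<omega>), g (\<theta> d \<omega>))) -` (A \<times> B) \<inter> space M = ?A \<inter> ?B"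
    "(\<lambda>\<omega>. real (N d \<omega>)) -` A \<inter> space M = ?A" "(\<lambda>\<omega>. g (\<theta> d \<omega>)) -` B \<inter> space M = ?B" by auto
  ultimately show "emeasure (distr M borel (\<lambda>\<omega>. real (N d \<omega>))) A * emeasure (distr M borel (\<lambda>\<omega>. g (\<theta> d \<omega>))) B
      = emeasure (distr M (borel \<Otimes>\<^sub>M borel) (\<lambda>\<omega>. (real (N d \<omega>), g (\<theta> d \<omega>)))) (A \<times> B)"
    by (simp add: emeasure_distr pair_measureI emeasure_eq_measure ennreal_mult'[symmetric])
qed

lemma lengths_pair_indep:
  assumes ind: "indep_vars (\<lambda>_. count_space UNIV) N UNIV" and d: "d \<noteq> d'"
  shows "prob {\<omega>\<in>space M. real (N d \<omega>) > x \<and> real (N d' \<omega>) > x}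
       = prob {\<omega>\<in>space M. real (N d \<omega>) > x} * prob {\<omega>\<in>space M. real (N d' \<omega>) > x}"
proof -
  have "prob (\<Inter>i\<in>{d, d'}. N i -` {n. real n > x} \<inter> space M) = (\<Prod>i\<in>{d, d'}. prob (N i -` {n. real n > x} \<inter> space M))"
    by (rule indep_varsD[OF ind]) auto
  moreover have "(\<Inter>i\<in>{d, d'}. N i -` {n. real n > x} \<inter> space M) = {\<omega>\<in>space M. real (N d \<omega>) > x \<and> real (N d' \<omega>) > x}"
    "N i -` {n. real n > x} \<inter> space M = {\<omega>\<in>space M. real (N i \<omega>) > x}" for i by auto
  ultimately show ?thesis using d by simp
qed

text \<open>Each position of the document falls into exactly one cell (w, k).\<close>

lemma sum_token_count: "(\<Sum>w\<in>UNIV. \<Sum>k\<in>UNIV. real (token_count N X Z d k w \<omega>)) = real (N d \<omega>)"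
proof -
  have "token_count N X Z d k w \<omega> = (\<Sum>i\<in>{1..N d \<omega>}. if X d i \<omega> = w \<and> Z d i \<omega> = k then 1 else 0)" for k w
    by (simp add: token_count_def sum.If_cases Int_def)
  then have "(\<Sum>w\<in>UNIV. \<Sum>k\<in>UNIV. token_count N X Z d k w \<omega>)
      = (\<Sum>w\<in>UNIV. \<Sum>i\<in>{1..N d \<omega>}. \<Sum>k\<in>UNIV. if X d i \<omega> = w \<and> Z d i \<omega> = k then 1 else 0)"
    by (simp only:) (intro sum.cong refl sum.swap)
  also have "\<dots> = (\<Sum>w\<in>UNIV. \<Sum>i\<in>{1..N d \<omega>}. if X d i \<omega> = w then 1 else 0)"
    by (intro sum.cong refl) auto
  also have "\<dots> = (\<Sum>i\<in>{1..N d \<omega>}. \<Sum>w\<in>UNIV. if X d i \<omega> = w then 1 else 0)" by (rule sum.swap)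
  also have "\<dots> = N d \<omega>" by simp
  finally have "real (\<Sum>w\<in>UNIV. \<Sum>k\<in>UNIV. token_count N X Z d k w \<omega>) = real (N d \<omega>)" by (rule arg_cong)
  then show ?thesis by simp
qed

section \<open>Limits under the tail assumption on the lengths\<close>

context
  fixes \<iota> :: real and b :: "real \<Rightarrow> real"
  assumes \<iota>: "\<iota> > 0" and scaling: "b \<in> RV (1 / \<iota>)"
    and lengths_tail: "\<forall>d. \<forall>x>0. ((\<lambda>t. t * prob {\<omega>\<in>space M. real (N d \<omega>) > b t * x}) \<longlongrightarrow> x powr - \<iota>) at_top"
begin

lemma length_tail: "x > 0 \<Longrightarrow> ((\<lambda>t. t * prob {\<omega>\<in>space M. real (N d \<omega>) > b t * x}) \<longlongrightarrow> x powr - \<iota>) at_top"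
  using lengths_tail by blast

lemma scaling_pos: "\<forall>\<^sub>F t in at_top. b t > 0"
  by (rule RV_eventually_pos[OF scaling])

text \<open>Lengths are at least 1, so b(t) < m would give P(N > b(t) x) = 1 at x = 1 / (2 m),
  whereas convergence of t P(N > b(t) x) forces this probability to 0.\<close>

lemma scaling_at_top: "filterlim b at_top at_top"
  unfolding filterlim_at_top_gt[where c = 0]
proof (intro allI impI)
  fix m :: real assume m: "m > 0"
  \<comment> \<open>Any document serves; the index type is inhabited.\<close>
  fix d :: 'd
  let ?x = "1 / (2 * m)"
  have "((\<lambda>t. (t * prob {\<omega>\<in>space M. real (N d \<omega>) > b t * ?x}) * inverse t) \<longlongrightarrow> ?x powr - \<iota> * 0) at_top"
    using m by (intro tendsto_mult length_tail tendsto_inverse_0_at_top filterlim_ident) simp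
  then have "\<forall>\<^sub>F t in at_top. (t * prob {\<omega>\<in>space M. real (N d \<omega>) > b t * ?x}) * inverse t < 1"
    by (rule order_tendstoD(2)) simp
  then show "\<forall>\<^sub>F t in at_top. m \<le> b t"
    using eventually_gt_at_top[of 0]
  proof eventually_elim
    case (elim t)
    show ?case
    proof (rule ccontr)
      assume "\<not> m \<le> b t"
      then have "b t * ?x \<le> 1 / 2" using m by (simp add: field_simps)
      then have "{\<omega>\<in>space M. real (N d \<omega>) > b t * ?x} = space M" using N_pos[of _ d] by force
      then show False using elim by (simp add: prob_space)
    qed
  qed
qed

text \<open>The deviation is at most N, so it exceeds \<epsilon> b(t) only if N does. Then either N
  > \<Lambda> b(t), of limiting weight \<Lambda>^-\<iota>, or the deviation exceeds (\<epsilon> /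
  \<Lambda>) N; the relative Chebyshev bound with m = \<epsilon> b(t) makes the latter smaller by a
  factor of order 1 / b(t).\<close>

lemma token_count_negligible:
  "tail_negligible b (\<lambda>\<omega>. real (token_count N X Z d k w \<omega>) - real (N d \<omega>) * (\<theta> d \<omega> $ k * \<phi> k $ w))"
  unfolding tail_negligible_def
proof (intro conjI allI impI)
  let ?R = "\<lambda>\<omega>. \<bar>real (token_count N X Z d k w \<omega>) - real (N d \<omega>) * (\<theta> d \<omega> $ k * \<phi> k $ w)\<bar>"
  let ?T = "\<lambda>t x. {\<omega>\<in>space M. real (N d \<omega>) > b t * x}"
  show "(\<lambda>\<omega>. real (token_count N X Z d k w \<omega>) - real (N d \<omega>) * (\<theta> d \<omega> $ k * \<phi> k $ w)) \<in> borel_measurable M"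
    by measurable
  fix \<epsilon> :: real assume \<epsilon>: "\<epsilon> > 0"
  have RN: "?R \<omega> \<le> real (N d \<omega>)" if "\<omega> \<in> space M" for \<omega>
  proof -
    have "0 \<le> \<theta> d \<omega> $ k * \<phi> k $ w" "\<theta> d \<omega> $ k * \<phi> k $ w \<le> 1"
      using prob_simplex_le_1[OF theta_simplex[OF that]] prob_simplex_le_1[OF topics] by (auto intro: mult_le_one)
    then have "0 \<le> real (N d \<omega>) * (\<theta> d \<omega> $ k * \<phi> k $ w)" "real (N d \<omega>) * (\<theta> d \<omega> $ k * \<phi> k $ w) \<le> real (N d \<omega>) * 1"
      by (auto intro!: mult_left_mono simp del: mult_1_right)
    then show ?thesis using token_count_le[of d k w \<omega>] by linarith
  qed
  show "((\<lambda>t. t * prob {\<omega>\<in>space M. ?R \<omega> > \<epsilon> * b t}) \<longlongrightarrow> 0) at_top"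
  proof (rule tendstoI)
    fix \<eta> :: real assume \<eta>: "\<eta> > 0"
    have "((\<lambda>\<Lambda>. \<Lambda> powr - \<iota>) \<longlongrightarrow> 0) at_top" using \<iota> by (intro tendsto_neg_powr filterlim_ident) simp
    then have "\<forall>\<^sub>F \<Lambda> in at_top. \<Lambda> powr - \<iota> < \<eta>" using \<eta> by (rule order_tendstoD(2))
    then have "\<forall>\<^sub>F \<Lambda> in at_top. \<Lambda> powr - \<iota> < \<eta> \<and> \<Lambda> > 0" using eventually_gt_at_top[of 0] by eventually_elim simp
    then obtain \<Lambda> where \<Lambda>: "\<Lambda> powr - \<iota> < \<eta>" "\<Lambda> > 0" using eventually_happens[of _ "at_top :: real filter"] by auto
    let ?g = "\<lambda>t. t * prob (?T t \<Lambda>) + (t * prob (?T t \<epsilon>)) * (inverse (b t) * (1 / ((\<epsilon> / \<Lambda>)\<^sup>2 * \<epsilon>)))"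
    have "(?g \<longlongrightarrow> \<Lambda> powr - \<iota> + \<epsilon> powr - \<iota> * (0 * (1 / ((\<epsilon> / \<Lambda>)\<^sup>2 * \<epsilon>)))) at_top"
      using \<epsilon> \<Lambda> by (intro tendsto_add tendsto_mult length_tail tendsto_const tendsto_inverse_0_at_top scaling_at_top)
    then have "\<forall>\<^sub>F t in at_top. ?g t < \<eta>" by (rule order_tendstoD(2)) (use \<Lambda> in simp)
    then show "\<forall>\<^sub>F t in at_top. dist (t * prob {\<omega>\<in>space M. ?R \<omega> > \<epsilon> * b t}) 0 < \<eta>"
      using scaling_pos eventually_gt_at_top[of 0]
    proof eventually_elim
      case (elim t)
      let ?S = "{\<omega>\<in>space M. real (N d \<omega>) > b t * \<epsilon> \<and> ?R \<omega> > (\<epsilon> / \<Lambda>) * real (N d \<omega>)}"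
      have "{\<omega>\<in>space M. ?R \<omega> > \<epsilon> * b t} \<subseteq> ?T t \<Lambda> \<union> ?S"
      proof (rule subsetI)
        fix \<omega> assume "\<omega> \<in> {\<omega>\<in>space M. ?R \<omega> > \<epsilon> * b t}"
        then have \<omega>: "\<omega> \<in> space M" "?R \<omega> > \<epsilon> * b t" by auto
        have "\<omega> \<in> ?S" if "real (N d \<omega>) \<le> b t * \<Lambda>"
        proof -
          have "(\<epsilon> / \<Lambda>) * real (N d \<omega>) \<le> (\<epsilon> / \<Lambda>) * (b t * \<Lambda>)" using that \<epsilon> \<Lambda> by (intro mult_left_mono) auto
          also have "\<dots> = \<epsilon> * b t" using \<Lambda> by simp
          finally show ?thesis using \<omega> RN[OF \<omega>(1)] by (auto simp: mult.commute)
        qed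
        then show "\<omega> \<in> ?T t \<Lambda> \<union> ?S" using \<omega>(1) by auto
      qed
      then have "prob {\<omega>\<in>space M. ?R \<omega> > \<epsilon> * b t} \<le> prob (?T t \<Lambda> \<union> ?S)" by (intro finite_measure_mono) measurable
      also have "\<dots> \<le> prob (?T t \<Lambda>) + prob ?S" by (intro measure_Un_le) measurable
      also have "prob ?S \<le> prob (?T t \<epsilon>) / ((\<epsilon> / \<Lambda>)\<^sup>2 * (b t * \<epsilon>))"
        using \<epsilon> \<Lambda> elim by (intro token_count_deviation) auto
      finally have "t * prob {\<omega>\<in>space M. ?R \<omega> > \<epsilon> * b t} \<le> t * (prob (?T t \<Lambda>) + prob (?T t \<epsilon>) / ((\<epsilon> / \<Lambda>)\<^sup>2 * (b t * \<epsilon>)))"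
        using elim by (intro mult_left_mono) auto
      also have "\<dots> = ?g t" by (simp add: field_simps)
      finally show ?case using elim by (simp add: dist_real_def)
    qed
  qed
qed

text \<open>\<open>J i\<close> lists the cells (topic, word) whose counts make up entry i of
  \<open>Y d\<close>. Negligible errors in the cells give a negligible vector error, since the norm
  is at most the sum of absolute entries.\<close>

lemma counts_limit:
  fixes g :: "real ^ 'k \<Rightarrow> real ^ 'p" and Y :: "'d \<Rightarrow> 'a \<Rightarrow> real ^ 'p" and D :: "'d set"
  assumes ind: "indep_vars (\<lambda>_. count_space UNIV) N UNIV"
    and g: "g \<in> borel_measurable borel" "\<And>d \<omega>. \<omega> \<in> space M \<Longrightarrow> g (\<theta> d \<omega>) \<in> nonneg_orthant" "\<And>d \<omega>. \<omega> \<in> space M \<Longrightarrow> norm (g (\<theta> d \<omega>)) \<le> 1"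
    and Y: "\<And>d. Y d \<in> borel_measurable M" "\<And>d \<omega>. Y d \<omega> \<in> nonneg_orthant"
    and J: "\<And>i. finite (J i)" and le: "\<And>d i \<omega>. \<omega> \<in> space M \<Longrightarrow> \<bar>Y d \<omega> $ i - real (N d \<omega>) * g (\<theta> d \<omega>) $ i\<bar>
       \<le> (\<Sum>(k, w)\<in>J i. \<bar>real (token_count N X Z d k w \<omega>) - real (N d \<omega>) * (\<theta> d \<omega> $ k * \<phi> k $ w)\<bar>)"
    and f: "f \<in> cone_test_functions nonneg_orthant {0}"
  shows "((\<lambda>t. t * expectation (\<lambda>\<omega>. zero_outside (nonneg_orthant - {0}) f ((1 / b t) *\<^sub>R (\<Sum>d\<in>D. Y d \<omega>))))
    \<longlongrightarrow> (\<Sum>d\<in>D. \<integral>y. expectation (\<lambda>\<omega>. zero_outside (nonneg_orthant - {0}) f (y *\<^sub>R g (\<theta> d \<omega>))) \<partial>nu \<iota>)) at_top"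
proof (rule sum_radial_limit[OF _ \<iota> _ _ product_law _ length_tail lengths_pair_indep[OF ind] scaling_pos])
  fix d
  have [measurable]: "(\<lambda>\<omega>. g (\<theta> d \<omega>)) \<in> borel_measurable M" using g(1) by measurable
  note [measurable] = Y(1)
  show "(\<lambda>\<omega>. g (\<theta> d \<omega>)) \<in> borel_measurable M" by measurable
  show "tail_negligible b (\<lambda>\<omega>. norm (Y d \<omega> - real (N d \<omega>) *\<^sub>R g (\<theta> d \<omega>)))"
  proof (rule tail_negligible_dominated[where J = "Sigma UNIV J" and r = "\<lambda>(i, k, w) \<omega>. real (token_count N X Z d k w \<omega>) - real (N d \<omega>) * (\<theta> d \<omega> $ k * \<phi> k $ w)"])
    show "finite (Sigma UNIV J)" using J by auto
    show "tail_negligible b ((\<lambda>(i, k, w) \<omega>. real (token_count N X Z d k w \<omega>) - real (N d \<omega>) * (\<theta> d \<omega> $ k * \<phi> k $ w)) j)"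
      if "j \<in> Sigma UNIV J" for j
      using token_count_negligible by (auto split: prod.split)
    fix \<omega> assume \<omega>: "\<omega> \<in> space M"
    have "norm (Y d \<omega> - real (N d \<omega>) *\<^sub>R g (\<theta> d \<omega>)) \<le> (\<Sum>i\<in>UNIV. \<bar>(Y d \<omega> - real (N d \<omega>) *\<^sub>R g (\<theta> d \<omega>)) $ i\<bar>)"
      by (rule norm_le_l1_cart)
    also have "\<dots> \<le> (\<Sum>i\<in>UNIV. \<Sum>(k, w)\<in>J i. \<bar>real (token_count N X Z d k w \<omega>) - real (N d \<omega>) * (\<theta> d \<omega> $ k * \<phi> k $ w)\<bar>)"
      using le[OF \<omega>] by (intro sum_mono) simp
    also have "\<dots> = (\<Sum>j\<in>Sigma UNIV J. \<bar>(\<lambda>(i, k, w) \<omega>. real (token_count N X Z d k w \<omega>) - real (N d \<omega>) * (\<theta> d \<omega> $ k * \<phi> k $ w)) j \<omega>\<bar>)"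
      using J by (subst sum.Sigma) (auto simp: case_prod_beta)
    finally show "\<bar>norm (Y d \<omega> - real (N d \<omega>) *\<^sub>R g (\<theta> d \<omega>))\<bar> \<le> (\<Sum>j\<in>Sigma UNIV J. \<bar>(\<lambda>(i, k, w) \<omega>. real (token_count N X Z d k w \<omega>) - real (N d \<omega>) * (\<theta> d \<omega> $ k * \<phi> k $ w)) j \<omega>\<bar>)"
      by simp
  qed (use scaling_pos in auto)
qed (use g Y f in auto)

text \<open>Serves words, with g the multiplication by the topic matrix, and topics, with g the
  identity. One limit measure fits all documents because the proportions are identically
  distributed.\<close>

lemma document_counts_limits:
  fixes g :: "real ^ 'k \<Rightarrow> real ^ 'p" and Y :: "'d \<Rightarrow> 'a \<Rightarrow> real ^ 'p"
  assumes ind: "indep_vars (\<lambda>_. count_space UNIV) N UNIV"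
    and law: "\<And>d. distr M borel (\<theta> d) = T"
    and g: "g \<in> borel_measurable borel" "\<And>d \<omega>. \<omega> \<in> space M \<Longrightarrow> g (\<theta> d \<omega>) \<in> prob_simplex"
    and Y: "\<And>d. Y d \<in> borel_measurable M" "\<And>d \<omega>. Y d \<omega> \<in> nonneg_orthant"
    and total: "\<And>d \<omega>. (\<Sum>i\<in>UNIV. Y d \<omega> $ i) = real (N d \<omega>)"
    and J: "\<And>i. finite (J i)" and le: "\<And>d i \<omega>. \<bar>Y d \<omega> $ i - real (N d \<omega>) * g (\<theta> d \<omega>) $ i\<bar>
       \<le> (\<Sum>(k, w)\<in>J i. \<bar>real (token_count N X Z d k w \<omega>) - real (N d \<omega>) * (\<theta> d \<omega> $ k * \<phi> k $ w)\<bar>)"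
  shows "\<exists>\<mu>\<in>cone_measures nonneg_orthant {0}.
      (\<forall>d. MRV M (Y d) \<iota> b \<mu>) \<and>
      (\<forall>d. \<forall>f\<in>cone_test_functions nonneg_orthant {0}.
         (\<integral>x. f x \<partial>\<mu>) = (\<integral>y. (\<integral>\<omega>. f (y *\<^sub>R g (\<theta> d \<omega>)) \<partial>M) \<partial>nu \<iota>))" (is ?A)
    and "polar_convergence M
         (\<lambda>t \<omega>. (\<chi> i. Y d \<omega> $ i / real (N d \<omega>), real (N d \<omega>) / b t))
         (simplex_law M (\<lambda>\<omega>. g (\<theta> d \<omega>)) \<Otimes>\<^sub>M nu \<iota>)" (is ?B)
proof -
  define Q where "Q = (\<lambda>d. simplex_law M (\<lambda>\<omega>. g (\<theta> d \<omega>)))"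
  have gm: "(\<lambda>\<omega>. g (\<theta> d \<omega>)) \<in> borel_measurable M" for d
    by (rule measurable_compose[OF theta_measurable g(1)])
  have Q: "prob_space (Q d)" "sets (Q d) = sets (restrict_space borel prob_simplex)" for d
    unfolding Q_def simplex_law_def by (simp_all add: prob_space_distr measurable_simplex gm g(2))
  have Qeq: "Q d = Q d'" for d d'
  proof -
    have "distr M borel (\<lambda>\<omega>. g (\<theta> d \<omega>)) = distr T borel g" for d
      unfolding law[of d, symmetric] using g(1) by (simp add: distr_distr o_def)
    then show ?thesis unfolding Q_def by (simp add: simplex_law_restrict gm g(2))
  qed
  have conv: "((\<lambda>t. t * expectation (\<lambda>\<omega>. zero_outside (nonneg_orthant - {0}) f ((1 / b t) *\<^sub>R Y d \<omega>)))
       \<longlongrightarrow> (\<integral>y. (\<integral>p. f (y *\<^sub>R p) \<partial>Q d) \<partial>nu \<iota>)) at_top"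
    if f: "f \<in> cone_test_functions nonneg_orthant {0}" for d f
  proof -
    have "g (\<theta> d \<omega>) \<in> nonneg_orthant" if "\<omega> \<in> space M" for d \<omega>
      using g(2)[OF that] by (simp add: prob_simplex_def nonneg_orthant_def)
    \<comment> \<open>A single document is the sum over a singleton.\<close>
    from counts_limit[where D = "{d}", OF ind g(1) this norm_prob_simplex_le[OF g(2)] Y J le f]
    show ?thesis
      unfolding Q_def using radial_expectation[OF f \<iota> gm g(2)] by simp
  qed
  note MP = MRV_polarI[OF Y \<iota> scaling Q conv]
  fix d0 :: 'd
  show ?A
  proof (intro bexI conjI allI ballI)
    show "radial_measure (Q d0) \<iota> \<in> cone_measures nonneg_orthant {0}"
      by (rule radial_measure_in_cone_measures[OF Q \<iota>])
    show "MRV M (Y d) \<iota> b (radial_measure (Q d0) \<iota>)" for d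
      unfolding Qeq[of d0 d] by (rule MP(1))
    show "integral\<^sup>L (radial_measure (Q d0) \<iota>) f = (\<integral>y. (\<integral>\<omega>. f (y *\<^sub>R g (\<theta> d \<omega>)) \<partial>M) \<partial>nu \<iota>)"
      if f: "f \<in> cone_test_functions nonneg_orthant {0}" for d f
      unfolding Qeq[of d0 d] radial_integral[OF Q \<iota> f] unfolding Q_def
      by (rule radial_expectation(1)[OF f \<iota> gm g(2), symmetric])
  qed
  show ?B
  proof -
    \<comment> \<open>\<open>undefined\<close> fills the place of the conventional value, which
      never occurs since lengths are positive.\<close>
    have "(\<chi> i. Y d \<omega> $ i / real (N d \<omega>)) = proportions undefined (\<Sum>i\<in>UNIV. Y d \<omega> $ i) (Y d \<omega>)" if "\<omega> \<in> space M" for \<omega>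
      using N_pos[OF that, of d] by (auto simp: proportions_def total)
    then have "polar_convergence M (\<lambda>t \<omega>. (\<chi> i. Y d \<omega> $ i / real (N d \<omega>), real (N d \<omega>) / b t)) (Q d \<Otimes>\<^sub>M nu \<iota>) \<longleftrightarrow>
        polar_convergence M (\<lambda>t \<omega>. (proportions undefined (\<Sum>i\<in>UNIV. Y d \<omega> $ i) (Y d \<omega>), (\<Sum>i\<in>UNIV. Y d \<omega> $ i) / b t)) (Q d \<Otimes>\<^sub>M nu \<iota>)"
      by (intro polar_convergence_cong) (simp add: total)
    with MP(2) show ?thesis unfolding Q_def by blast
  qed
qed

end

end

theorem theorem1:
  fixes M :: "'a measure"
    and \<phi> :: "'k::finite \<Rightarrow> real ^ 'w::finite"
    and N :: "'d::finite \<Rightarrow> 'a \<Rightarrow> nat"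
    and \<theta> :: "'d \<Rightarrow> 'a \<Rightarrow> real ^ 'k"
    and X :: "'d \<Rightarrow> nat \<Rightarrow> 'a \<Rightarrow> 'w"
    and Z :: "'d \<Rightarrow> nat \<Rightarrow> 'a \<Rightarrow> 'k"
    and \<alpha> :: "'k \<Rightarrow> real"
    and \<iota> :: real
    and b :: "real \<Rightarrow> real"
    and L :: "nat measure"
  defines "\<Phi> \<equiv> topic_matrix \<phi>"
    and "\<alpha>\<^sub>0 \<equiv> (\<Sum>k\<in>UNIV. \<alpha> k)"
  defines "b' \<equiv> (\<lambda>k t. (real CARD('d) * (Beta (\<alpha> k + \<iota>) (\<alpha>\<^sub>0 - \<alpha> k) / Beta (\<alpha> k) (\<alpha>\<^sub>0 - \<alpha> k)))
                          powr (1 / \<iota>) * b t)"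
  assumes model: "lda M \<phi> N \<theta> X Z"
    and alpha: "\<And>k. \<alpha> k > 0"
    and iota: "\<iota> > 0"
    and scaling: "b \<in> RV (1 / \<iota>)"
    and N_indep: "prob_space.indep_vars M (\<lambda>_. count_space UNIV) N UNIV"
    and N_law: "\<And>d. distr M (count_space UNIV) (N d) = L"
    and N_tail: "\<And>x. x > 0 \<Longrightarrow>
      ((\<lambda>t. t * measure L {n. real n > b t * x}) \<longlongrightarrow> x powr - \<iota>) at_top"
    and theta_indep: "prob_space.indep_vars M (\<lambda>_. borel) \<theta> UNIV"
    and theta_law: "\<And>d. distr M borel (\<theta> d) = dirichlet \<alpha>"
  shows
    "((\<exists>\<mu>\<in>cone_measures nonneg_orthant {0}.
         (\<forall>d. MRV M (doc_word_counts N X Z d) \<iota> b \<mu>) \<and>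
         (\<forall>d. \<forall>f\<in>cone_test_functions nonneg_orthant {0}.
            (\<integral>x. f x \<partial>\<mu>) = (\<integral>y. (\<integral>\<omega>. f (y *\<^sub>R (\<Phi> *v \<theta> d \<omega>)) \<partial>M) \<partial>nu \<iota>))) \<and>
      (\<forall>d. polar_convergence M
             (\<lambda>t \<omega>. (\<chi> w. doc_word_counts N X Z d \<omega> $ w / real (N d \<omega>), real (N d \<omega>) / b t))
             (simplex_law M (\<lambda>\<omega>. \<Phi> *v \<theta> d \<omega>) \<Otimes>\<^sub>M nu \<iota>))) \<and>
     ((\<exists>\<eta>\<in>cone_measures nonneg_orthant {0}.
         (\<forall>d. MRV M (doc_topic_counts N X Z d) \<iota> b \<eta>) \<and>
         (\<forall>d. \<forall>f\<in>cone_test_functions nonneg_orthant {0}.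
            (\<integral>x. f x \<partial>\<eta>) = (\<integral>y. (\<integral>\<omega>. f (y *\<^sub>R \<theta> d \<omega>) \<partial>M) \<partial>nu \<iota>))) \<and>
      (\<forall>d. polar_convergence M
             (\<lambda>t \<omega>. (\<chi> k. doc_topic_counts N X Z d \<omega> $ k / real (N d \<omega>), real (N d \<omega>) / b t))
             (simplex_law M (\<theta> d) \<Otimes>\<^sub>M nu \<iota>))) \<and>
     (\<forall>k. (\<exists>\<upsilon>\<in>cone_measures nonneg_orthant {0}.
             MRV M (topic_word_counts N X Z k) \<iota> (b' k) \<upsilon> \<and>
             (\<forall>f\<in>cone_test_functions nonneg_orthant {0}.
                (\<integral>x. f x \<partial>\<upsilon>) = (\<integral>y. f (y *\<^sub>R \<phi> k) \<partial>nu \<iota>))) \<and>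
          (\<forall>q\<in>prob_simplex. polar_convergence M
             (\<lambda>t \<omega>. (proportions q (topic_total N X Z k \<omega>) (topic_word_counts N X Z k \<omega>),
                      topic_total N X Z k \<omega> / b' k t))
             (return (restrict_space borel prob_simplex) (\<phi> k) \<Otimes>\<^sub>M nu \<iota>)))"
proof -
  interpret lda M \<phi> N \<theta> X Z by (rule model)
  have tail: "\<forall>d. \<forall>x>0. ((\<lambda>t. t * prob {\<omega>\<in>space M. real (N d \<omega>) > b t * x}) \<longlongrightarrow> x powr - \<iota>) at_top"
  proof (intro allI impI)
    fix d and x :: real assume "x > 0"
    have "measure L {n. real n > b t * x} = prob {\<omega>\<in>space M. real (N d \<omega>) > b t * x}" for t
      unfolding N_law[of d, symmetric]
      by (subst measure_distr) (auto intro!: arg_cong2[where f = measure])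
    then show "((\<lambda>t. t * prob {\<omega>\<in>space M. real (N d \<omega>) > b t * x}) \<longlongrightarrow> x powr - \<iota>) at_top"
      using N_tail[OF \<open>x > 0\<close>] by simp
  qed
  note limit = counts_limit[OF iota scaling tail N_indep]

  let ?C = "\<lambda>d k w \<omega>. real (token_count N X Z d k w \<omega>)"
  have Cm: "?C d k w \<in> borel_measurable M" for d k w by measurable

  have word_simplex: "\<Phi> *v \<theta> d \<omega> \<in> prob_simplex" if "\<omega> \<in> space M" for d \<omega>
  proof -
    note th = theta_simplex[OF that, of d]
    have "(\<Sum>w\<in>UNIV. (\<Phi> *v \<theta> d \<omega>) $ w) = (\<Sum>k\<in>UNIV. (\<Sum>w\<in>UNIV. \<phi> k $ w) * \<theta> d \<omega> $ k)"
      unfolding matrix_vector_mult_def \<Phi>_def topic_matrix_def by (simp add: sum_distrib_right) (rule sum.swap)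
    also have "\<dots> = 1" using topics th by (simp add: prob_simplex_def)
    finally have s: "(\<Sum>w\<in>UNIV. (\<Phi> *v \<theta> d \<omega>) $ w) = 1" .
    have "0 \<le> (\<Phi> *v \<theta> d \<omega>) $ w" for w
      unfolding matrix_vector_mult_def \<Phi>_def topic_matrix_def
      using prob_simplex_le_1[OF th] prob_simplex_le_1[OF topics] by (auto intro!: sum_nonneg)
    with s show ?thesis by (simp add: prob_simplex_def)
  qed
  have word_meas: "(*v) \<Phi> \<in> borel_measurable borel"
    by (intro borel_measurable_continuous_onI linear_continuous_on matrix_vector_mul_bounded_linear)
  have word_le: "\<bar>doc_word_counts N X Z d \<omega> $ w - real (N d \<omega>) * (\<Phi> *v \<theta> d \<omega>) $ w\<bar>
     \<le> (\<Sum>(k, w)\<in>UNIV \<times> {w}. \<bar>?C d k w \<omega> - real (N d \<omega>) * (\<theta> d \<omega> $ k * \<phi> k $ w)\<bar>)" for d w \<omega>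
  proof -
    have "doc_word_counts N X Z d \<omega> $ w - real (N d \<omega>) * (\<Phi> *v \<theta> d \<omega>) $ w
        = (\<Sum>k\<in>UNIV. ?C d k w \<omega> - real (N d \<omega>) * (\<theta> d \<omega> $ k * \<phi> k $ w))"
      by (simp add: doc_word_counts_def matrix_vector_mult_def \<Phi>_def topic_matrix_def sum_subtractf sum_distrib_left mult_ac)
    also have "\<bar>\<dots>\<bar> \<le> (\<Sum>k\<in>UNIV. \<bar>?C d k w \<omega> - real (N d \<omega>) * (\<theta> d \<omega> $ k * \<phi> k $ w)\<bar>)" by (rule sum_abs)
    finally show ?thesis by (simp add: sum.cartesian_product[symmetric])
  qed
  have topic_le: "\<bar>doc_topic_counts N X Z d \<omega> $ k - real (N d \<omega>) * \<theta> d \<omega> $ k\<bar>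
     \<le> (\<Sum>(k, w)\<in>{k} \<times> UNIV. \<bar>?C d k w \<omega> - real (N d \<omega>) * (\<theta> d \<omega> $ k * \<phi> k $ w)\<bar>)" for d k \<omega>
  proof -
    \<comment> \<open>The word probabilities of a topic sum to 1, so the means of its cells add up
      to the mean of the topic count.\<close>
    have "(\<Sum>w\<in>UNIV. real (N d \<omega>) * (\<theta> d \<omega> $ k * \<phi> k $ w)) = real (N d \<omega>) * \<theta> d \<omega> $ k"
      using topics[of k] by (simp add: sum_distrib_left[symmetric] mult.assoc[symmetric] prob_simplex_def)
    then have "doc_topic_counts N X Z d \<omega> $ k - real (N d \<omega>) * \<theta> d \<omega> $ k
        = (\<Sum>w\<in>UNIV. ?C d k w \<omega> - real (N d \<omega>) * (\<theta> d \<omega> $ k * \<phi> k $ w))"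
      by (simp add: doc_topic_counts_def sum_subtractf)
    also have "\<bar>\<dots>\<bar> \<le> (\<Sum>w\<in>UNIV. \<bar>?C d k w \<omega> - real (N d \<omega>) * (\<theta> d \<omega> $ k * \<phi> k $ w)\<bar>)" by (rule sum_abs)
    finally show ?thesis by (simp add: sum.cartesian_product[symmetric])
  qed
  have wm: "doc_word_counts N X Z d \<in> borel_measurable M" "doc_topic_counts N X Z d \<in> borel_measurable M" for d
    unfolding doc_word_counts_def doc_topic_counts_def using Cm by (auto intro!: borel_measurable_vecI)
  have wc: "doc_word_counts N X Z d \<omega> \<in> nonneg_orthant" "doc_topic_counts N X Z d \<omega> \<in> nonneg_orthant" for d \<omega>
    by (auto simp: nonneg_orthant_def doc_word_counts_def doc_topic_counts_def intro!: sum_nonneg)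
  have wt: "(\<Sum>w\<in>UNIV. doc_word_counts N X Z d \<omega> $ w) = real (N d \<omega>)" for d \<omega>
    by (simp add: doc_word_counts_def sum_token_count)
  have tt: "(\<Sum>k\<in>UNIV. doc_topic_counts N X Z d \<omega> $ k) = real (N d \<omega>)" for d \<omega>
    unfolding doc_topic_counts_def vec_lambda_beta sum_token_count[symmetric] by (rule sum.swap)
  note limits = document_counts_limits[OF iota scaling tail N_indep theta_law]
  note A = limits[OF word_meas word_simplex wm(1) wc(1) wt _ word_le]
  note B = limits[where g = "\<lambda>x. x", OF _ theta_simplex wm(2) wc(2) tt _ topic_le]

  have C: "(\<exists>\<upsilon>\<in>cone_measures nonneg_orthant {0}.
             MRV M (topic_word_counts N X Z k) \<iota> (b' k) \<upsilon> \<and>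
             (\<forall>f\<in>cone_test_functions nonneg_orthant {0}.
                (\<integral>x. f x \<partial>\<upsilon>) = (\<integral>y. f (y *\<^sub>R \<phi> k) \<partial>nu \<iota>))) \<and>
          (\<forall>q\<in>prob_simplex. polar_convergence M
             (\<lambda>t \<omega>. (proportions q (topic_total N X Z k \<omega>) (topic_word_counts N X Z k \<omega>),
                      topic_total N X Z k \<omega> / b' k t))
             (return (restrict_space borel prob_simplex) (\<phi> k) \<Otimes>\<^sub>M nu \<iota>))" for k
  proof -
    \<comment> \<open>\<kappa> is the number of documents times the \<iota>-th moment of a
      proportion of topic k: the factor by which the limit for \<open>b\<close> exceeds the one
      wanted. The constant in \<open>b' k\<close> is its \<iota>-th root.\<close>
    define \<kappa> where "\<kappa> = real CARD('d) * (Beta (\<alpha> k + \<iota>) (\<alpha>\<^sub>0 - \<alpha> k) / Beta (\<alpha> k) (\<alpha>\<^sub>0 - \<alpha> k))"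
    define s where "s = \<kappa> powr (1 / \<iota>)"
    \<comment> \<open>With at least two topics the other parameters have a positive sum, so both
      Beta values are quotients of positive Gamma values, in which
      \<open>Gamma (\<alpha>\<^sub>0 - \<alpha> k)\<close> cancels.\<close>
    have "card (UNIV - {k} :: 'k set) > 0" using two_topics by (simp add: card_Diff_singleton)
    then have "UNIV - {k} \<noteq> {}" by force
    then have "\<alpha>\<^sub>0 - \<alpha> k > 0"
      unfolding \<alpha>\<^sub>0_def using sum_pos[of "UNIV - {k}" \<alpha>] alpha by (subst sum.remove[of _ k]) simp_all
    then have \<kappa>_eq: "\<kappa> = real CARD('d) * (Gamma (\<alpha> k + \<iota>) * Gamma \<alpha>\<^sub>0 / (Gamma (\<alpha> k) * Gamma (\<alpha>\<^sub>0 + \<iota>)))"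
      and \<kappa>: "\<kappa> > 0"
    proof -
      assume a: "\<alpha>\<^sub>0 - \<alpha> k > 0"
      have pos: "Gamma (\<alpha>\<^sub>0 - \<alpha> k) > 0" "Gamma (\<alpha> k) > 0" "Gamma (\<alpha> k + \<iota>) > 0" "Gamma \<alpha>\<^sub>0 > 0" "Gamma (\<alpha>\<^sub>0 + \<iota>) > 0"
        using a alpha[of k] iota by (auto intro!: Gamma_real_pos)
      show "\<kappa> = real CARD('d) * (Gamma (\<alpha> k + \<iota>) * Gamma \<alpha>\<^sub>0 / (Gamma (\<alpha> k) * Gamma (\<alpha>\<^sub>0 + \<iota>)))"
        unfolding \<kappa>_def Beta_def using pos by (simp add: field_simps)
      then show "\<kappa> > 0" using pos by simp
    qed
    have s: "s > 0" "s powr \<iota> = \<kappa>" using \<kappa> iota by (auto simp: s_def powr_powr)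
    have b': "b' k = (\<lambda>t. s * b t)" by (simp add: b'_def s_def \<kappa>_def)
    have h: "(\<lambda>\<omega>. \<theta> d \<omega> $ k) \<in> borel_measurable M" "\<And>\<omega>. \<omega> \<in> space M \<Longrightarrow> 0 \<le> \<theta> d \<omega> $ k \<and> \<theta> d \<omega> $ k \<le> 1" for d
      using prob_simplex_le_1[OF theta_simplex] by auto
    have moment: "expectation (\<lambda>\<omega>. (\<theta> d \<omega> $ k) powr \<iota>) = \<kappa> / real CARD('d)" for d
    proof -
      have [measurable]: "(\<lambda>p::real ^ 'k. p $ k) \<in> borel_measurable borel"
        by (rule borel_measurable_vec_nth) simp
      have pm: "(\<lambda>p::real ^ 'k. ennreal (p $ k powr \<iota>)) \<in> borel_measurable borel" by measurable
      have "(\<integral>\<^sup>+\<omega>. ennreal ((\<theta> d \<omega> $ k) powr \<iota>) \<partial>M) = (\<integral>\<^sup>+p. ennreal (p $ k powr \<iota>) \<partial>distr M borel (\<theta> d))"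
        using pm by (subst nn_integral_distr) auto
      also have "\<dots> = ennreal (\<kappa> / real CARD('d))"
        unfolding theta_law dirichlet_moment[of \<alpha>, OF alpha iota] \<kappa>_eq \<alpha>\<^sub>0_def by simp
      finally show ?thesis using h \<kappa> by (subst integral_eq_nn_integral) auto
    qed
    \<comment> \<open>The random factor of a summand enters its radial part only, so the angular law
      is a point mass.\<close>
    let ?Q = "return (restrict_space borel prob_simplex) (\<phi> k)"
    have Q: "prob_space ?Q" "sets ?Q = sets (restrict_space borel prob_simplex)"
      using topics[of k] by (auto intro!: prob_space_return simp: space_restrict_space)
    have Qint: "(\<integral>y. (\<integral>p. f (y *\<^sub>R p) \<partial>?Q) \<partial>nu \<iota>) = (\<integral>y. f (y *\<^sub>R \<phi> k) \<partial>nu \<iota>)"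
      if "f \<in> cone_test_functions nonneg_orthant {0}" for f
      using topics[of k] measurable_test_function_ray[OF that]
      by (intro Bochner_Integration.integral_cong refl integral_return) (auto simp: nu_space[OF iota] space_restrict_space)
    let ?Y = "\<lambda>d \<omega>. (\<chi> w. ?C d k w \<omega>) :: real ^ 'w"
    have sumY: "topic_word_counts N X Z k = (\<lambda>\<omega>. \<Sum>d\<in>UNIV. ?Y d \<omega>)"
      by (auto simp: topic_word_counts_def vec_eq_iff fun_eq_iff)
    have Ym: "?Y d \<in> borel_measurable M" for d using Cm by (auto intro!: borel_measurable_vecI)
    have Yc: "?Y d \<omega> \<in> nonneg_orthant" for d \<omega> by (simp add: nonneg_orthant_def)
    have conv: "((\<lambda>t. t * expectation (\<lambda>\<omega>. zero_outside (nonneg_orthant - {0}) f ((1 / b' k t) *\<^sub>R topic_word_counts N X Z k \<omega>)))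
         \<longlongrightarrow> (\<integral>y. (\<integral>p. f (y *\<^sub>R p) \<partial>?Q) \<partial>nu \<iota>)) at_top"
      if f: "f \<in> cone_test_functions nonneg_orthant {0}" for f
    proof -
      \<comment> \<open>The factor s moves from \<open>b' k\<close> into the test function;
        rescaling the limit integral later gives back s^-\<iota> = 1 / \<kappa>.\<close>
      let ?f = "\<lambda>x. f ((1 / s) *\<^sub>R x)"
      have f': "?f \<in> cone_test_functions nonneg_orthant {0}" using s(1) by (intro test_function_scale f) simp
      have "((\<lambda>t. t * expectation (\<lambda>\<omega>. zero_outside (nonneg_orthant - {0}) ?f ((1 / b t) *\<^sub>R (\<Sum>d\<in>UNIV. ?Y d \<omega>))))
        \<longlongrightarrow> (\<Sum>d\<in>UNIV. \<integral>y. expectation (\<lambda>\<omega>. zero_outside (nonneg_orthant - {0}) ?f (y *\<^sub>R ((\<theta> d \<omega> $ k) *\<^sub>R \<phi> k))) \<partial>nu \<iota>)) at_top"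
      \<comment> \<open>Entry w of a summand is the count of one cell, hence the singleton
        \<open>J\<close>.\<close>
      proof (rule limit[where g = "\<lambda>x. (x $ k) *\<^sub>R \<phi> k" and J = "\<lambda>w. {(k, w)}" and Y = ?Y])
        show "(\<lambda>x. (x $ k) *\<^sub>R \<phi> k) \<in> borel_measurable borel"
          by (intro borel_measurable_continuous_onI continuous_intros)
        show "\<theta> d \<omega> $ k *\<^sub>R \<phi> k \<in> nonneg_orthant" if "\<omega> \<in> space M" for d \<omega>
          using h(2)[OF that] prob_simplex_le_1[OF topics] by (auto simp: nonneg_orthant_def)
        show "norm (\<theta> d \<omega> $ k *\<^sub>R \<phi> k) \<le> 1" if "\<omega> \<in> space M" for d \<omega>
          using h(2)[OF that, of d] norm_prob_simplex_le[OF topics[of k]] by (auto intro: mult_le_one)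
        show "?f \<in> cone_test_functions nonneg_orthant {0}" by (rule f')
      qed (use Ym Yc in auto)
      also have "(\<lambda>t. t * expectation (\<lambda>\<omega>. zero_outside (nonneg_orthant - {0}) ?f ((1 / b t) *\<^sub>R (\<Sum>d\<in>UNIV. ?Y d \<omega>))))
         = (\<lambda>t. t * expectation (\<lambda>\<omega>. zero_outside (nonneg_orthant - {0}) f ((1 / b' k t) *\<^sub>R topic_word_counts N X Z k \<omega>)))"
        using s(1) by (simp add: zero_outside_scale sumY b')
      \<comment> \<open>Every document contributes the same moment, and summing over the documents
        produces \<kappa>.\<close>
      also have "(\<Sum>d\<in>UNIV. \<integral>y. expectation (\<lambda>\<omega>. zero_outside (nonneg_orthant - {0}) ?f (y *\<^sub>R ((\<theta> d \<omega> $ k) *\<^sub>R \<phi> k))) \<partial>nu \<iota>)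
          = (\<Sum>d\<in>(UNIV :: 'd set). \<kappa> / real CARD('d) * (\<integral>y. ?f (y *\<^sub>R \<phi> k) \<partial>nu \<iota>))"
        by (intro sum.cong refl trans[OF radial_moment[OF f' iota h topics]] arg_cong2[where f = "(*)"] moment)
      also have "\<dots> = \<kappa> * (\<integral>y. ?f (y *\<^sub>R \<phi> k) \<partial>nu \<iota>)" by simp
      also have "(\<integral>y. ?f (y *\<^sub>R \<phi> k) \<partial>nu \<iota>) = (1 / s) powr \<iota> * (\<integral>y. f (y *\<^sub>R \<phi> k) \<partial>nu \<iota>)"
      proof -
        have "(\<lambda>y. f (y *\<^sub>R \<phi> k)) \<in> borel_measurable (restrict_space borel {0<..})"
        proof (rule measurable_compose[OF _ borel_measurable_zero_outside(2)[OF f orthant_borel]], rule measurable_restrict_space2)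
          show "(\<lambda>y. y *\<^sub>R \<phi> k) \<in> space (restrict_space borel {0<..}) \<rightarrow> nonneg_orthant - {0}"
            using prob_simplex_cone[OF topics[of k]] by (intro funcsetI) (simp only: space_restrict_space Int_iff greaterThan_iff)
          show "(\<lambda>y. y *\<^sub>R \<phi> k) \<in> borel_measurable (restrict_space borel {0<..})"
            by (intro measurable_restrict_space1 borel_measurable_continuous_onI continuous_intros)
        qed
        from integral_nu_scale[OF iota _ this, of "1 / s"] s(1) show ?thesis by simp
      qed
      also have "\<kappa> * ((1 / s) powr \<iota> * (\<integral>y. f (y *\<^sub>R \<phi> k) \<partial>nu \<iota>)) = (\<integral>y. f (y *\<^sub>R \<phi> k) \<partial>nu \<iota>)"
        using s \<kappa> by (simp add: powr_divide)
      finally show ?thesis unfolding Qint[OF f] .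
    qed
    have Zm: "topic_word_counts N X Z k \<in> borel_measurable M" unfolding sumY using Ym by simp
    have Zc: "topic_word_counts N X Z k \<omega> \<in> nonneg_orthant" for \<omega>
      by (auto simp: topic_word_counts_def nonneg_orthant_def intro!: sum_nonneg)
    have RV': "b' k \<in> RV (1 / \<iota>)" unfolding b' by (rule RV_cmult[OF scaling s(1)])
    note MP = MRV_polarI[OF Zm Zc iota RV' Q conv]
    have total: "topic_total N X Z k \<omega> = (\<Sum>w\<in>UNIV. topic_word_counts N X Z k \<omega> $ w)" for \<omega>
      unfolding topic_total_def topic_word_counts_def vec_lambda_beta by (rule sum.swap)
    show ?thesis
    proof (intro conjI bexI ballI)
      show "radial_measure ?Q \<iota> \<in> cone_measures nonneg_orthant {0}"
        by (rule radial_measure_in_cone_measures[OF Q iota])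
      show "MRV M (topic_word_counts N X Z k) \<iota> (b' k) (radial_measure ?Q \<iota>)" by (rule MP(1))
      show "integral\<^sup>L (radial_measure ?Q \<iota>) f = (\<integral>y. f (y *\<^sub>R \<phi> k) \<partial>nu \<iota>)"
        if f: "f \<in> cone_test_functions nonneg_orthant {0}" for f
        unfolding radial_integral[OF Q iota f] Qint[OF f] ..
      show "polar_convergence M
             (\<lambda>t \<omega>. (proportions q (topic_total N X Z k \<omega>) (topic_word_counts N X Z k \<omega>),
                      topic_total N X Z k \<omega> / b' k t)) (?Q \<Otimes>\<^sub>M nu \<iota>)" for q
        unfolding total by (rule MP(2))
    qed
  qed
  show ?thesis using A B C by (intro conjI allI) simp_all
qed

end
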